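(* Let $(\mathbf u,\mathbf u_1,\varphi,\varphi_1)\in\mathbf H^1_0(\Omega)\times\mathbf L^2[\Omega;\mathbf H^1_\sharp(Y^* )/\mathbb R]\times H^1_0(\Omega)\times L^2[\Omega;H^1_\sharp(Y^* )/\mathbb R]$ be the solution of the two-scale homogenized system $$-\frac{\partial}{\partial x_j}\Big[\int_{Y^*}\{c_{ijkl}(x,y)[s_{kl,x}(\mathbf u)+s_{kl,y}(\mathbf u_1)]+e_{kij}(x,y)[\partial_{k,x}\varphi+\partial_{k,y}\varphi_1]\}\,dy\Big]=\theta f_i(x)\ \text{ in }\Omega,$$ $$-\frac{\partial}{\partial x_i}\Big[\int_{Y^*}\{-e_{ikl}(x,y)[s_{kl,x}(\mathbf u)+s_{kl,y}(\mathbf u_1)]+d_{ij}(x,y)[\partial_{j,x}\varphi+\partial_{j,y}\varphi_1]\}\,dy\Big]=0\ \text{ in }\Omega,$$ $$-\frac{\partial}{\partial y_j}\{c_{ijkl}(x,y)[s_{kl,x}(\mathbf u)+s_{kl,y}(\mathbf u_1)]+e_{kij}(x,y)[\partial_{k,x}\varphi+\partial_{k,y}\varphi_1]\}=0\ \text{ in }\Omega\times Y^*,$$ $$-\frac{\partial}{\partial y_i}\{-e_{ikl}(x,y)[s_{kl,x}(\mathbf u)+s_{kl,y}(\mathbf u_1)]+d_{ij}(x,y)[\partial_{j,x}\varphi+\partial_{j,y}\varphi_1]\}=0\ \text{ in }\Omega\times Y^*,$$ with $\mathbf u=\mathbf 0$, $\varphi=0$ on $\partial\Omega$; $\{c_{ijkl}[s_{kl,x}(\mathbf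 u)+s_{kl,y}(\mathbf u_1)]+e_{kij}[\partial_{k,x}\varphi+\partial_{k,y}\varphi_1]\}n_j=0$ and $\{-e_{ikl}[s_{kl,x}(\mathbf u)+s_{kl,y}(\mathbf u_1)]+d_{ij}[\partial_{j,x}\varphi+\partial_{j,y}\varphi_1]\}n_i=0$ on $\partial Y^*-\partial Y$; and $\mathbf u_1,\varphi_1$ $Y$-periodic in $y$. Then $(\mathbf u,\varphi)$ is the solution of the homogenized problem $$-\mathbf{div}\,\sigma^H(\mathbf u,\varphi)=\theta\,\mathbf f\ \text{ in }\Omega,\qquad -\mathbf{div}\,D^H(\mathbf u,\varphi)=0\ \text{ in }\Omega,\qquad \mathbf u=\mathbf 0,\ \varphi=0\ \text{ on }\partial\Omega,$$ where $\sigma^H$ and $D^H$ are given by the homogenized constitutive law $$\sigma^H_{ij}(\mathbf u,\varphi)=c^H_{ijmh}\,s_{mh,x}(\mathbf u)+e^H_{nij}\frac{\partial\varphi}{\partial x_n},\qquad D^H_i(\mathbf u,\varphi)=-e^H_{imh}\,s_{mh,x}(\mathbf u)+d^H_{in}\frac{\partial\varphi}{\partial x_n},$$ with the homogenized coefficients $$c^H_{ijmh}=\Big\langle c_{ijkl}(x,y)[\tau^{kl}_{mh}+s_{kl,y}(\mathbf w^{mh})]+e_{kij}(x,y)\frac{\partial\varphi^{mh}}{\partial y_k}\Big\rangle,$$ $$e^H_{nij}=\Big\langle c_{ijkl}(x,y)s_{kl,y}(\mathbf q^n)+e_{kij}(x,y)\Big[\delta_{kn}+\frac{\partial\psi^n}{\partial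 y_k}\Big]\Big\rangle,$$ $$d^H_{in}=\Big\langle-e_{ikl}(x,y)s_{kl,y}(\mathbf q^n)+d_{ij}(x,y)\Big[\delta_{jn}+\frac{\partial\psi^n}{\partial y_j}\Big]\Big\rangle.$$
   Context: Indices run from 1 to 3 and repeated indices are summed (no summation is implied over $m,h,n$ when they merely label a cell function). Bold symbols denote $\mathbb R^3$-valued functions and spaces of such functions. Geometry: $\Omega\subset\mathbb R^3$ is a bounded domain; $Y=(0,1)^3$; $Y^*\subset Y$ is the material part of the cell, and the set $S^*$ obtained from $Y^*$ by $Y$-periodicity is a smooth connected open subset of $\mathbb R^3$; $\theta=|Y^*|$; $n$ with a spatial component index ($n_i,n_j$) is the unit normal on $\partial Y^*-\partial Y$. $\langle h\rangle=\int_{Y^*}h(y)\,dy$. Spaces and notation: $C_\sharp(Y)$ is the space of continuous $Y$-periodic functions; $H^1_\sharp(Y^* )$ is the space of $Y$-periodic $H^1$ functions on $Y^*$; $/\mathbb R$ is the quotient by constants (constant vectors in the vector case). $s_{kl}(\mathbf u)=\frac12(\partial_ku_l+\partial_lu_k)$; a subscript $x$ or $y$ (as in $s_{kl,x},s_{kl,y},\partial_{k,x},\partial_{k,y}$) indicates derivatives with respect to that variable. $(\mathbf{div}\,\sigma)^j=\partial_i\sigma_{ij}$, $\mathbf{div}\,D=\partial_iD_i$. $\delta_{ij}$ is the Kronecker symbol, $\tau^{kl}_{mh}=\frac12[\delta_{km}\delta_{lh}+\delta_{kh}\delta_{lm}]$. Data: $\mathbf f\in\mathbf L^2(\Omega)$;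 $c_{ijkl},e_{ijk},d_{ij}\in L^\infty(\Omega;C_\sharp(Y))$. Writing $c^\varepsilon_{ijkl}(x)=c_{ijkl}(x,x/\varepsilon)$, $e^\varepsilon_{ijk}(x)=e_{ijk}(x,x/\varepsilon)$, $d^\varepsilon_{ij}(x)=d_{ij}(x,x/\varepsilon)$, one assumes $c^\varepsilon_{ijkl}=c^\varepsilon_{jikl}=c^\varepsilon_{klij}=c^\varepsilon_{ijlk}$, $e^\varepsilon_{ijk}=e^\varepsilon_{ikj}$, $d^\varepsilon_{ij}=d^\varepsilon_{ji}$, and there are $\alpha_c,\alpha_d>0$ independent of $\varepsilon$ with $c^\varepsilon_{ijkl}X_{ij}X_{kl}\ge\alpha_cX_{ij}X_{ij}$ for all real symmetric $(X_{ij})$ and $d^\varepsilon_{ij}X_iX_j\ge\alpha_dX_iX_i$ for all real $(X_i)$. Cell problems ($x$ enters as a parameter): $\mathbf w^{mh},\varphi^{mh}$ are periodic in $y$ and solve $$-\frac{\partial}{\partial y_j}\Big\{c_{ijkl}[\tau^{kl}_{mh}+s_{kl,y}(\mathbf w^{mh})]+e_{kij}\frac{\partial\varphi^{mh}}{\partial y_k}\Big\}=0,\quad -\frac{\partial}{\partial y_i}\Big\{-e_{ikl}[\tau^{kl}_{mh}+s_{kl,y}(\mathbf w^{mh})]+d_{ij}\frac{\partial\varphi^{mh}}{\partial y_j}\Big\}=0\ \text{ in }Y^*,$$ and $\mathbf q^n,\psi^n$ are periodic in $y$ and solve $$-\frac{\partial}{\partial y_j}\Big\{c_{ijkl}s_{kl,y}(\mathbf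 q^n)+e_{kij}\Big[\delta_{kn}+\frac{\partial\psi^n}{\partial y_k}\Big]\Big\}=0,\quad -\frac{\partial}{\partial y_i}\Big\{-e_{ikl}s_{kl,y}(\mathbf q^n)+d_{ij}\Big[\delta_{jn}+\frac{\partial\psi^n}{\partial y_j}\Big]\Big\}=0\ \text{ in }Y^*,$$ with vanishing normal component of each bracketed flux on $\partial Y^*-\partial Y$. All equations are understood in the weak sense, with cell functions in $\mathbf H^1_\sharp(Y^* )/\mathbb R$ and $H^1_\sharp(Y^* )/\mathbb R$. *)

theory Defs
  imports "HOL-Analysis.Analysis"
begin

type_synonym R3 = "real^3"

section \<open>Smooth functions and weak derivatives\<close>

text \<open>\<open>D [k\<^sub>1, \<dots>, k\<^sub>r]\<close> is the partial derivative of \<open>f\<close> in the directions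
  \<open>k\<^sub>r, \<dots>, k\<^sub>1\<close>; all of them are required to be (Frechet) differentiable, so \<open>f\<close> is infinitely
  differentiable.\<close>

definition smooth :: "(R3 \<Rightarrow> real) \<Rightarrow> bool" where
  "smooth f \<longleftrightarrow> (\<exists>D :: 3 list \<Rightarrow> R3 \<Rightarrow> real. D [] = f \<and>
     (\<forall>ks x. (D ks has_derivative (\<lambda>h. \<Sum>k\<in>UNIV. h $ k * D (k # ks) x)) (at x)))"

definition pderiv_cl :: "3 \<Rightarrow> (R3 \<Rightarrow> real) \<Rightarrow> R3 \<Rightarrow> real" where
  "pderiv_cl k f x = frechet_derivative f (at x) (axis k 1)"

definition test_functions :: "R3 set \<Rightarrow> (R3 \<Rightarrow> real) set" where
  "test_functions A = {f. smooth f \<and>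
     compact (closure {x. f x \<noteq> 0}) \<and> closure {x. f x \<noteq> 0} \<subseteq> A}"

definition locally_integrable_in :: "R3 set \<Rightarrow> (R3 \<Rightarrow> real) \<Rightarrow> bool" where
  "locally_integrable_in A f \<longleftrightarrow> (\<forall>K. compact K \<and> K \<subseteq> A \<longrightarrow> set_integrable lebesgue K f)"

definition is_weak_deriv :: "R3 set \<Rightarrow> 3 \<Rightarrow> (R3 \<Rightarrow> real) \<Rightarrow> (R3 \<Rightarrow> real) \<Rightarrow> bool" where
  "is_weak_deriv A k v g \<longleftrightarrow> locally_integrable_in A v \<and> locally_integrable_in A g \<and>
     (\<forall>\<phi>\<in>test_functions A.
        (\<integral>x. v x * pderiv_cl k \<phi> x \<partial>lebesgue_on A) = - (\<integral>x. g x * \<phi> x \<partial>lebesgue_on A))"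

text \<open>A representative of the weak derivative, which is unique almost everywhere in \<open>A\<close>.
  All notions below depend only on its almost-everywhere class.\<close>

definition wderiv :: "R3 set \<Rightarrow> 3 \<Rightarrow> (R3 \<Rightarrow> real) \<Rightarrow> R3 \<Rightarrow> real" where
  "wderiv A k v = (SOME g. is_weak_deriv A k v g)"

definition strain :: "R3 set \<Rightarrow> (R3 \<Rightarrow> R3) \<Rightarrow> 3 \<Rightarrow> 3 \<Rightarrow> R3 \<Rightarrow> real" where
  "strain A v k l x = (wderiv A k (\<lambda>z. v z $ l) x + wderiv A l (\<lambda>z. v z $ k) x) / 2"


section \<open>Function spaces on the macroscopic domain\<close>

definition L2_on :: "R3 set \<Rightarrow> (R3 \<Rightarrow> real) set" where
  "L2_on A = {f. f \<in> borel_measurable (lebesgue_on A) \<and> integrable (lebesgue_on A) (\<lambda>x. (f x)\<^sup>2)}"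

definition H1 :: "R3 set \<Rightarrow> (R3 \<Rightarrow> real) set" where
  "H1 A = {v. v \<in> L2_on A \<and> (\<forall>k. \<exists>g. is_weak_deriv A k v g \<and> g \<in> L2_on A)}"

text \<open>The closure of the test functions in \<open>H1 A\<close>; membership encodes the homogeneous
  Dirichlet condition (no regularity of the boundary of \<open>A\<close> is needed).\<close>

definition H1_0 :: "R3 set \<Rightarrow> (R3 \<Rightarrow> real) set" where
  "H1_0 A = {v \<in> H1 A. \<exists>\<phi> :: nat \<Rightarrow> R3 \<Rightarrow> real. (\<forall>n. \<phi> n \<in> test_functions A) \<and>
     (\<lambda>n. \<integral>x. (\<phi> n x - v x)\<^sup>2 \<partial>lebesgue_on A) \<longlonglongrightarrow> 0 \<and>
     (\<forall>k. (\<lambda>n. \<integral>x. (pderiv_cl k (\<phi> n) x - wderiv A k v x)\<^sup>2 \<partial>lebesgue_on A) \<longlonglongrightarrow> 0)}"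


section \<open>Periodic geometry and periodic function spaces\<close>

definition unit_cell :: "R3 set" where
  "unit_cell = {y. \<forall>i. 0 < y $ i \<and> y $ i < 1}"

definition smooth_open_set :: "R3 set \<Rightarrow> bool" where
  "smooth_open_set S \<longleftrightarrow> open S \<and>
     (\<forall>p\<in>frontier S. \<exists>U \<rho>. open U \<and> p \<in> U \<and> smooth \<rho> \<and>
        \<not> (\<rho> has_derivative (\<lambda>h. 0)) (at p) \<and> S \<inter> U = {x \<in> U. \<rho> x < 0})"

text \<open>The translates of \<open>Y\<^sup>*\<close>, a subset of the open cell, do not cover the parts of \<open>S\<^sup>*\<close> on the
  cell faces.  Therefore the periodic set \<open>S = S\<^sup>*\<close> is taken as the primitive datum, and \<open>Y\<^sup>*\<close>
  is recovered as \<open>material S\<close>.\<close>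

definition material :: "R3 set \<Rightarrow> R3 set" where
  "material S = unit_cell \<inter> S"

definition periodic_material_set :: "R3 set \<Rightarrow> bool" where
  "periodic_material_set S \<longleftrightarrow> (\<forall>y k. y + axis k 1 \<in> S \<longleftrightarrow> y \<in> S) \<and>
     smooth_open_set S \<and> connected S \<and> S \<noteq> {}"

text \<open>\<open>H\<^sup>1\<^sub>\<sharp>(Y\<^sup>*)\<close>: a function on \<open>Y\<^sup>*\<close> is represented by its periodic extension to \<open>S\<close>.  Taking
  the weak derivatives on all of \<open>S\<close> encodes that the traces on opposite cell faces agree.\<close>

definition H1_per :: "R3 set \<Rightarrow> (R3 \<Rightarrow> real) set" where
  "H1_per S = {v. (\<forall>y\<in>S. \<forall>k. v (y + axis k 1) = v y) \<and> v \<in> L2_on (material S) \<and>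
     (\<forall>k. \<exists>g. is_weak_deriv S k v g \<and> g \<in> L2_on (material S))}"

definition H1_per_quot_norm :: "R3 set \<Rightarrow> (R3 \<Rightarrow> real) \<Rightarrow> real" where
  "H1_per_quot_norm S v = (INF a :: real.
     sqrt (\<integral>y. (v y - a)\<^sup>2 + (\<Sum>k\<in>UNIV. (wderiv S k v y)\<^sup>2) \<partial>lebesgue_on (material S)))"

text \<open>The Bochner space \<open>L\<^sup>2[\<Omega>; H\<^sup>1\<^sub>\<sharp>(Y\<^sup>*)/\<real>]\<close>: strongly measurable (almost everywhere limits of
  simple functions) with square integrable quotient norm.  Elements of the quotient are given by
  representatives \<open>v x\<close>, whose additive constant is arbitrary for each \<open>x\<close>.\<close>

definition L2_H1_per :: "R3 set \<Rightarrow> R3 set \<Rightarrow> (R3 \<Rightarrow> R3 \<Rightarrow> real) set" where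
  "L2_H1_per \<Omega> S = {v.
     (AE x in lebesgue_on \<Omega>. v x \<in> H1_per S) \<and>
     (\<exists>s :: nat \<Rightarrow> R3 \<Rightarrow> R3 \<Rightarrow> real.
        (\<forall>n. simple_function (lebesgue_on \<Omega>) (s n) \<and> (\<forall>x\<in>\<Omega>. s n x \<in> H1_per S)) \<and>
        (AE x in lebesgue_on \<Omega>. (\<lambda>n. H1_per_quot_norm S (\<lambda>y. v x y - s n x y)) \<longlonglongrightarrow> 0)) \<and>
     integrable (lebesgue_on \<Omega>) (\<lambda>x. (H1_per_quot_norm S (v x))\<^sup>2)}"

definition C_per :: "(R3 \<Rightarrow>\<^sub>C real) set" where
  "C_per = {g. \<forall>y k. apply_bcontfun g (y + axis k 1) = apply_bcontfun g y}"

text \<open>\<open>L\<^sup>\<infinity>(\<Omega>; C\<^sub>\<sharp>(Y))\<close>.  Since \<open>C_per\<close> is separable, Borel measurability is strong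
  measurability here.\<close>

definition Linf_C_per :: "R3 set \<Rightarrow> (R3 \<Rightarrow> (R3 \<Rightarrow>\<^sub>C real)) set" where
  "Linf_C_per \<Omega> = {a. a \<in> borel_measurable (lebesgue_on \<Omega>) \<and>
     (AE x in lebesgue_on \<Omega>. a x \<in> C_per) \<and>
     (\<exists>M. AE x in lebesgue_on \<Omega>. norm (a x) \<le> M)}"

definition oscillating :: "real \<Rightarrow> (R3 \<Rightarrow> (R3 \<Rightarrow>\<^sub>C real)) \<Rightarrow> R3 \<Rightarrow> real" where
  "oscillating \<epsilon> a x = apply_bcontfun (a x) ((1 / \<epsilon>) *\<^sub>R x)"


section \<open>Weak divergence equations\<close>

text \<open>\<open>- \<partial>F\<^sub>i/\<partial>x\<^sub>i = g\<close> in \<open>\<Omega>\<close>.\<close>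

definition weak_neg_div :: "R3 set \<Rightarrow> (3 \<Rightarrow> R3 \<Rightarrow> real) \<Rightarrow> (R3 \<Rightarrow> real) \<Rightarrow> bool" where
  "weak_neg_div \<Omega> F g \<longleftrightarrow> (\<forall>i. F i \<in> L2_on \<Omega>) \<and>
     (\<forall>v\<in>H1_0 \<Omega>. (\<integral>x. (\<Sum>i\<in>UNIV. F i x * wderiv \<Omega> i v x) \<partial>lebesgue_on \<Omega>)
                  = (\<integral>x. g x * v x \<partial>lebesgue_on \<Omega>))"

text \<open>\<open>- \<partial>F\<^sub>i/\<partial>y\<^sub>i = 0\<close> in \<open>Y\<^sup>*\<close>, with vanishing normal component on \<open>\<partial>Y\<^sup>* - \<partial>Y\<close> and periodicity as
  the natural conditions.\<close>

definition weak_neg_div_cell :: "R3 set \<Rightarrow> (3 \<Rightarrow> R3 \<Rightarrow> real) \<Rightarrow> bool" where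
  "weak_neg_div_cell S F \<longleftrightarrow> (\<forall>v\<in>H1_per S.
     (\<integral>y. (\<Sum>i\<in>UNIV. F i y * wderiv S i v y) \<partial>lebesgue_on (material S)) = 0)"

text \<open>The same in \<open>\<Omega> \<times> Y\<^sup>*\<close>.\<close>

definition weak_neg_div_two_scale :: "R3 set \<Rightarrow> R3 set \<Rightarrow> (3 \<Rightarrow> R3 \<Rightarrow> R3 \<Rightarrow> real) \<Rightarrow> bool" where
  "weak_neg_div_two_scale \<Omega> S F \<longleftrightarrow> (\<forall>v\<in>L2_H1_per \<Omega> S.
     (\<integral>x. (\<integral>y. (\<Sum>i\<in>UNIV. F i x y * wderiv S i (v x) y) \<partial>lebesgue_on (material S))
        \<partial>lebesgue_on \<Omega>) = 0)"


section \<open>Piezoelectric coefficients and constitutive laws\<close>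

type_synonym coef = "R3 \<Rightarrow> (R3 \<Rightarrow>\<^sub>C real)"

definition piezo_coefficients ::
  "R3 set \<Rightarrow> (3 \<Rightarrow> 3 \<Rightarrow> 3 \<Rightarrow> 3 \<Rightarrow> coef) \<Rightarrow> (3 \<Rightarrow> 3 \<Rightarrow> 3 \<Rightarrow> coef) \<Rightarrow> (3 \<Rightarrow> 3 \<Rightarrow> coef) \<Rightarrow>
   real \<Rightarrow> real \<Rightarrow> bool" where
  "piezo_coefficients \<Omega> c e d \<alpha>\<^sub>c \<alpha>\<^sub>d \<longleftrightarrow>
     (\<forall>i j k l. c i j k l \<in> Linf_C_per \<Omega>) \<and>
     (\<forall>i j k. e i j k \<in> Linf_C_per \<Omega>) \<and>
     (\<forall>i j. d i j \<in> Linf_C_per \<Omega>) \<and>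
     0 < \<alpha>\<^sub>c \<and> 0 < \<alpha>\<^sub>d \<and>
     (\<forall>\<epsilon>>0. AE x in lebesgue_on \<Omega>.
        (\<forall>i j k l. oscillating \<epsilon> (c i j k l) x = oscillating \<epsilon> (c j i k l) x \<and>
                   oscillating \<epsilon> (c i j k l) x = oscillating \<epsilon> (c k l i j) x \<and>
                   oscillating \<epsilon> (c i j k l) x = oscillating \<epsilon> (c i j l k) x) \<and>
        (\<forall>i j k. oscillating \<epsilon> (e i j k) x = oscillating \<epsilon> (e i k j) x) \<and>
        (\<forall>i j. oscillating \<epsilon> (d i j) x = oscillating \<epsilon> (d j i) x) \<and>
        (\<forall>X :: real^3^3. transpose X = X \<longrightarrow>
           (\<Sum>i\<in>UNIV. \<Sum>j\<in>UNIV. \<Sum>k\<in>UNIV. \<Sum>l\<in>UNIV.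
               oscillating \<epsilon> (c i j k l) x * X $ i $ j * X $ k $ l)
           \<ge> \<alpha>\<^sub>c * (\<Sum>i\<in>UNIV. \<Sum>j\<in>UNIV. X $ i $ j * X $ i $ j)) \<and>
        (\<forall>X :: real^3.
           (\<Sum>i\<in>UNIV. \<Sum>j\<in>UNIV. oscillating \<epsilon> (d i j) x * X $ i * X $ j)
           \<ge> \<alpha>\<^sub>d * (\<Sum>i\<in>UNIV. X $ i * X $ i)))"

text \<open>The local laws \<open>c\<^sub>i\<^sub>j\<^sub>k\<^sub>l \<xi>\<^sub>k\<^sub>l + e\<^sub>k\<^sub>i\<^sub>j E\<^sub>k\<close> and \<open>- e\<^sub>i\<^sub>k\<^sub>l \<xi>\<^sub>k\<^sub>l + d\<^sub>i\<^sub>j E\<^sub>j\<close> at \<open>(x, y)\<close>, for a strain \<open>\<xi>\<close>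
  and a potential gradient \<open>E\<close>.\<close>

definition stress ::
  "(3 \<Rightarrow> 3 \<Rightarrow> 3 \<Rightarrow> 3 \<Rightarrow> coef) \<Rightarrow> (3 \<Rightarrow> 3 \<Rightarrow> 3 \<Rightarrow> coef) \<Rightarrow> R3 \<Rightarrow> R3 \<Rightarrow>
   (3 \<Rightarrow> 3 \<Rightarrow> real) \<Rightarrow> (3 \<Rightarrow> real) \<Rightarrow> 3 \<Rightarrow> 3 \<Rightarrow> real" where
  "stress c e x y \<xi> E i j =
     (\<Sum>k\<in>UNIV. \<Sum>l\<in>UNIV. apply_bcontfun (c i j k l x) y * \<xi> k l) +
     (\<Sum>k\<in>UNIV. apply_bcontfun (e k i j x) y * E k)"

definition elec_disp ::
  "(3 \<Rightarrow> 3 \<Rightarrow> 3 \<Rightarrow> coef) \<Rightarrow> (3 \<Rightarrow> 3 \<Rightarrow> coef) \<Rightarrow> R3 \<Rightarrow> R3 \<Rightarrow>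
   (3 \<Rightarrow> 3 \<Rightarrow> real) \<Rightarrow> (3 \<Rightarrow> real) \<Rightarrow> 3 \<Rightarrow> real" where
  "elec_disp e d x y \<xi> E i =
     - (\<Sum>k\<in>UNIV. \<Sum>l\<in>UNIV. apply_bcontfun (e i k l x) y * \<xi> k l) +
     (\<Sum>j\<in>UNIV. apply_bcontfun (d i j x) y * E j)"

definition kdelta :: "3 \<Rightarrow> 3 \<Rightarrow> real" where
  "kdelta i j = (if i = j then 1 else 0)"

text \<open>\<open>tau m h k l\<close> is \<open>\<tau>\<^sup>k\<^sup>l\<^sub>m\<^sub>h\<close>.\<close>

definition tau :: "3 \<Rightarrow> 3 \<Rightarrow> 3 \<Rightarrow> 3 \<Rightarrow> real" where
  "tau m h k l = (kdelta k m * kdelta l h + kdelta k h * kdelta l m) / 2"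


section \<open>The two-scale homogenized system\<close>

definition two_scale_solution ::
  "R3 set \<Rightarrow> R3 set \<Rightarrow> (3 \<Rightarrow> 3 \<Rightarrow> 3 \<Rightarrow> 3 \<Rightarrow> coef) \<Rightarrow> (3 \<Rightarrow> 3 \<Rightarrow> 3 \<Rightarrow> coef) \<Rightarrow> (3 \<Rightarrow> 3 \<Rightarrow> coef) \<Rightarrow>
   (R3 \<Rightarrow> R3) \<Rightarrow> (R3 \<Rightarrow> R3) \<Rightarrow> (R3 \<Rightarrow> R3 \<Rightarrow> R3) \<Rightarrow> (R3 \<Rightarrow> real) \<Rightarrow> (R3 \<Rightarrow> R3 \<Rightarrow> real) \<Rightarrow> bool" where
  "two_scale_solution \<Omega> S c e d f u u\<^sub>1 \<phi> \<phi>\<^sub>1 \<longleftrightarrow>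
     (\<forall>i. (\<lambda>x. u x $ i) \<in> H1_0 \<Omega>) \<and>
     (\<forall>i. (\<lambda>x y. u\<^sub>1 x y $ i) \<in> L2_H1_per \<Omega> S) \<and>
     \<phi> \<in> H1_0 \<Omega> \<and>
     \<phi>\<^sub>1 \<in> L2_H1_per \<Omega> S \<and>
     (let \<sigma> = (\<lambda>i j x y. stress c e x y
                 (\<lambda>k l. strain \<Omega> u k l x + strain S (u\<^sub>1 x) k l y)
                 (\<lambda>k. wderiv \<Omega> k \<phi> x + wderiv S k (\<phi>\<^sub>1 x) y) i j);
          D = (\<lambda>i x y. elec_disp e d x y
                 (\<lambda>k l. strain \<Omega> u k l x + strain S (u\<^sub>1 x) k l y)
                 (\<lambda>k. wderiv \<Omega> k \<phi> x + wderiv S k (\<phi>\<^sub>1 x) y) i);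
          \<theta> = measure lebesgue (material S)
      in (\<forall>i. weak_neg_div \<Omega> (\<lambda>j x. \<integral>y. \<sigma> i j x y \<partial>lebesgue_on (material S))
                (\<lambda>x. \<theta> * f x $ i)) \<and>
         weak_neg_div \<Omega> (\<lambda>i x. \<integral>y. D i x y \<partial>lebesgue_on (material S)) (\<lambda>x. 0) \<and>
         (\<forall>i. weak_neg_div_two_scale \<Omega> S (\<lambda>j. \<sigma> i j)) \<and>
         weak_neg_div_two_scale \<Omega> S D)"


section \<open>Cell problems and the homogenized problem\<close>

text \<open>In the next two definitions \<open>w, p\<close> are the cell functions \<open>w\<^sup>m\<^sup>h, \<phi>\<^sup>m\<^sup>h\<close>, respectively
  \<open>q\<^sup>n, \<psi>\<^sup>n\<close>, at a fixed \<open>x\<close>.\<close>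

definition strain_cell_solution ::
  "R3 set \<Rightarrow> (3 \<Rightarrow> 3 \<Rightarrow> 3 \<Rightarrow> 3 \<Rightarrow> coef) \<Rightarrow> (3 \<Rightarrow> 3 \<Rightarrow> 3 \<Rightarrow> coef) \<Rightarrow> (3 \<Rightarrow> 3 \<Rightarrow> coef) \<Rightarrow>
   R3 \<Rightarrow> 3 \<Rightarrow> 3 \<Rightarrow> (R3 \<Rightarrow> R3) \<Rightarrow> (R3 \<Rightarrow> real) \<Rightarrow> bool" where
  "strain_cell_solution S c e d x m h w p \<longleftrightarrow>
     (\<forall>i. (\<lambda>y. w y $ i) \<in> H1_per S) \<and> p \<in> H1_per S \<and>
     (\<forall>i. weak_neg_div_cell S (\<lambda>j y. stress c e x y
        (\<lambda>k l. tau m h k l + strain S w k l y) (\<lambda>k. wderiv S k p y) i j)) \<and>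
     weak_neg_div_cell S (\<lambda>i y. elec_disp e d x y
        (\<lambda>k l. tau m h k l + strain S w k l y) (\<lambda>k. wderiv S k p y) i)"

definition potential_cell_solution ::
  "R3 set \<Rightarrow> (3 \<Rightarrow> 3 \<Rightarrow> 3 \<Rightarrow> 3 \<Rightarrow> coef) \<Rightarrow> (3 \<Rightarrow> 3 \<Rightarrow> 3 \<Rightarrow> coef) \<Rightarrow> (3 \<Rightarrow> 3 \<Rightarrow> coef) \<Rightarrow>
   R3 \<Rightarrow> 3 \<Rightarrow> (R3 \<Rightarrow> R3) \<Rightarrow> (R3 \<Rightarrow> real) \<Rightarrow> bool" where
  "potential_cell_solution S c e d x n w p \<longleftrightarrow>
     (\<forall>i. (\<lambda>y. w y $ i) \<in> H1_per S) \<and> p \<in> H1_per S \<and>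
     (\<forall>i. weak_neg_div_cell S (\<lambda>j y. stress c e x y
        (\<lambda>k l. strain S w k l y) (\<lambda>k. kdelta k n + wderiv S k p y) i j)) \<and>
     weak_neg_div_cell S (\<lambda>i y. elec_disp e d x y
        (\<lambda>k l. strain S w k l y) (\<lambda>k. kdelta k n + wderiv S k p y) i)"

definition hom_c ::
  "R3 set \<Rightarrow> (3 \<Rightarrow> 3 \<Rightarrow> 3 \<Rightarrow> 3 \<Rightarrow> coef) \<Rightarrow> (3 \<Rightarrow> 3 \<Rightarrow> 3 \<Rightarrow> coef) \<Rightarrow>
   (3 \<Rightarrow> 3 \<Rightarrow> R3 \<Rightarrow> R3 \<Rightarrow> R3) \<Rightarrow> (3 \<Rightarrow> 3 \<Rightarrow> R3 \<Rightarrow> R3 \<Rightarrow> real) \<Rightarrow> 3 \<Rightarrow> 3 \<Rightarrow> 3 \<Rightarrow> 3 \<Rightarrow> R3 \<Rightarrow> real" where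
  "hom_c S c e w p i j m h x = (\<integral>y. stress c e x y
     (\<lambda>k l. tau m h k l + strain S (w m h x) k l y)
     (\<lambda>k. wderiv S k (p m h x) y) i j \<partial>lebesgue_on (material S))"

definition hom_e ::
  "R3 set \<Rightarrow> (3 \<Rightarrow> 3 \<Rightarrow> 3 \<Rightarrow> 3 \<Rightarrow> coef) \<Rightarrow> (3 \<Rightarrow> 3 \<Rightarrow> 3 \<Rightarrow> coef) \<Rightarrow>
   (3 \<Rightarrow> R3 \<Rightarrow> R3 \<Rightarrow> R3) \<Rightarrow> (3 \<Rightarrow> R3 \<Rightarrow> R3 \<Rightarrow> real) \<Rightarrow> 3 \<Rightarrow> 3 \<Rightarrow> 3 \<Rightarrow> R3 \<Rightarrow> real" where
  "hom_e S c e q \<psi> n i j x = (\<integral>y. stress c e x y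
     (\<lambda>k l. strain S (q n x) k l y)
     (\<lambda>k. kdelta k n + wderiv S k (\<psi> n x) y) i j \<partial>lebesgue_on (material S))"

definition hom_d ::
  "R3 set \<Rightarrow> (3 \<Rightarrow> 3 \<Rightarrow> 3 \<Rightarrow> coef) \<Rightarrow> (3 \<Rightarrow> 3 \<Rightarrow> coef) \<Rightarrow>
   (3 \<Rightarrow> R3 \<Rightarrow> R3 \<Rightarrow> R3) \<Rightarrow> (3 \<Rightarrow> R3 \<Rightarrow> R3 \<Rightarrow> real) \<Rightarrow> 3 \<Rightarrow> 3 \<Rightarrow> R3 \<Rightarrow> real" where
  "hom_d S e d q \<psi> i n x = (\<integral>y. elec_disp e d x y
     (\<lambda>k l. strain S (q n x) k l y)
     (\<lambda>k. kdelta k n + wderiv S k (\<psi> n x) y) i \<partial>lebesgue_on (material S))"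

definition hom_stress ::
  "R3 set \<Rightarrow> (3 \<Rightarrow> 3 \<Rightarrow> 3 \<Rightarrow> 3 \<Rightarrow> R3 \<Rightarrow> real) \<Rightarrow> (3 \<Rightarrow> 3 \<Rightarrow> 3 \<Rightarrow> R3 \<Rightarrow> real) \<Rightarrow>
   (R3 \<Rightarrow> R3) \<Rightarrow> (R3 \<Rightarrow> real) \<Rightarrow> 3 \<Rightarrow> 3 \<Rightarrow> R3 \<Rightarrow> real" where
  "hom_stress \<Omega> cH eH u \<phi> i j x =
     (\<Sum>m\<in>UNIV. \<Sum>h\<in>UNIV. cH i j m h x * strain \<Omega> u m h x) +
     (\<Sum>n\<in>UNIV. eH n i j x * wderiv \<Omega> n \<phi> x)"

definition hom_elec_disp ::
  "R3 set \<Rightarrow> (3 \<Rightarrow> 3 \<Rightarrow> 3 \<Rightarrow> R3 \<Rightarrow> real) \<Rightarrow> (3 \<Rightarrow> 3 \<Rightarrow> R3 \<Rightarrow> real) \<Rightarrow>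
   (R3 \<Rightarrow> R3) \<Rightarrow> (R3 \<Rightarrow> real) \<Rightarrow> 3 \<Rightarrow> R3 \<Rightarrow> real" where
  "hom_elec_disp \<Omega> eH dH u \<phi> i x =
     - (\<Sum>m\<in>UNIV. \<Sum>h\<in>UNIV. eH i m h x * strain \<Omega> u m h x) +
     (\<Sum>n\<in>UNIV. dH i n x * wderiv \<Omega> n \<phi> x)"

definition homogenized_solution ::
  "R3 set \<Rightarrow> real \<Rightarrow> (R3 \<Rightarrow> R3) \<Rightarrow>
   (3 \<Rightarrow> 3 \<Rightarrow> 3 \<Rightarrow> 3 \<Rightarrow> R3 \<Rightarrow> real) \<Rightarrow> (3 \<Rightarrow> 3 \<Rightarrow> 3 \<Rightarrow> R3 \<Rightarrow> real) \<Rightarrow> (3 \<Rightarrow> 3 \<Rightarrow> R3 \<Rightarrow> real) \<Rightarrow>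
   (R3 \<Rightarrow> R3) \<Rightarrow> (R3 \<Rightarrow> real) \<Rightarrow> bool" where
  "homogenized_solution \<Omega> \<theta> f cH eH dH u \<phi> \<longleftrightarrow>
     (\<forall>i. (\<lambda>x. u x $ i) \<in> H1_0 \<Omega>) \<and> \<phi> \<in> H1_0 \<Omega> \<and>
     (\<forall>j. weak_neg_div \<Omega> (\<lambda>i. hom_stress \<Omega> cH eH u \<phi> i j) (\<lambda>x. \<theta> * f x $ j)) \<and>
     weak_neg_div \<Omega> (hom_elec_disp \<Omega> eH dH u \<phi>) (\<lambda>x. 0)"

end

theory Submission
  imports Defs "HOL-Computational_Algebra.Polynomial"
begin

text \<open>For almost every \<open>x\<close> the two-scale equations localize to the cell equations, because the
  gradients of periodic functions form a separable subset of \<open>L\<^sup>2(Y\<^sup>*)\<^sup>3\<close>.  By linearity, the correctors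
  \<open>(u\<^sub>1, \<phi>\<^sub>1)\<close> and the combination of the cell functions with weights \<open>s\<^sub>m\<^sub>h(u)\<close> and \<open>\<partial>\<^sub>n\<phi>\<close> then solve the same
  coercive cell problem, so they have the same fluxes; averaging gives \<open>\<sigma>\<^sup>H\<close> and \<open>D\<^sup>H\<close>, where \<open>e\<^sup>H\<close> enters \<open>D\<^sup>H\<close>
  through the reciprocity of the cell solutions.

  For uniqueness, the homogenized energy density of a strain \<open>\<xi>\<close> and a field \<open>E\<close> is the cell energy of the
  corrected state, hence nonnegative.  If it vanishes, then \<open>- \<xi>\<close> and \<open>- E\<close> are the strain and the gradient of
  periodic functions on the connected set \<open>S\<close>, which forces \<open>\<xi> = 0\<close> and \<open>E = 0\<close>.  So two solutions have the same
  strain and gradient, and they agree by the inequalities of Korn and Poincare.\<close>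

section \<open>Smooth functions\<close>

text \<open>Three obstacles shape the argument. Symmetry and ellipticity of the coefficients are
  assumed only along \<open>y = x / \<epsilon>\<close>, outside a null set that may depend on
  \<open>\<epsilon>\<close>; passing to the countably many values \<open>\<epsilon> = 1 / n\<close>
  and using density of the points \<open>n x\<close> modulo the lattice turns them into conditions
  at every \<open>y\<close>. Next, \<open>wderiv S k (v x)\<close> is chosen separately for each
  \<open>x\<close>, so nothing is known about joint measurability in \<open>(x, y)\<close>;
  localization works only with pairings against fixed functions of \<open>y\<close>, which inherit
  measurability from the simple functions in the definition of the Bochner space. Finally, the
  coupled bilinear form is coercive without being symmetric: the two coupling terms with
  \<open>e\<close> have opposite signs and cancel when a state is paired with itself, which leaves
  \<open>c\<close> and \<open>d\<close>. The same cancellation between two different states, with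
  stress taken from one and electric displacement from the other, yields reciprocity.\<close>

lemma smooth_coinduct:
  fixes f :: "R3 \<Rightarrow> real"
  assumes "f \<in> X"
    and step: "\<And>f. f \<in> X \<Longrightarrow> \<exists>g :: 3 \<Rightarrow> R3 \<Rightarrow> real. (\<forall>k. g k \<in> X) \<and>
      (\<forall>x. (f has_derivative (\<lambda>h. \<Sum>k\<in>UNIV. h $ k * g k x)) (at x))"
  shows "smooth f"
proof -
  define G where "G f = (SOME g :: 3 \<Rightarrow> R3 \<Rightarrow> real. (\<forall>k. g k \<in> X) \<and>
      (\<forall>x. (f has_derivative (\<lambda>h. \<Sum>k\<in>UNIV. h $ k * g k x)) (at x)))" for f
  have G: "(\<forall>k. G f k \<in> X) \<and>
      (\<forall>x. (f has_derivative (\<lambda>h. \<Sum>k\<in>UNIV. h $ k * G f k x)) (at x))" if "f \<in> X" for f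
    using someI_ex[OF step[OF that], folded G_def] .
  \<comment> \<open>Iterating one choice of partial derivatives produces the family that
    \<open>smooth\<close> asks for. The head of the list is the direction applied last, hence the
    fold from the right.\<close>
  define D where "D ks = foldr (\<lambda>k f. G f k) ks f" for ks
  have X: "D ks \<in> X" for ks
    by (induction ks) (use assms(1) G in \<open>auto simp: D_def\<close>)
  show ?thesis
    unfolding smooth_def
  proof (intro exI[of _ D] conjI allI)
    show "D [] = f" by (simp add: D_def)
    show "(D ks has_derivative (\<lambda>h. \<Sum>k\<in>UNIV. h $ k * D (k # ks) x)) (at x)" for ks x
      using G[OF X[of ks]] by (simp add: D_def)
  qed
qed

lemma smooth_partials:
  assumes "smooth f"
  shows "(f has_derivative (\<lambda>h. \<Sum>k\<in>UNIV. h $ k * pderiv_cl k f x)) (at x)"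
    and "smooth (pderiv_cl k f)"
proof -
  define P where "P D \<longleftrightarrow> D [] = f \<and>
      (\<forall>ks x. (D ks has_derivative (\<lambda>h. \<Sum>k\<in>UNIV. h $ k * D (k # ks) x)) (at x))"
    for D :: "3 list \<Rightarrow> R3 \<Rightarrow> real"
  have "\<exists>D. P D" using assms unfolding smooth_def P_def .
  then obtain D where PD: "P D" by (rule exE)
  have D0: "D [] = f" using PD[unfolded P_def] by (rule conjunct1)
  have D: "(D ks has_derivative (\<lambda>h. \<Sum>k\<in>UNIV. h $ k * D (k # ks) x)) (at x)" for ks x
    using spec[OF spec[OF PD[unfolded P_def, THEN conjunct2], of ks], of x] .
  have pd: "pderiv_cl k f = D [k]" for k
  proof
    fix x
    have "frechet_derivative f (at x) = (\<lambda>h. \<Sum>k\<in>UNIV. h $ k * D [k] x)"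
      using frechet_derivative_at[OF D[of "[]" x], symmetric] unfolding D0 .
    then show "pderiv_cl k f x = D [k] x"
      by (simp add: pderiv_cl_def axis_def if_distrib[of "\<lambda>t. t * _"] sum.delta cong: if_cong)
  qed
  show "(f has_derivative (\<lambda>h. \<Sum>k\<in>UNIV. h $ k * pderiv_cl k f x)) (at x)"
    using D[of "[]" x] unfolding D0 pd .
  show "smooth (pderiv_cl k f)"
    unfolding smooth_def pd
  \<comment> \<open>The last entry of a list is the direction differentiated first, so the family of
    the \<open>k\<close>-th partial derivative appends \<open>k\<close> at the end.\<close>
  proof (intro exI[of _ "\<lambda>ks. D (ks @ [k])"] conjI allI)
    show "(D (ks @ [k]) has_derivative (\<lambda>h. \<Sum>ka\<in>UNIV. h $ ka * D ((ka # ks) @ [k]) x)) (at x)" for ks x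
      using D[of "ks @ [k]" x] by (simp only: append_Cons)
  qed simp
qed

lemma pderiv_cl_eqI:
  assumes "(f has_derivative (\<lambda>h. \<Sum>k\<in>UNIV. h $ k * g k)) (at x)"
  shows "pderiv_cl k f x = g k"
proof -
  have "frechet_derivative f (at x) = (\<lambda>h. \<Sum>k\<in>UNIV. h $ k * g k)"
    using frechet_derivative_at[OF assms, symmetric] .
  then show ?thesis
    by (simp add: pderiv_cl_def axis_def if_distrib[of "\<lambda>t. t * _"] sum.delta cong: if_cong)
qed

lemma smooth_continuous: "smooth f \<Longrightarrow> continuous_on A f"
  by (meson smooth_partials(1) has_derivative_continuous continuous_at_imp_continuous_on)

lemma smooth_const: "smooth (\<lambda>x. c)"
proof (rule smooth_coinduct)
  show "(\<lambda>x. c) \<in> range (\<lambda>c x. c)" by auto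
  fix f :: "R3 \<Rightarrow> real" assume "f \<in> range (\<lambda>c x. c)"
  then show "\<exists>g :: 3 \<Rightarrow> R3 \<Rightarrow> real. (\<forall>k. g k \<in> range (\<lambda>c x. c)) \<and>
      (\<forall>x. (f has_derivative (\<lambda>h. \<Sum>k\<in>UNIV. h $ k * g k x)) (at x))"
    by (intro exI[of _ "\<lambda>k x. 0"]) auto
qed

text \<open>Products of smooth functions are not closed under differentiation, but by the Leibniz
  rule their sums are. This is the class to which the coinduction principle applies.\<close>

inductive_set sums_of_products :: "(R3 \<Rightarrow> real) set" where
  prod: "smooth f \<Longrightarrow> smooth g \<Longrightarrow> (\<lambda>x. f x * g x) \<in> sums_of_products"
| sum: "a \<in> sums_of_products \<Longrightarrow> b \<in> sums_of_products \<Longrightarrow> (\<lambda>x. a x + b x) \<in> sums_of_products"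

lemma smooth_sums_of_products:
  assumes "f \<in> sums_of_products"
  shows "smooth f"
proof (rule smooth_coinduct[OF assms])
  fix f assume "f \<in> sums_of_products"
  then show "\<exists>g :: 3 \<Rightarrow> R3 \<Rightarrow> real. (\<forall>k. g k \<in> sums_of_products) \<and>
      (\<forall>x. (f has_derivative (\<lambda>h. \<Sum>k\<in>UNIV. h $ k * g k x)) (at x))"
  proof induction
    case (prod f g)
    show ?case
    proof (intro exI conjI allI)
      show "(\<lambda>x. f x * pderiv_cl k g x + pderiv_cl k f x * g x) \<in> sums_of_products" for k
        using prod smooth_partials(2) by (intro sums_of_products.intros) auto
      show "((\<lambda>x. f x * g x) has_derivative
         (\<lambda>h. \<Sum>k\<in>UNIV. h $ k * (f x * pderiv_cl k g x + pderiv_cl k f x * g x))) (at x)" for x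
        by (rule has_derivative_eq_rhs[OF has_derivative_mult[OF smooth_partials(1)[OF prod(1)]
                smooth_partials(1)[OF prod(2)]]])
           (simp add: fun_eq_iff sum_distrib_left sum_distrib_right sum.distrib algebra_simps)
    qed
  next
    case (sum a b)
    then obtain ga gb :: "3 \<Rightarrow> R3 \<Rightarrow> real" where
      "\<forall>k. ga k \<in> sums_of_products" "\<forall>k. gb k \<in> sums_of_products"
      and a: "\<forall>x. (a has_derivative (\<lambda>h. \<Sum>k\<in>UNIV. h $ k * ga k x)) (at x)"
      and b: "\<forall>x. (b has_derivative (\<lambda>h. \<Sum>k\<in>UNIV. h $ k * gb k x)) (at x)"
      by blast
    moreover have "((\<lambda>x. a x + b x) has_derivative (\<lambda>h. \<Sum>k\<in>UNIV. h $ k * (ga k x + gb k x))) (at x)" for x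
      by (rule has_derivative_eq_rhs[OF has_derivative_add[OF a[rule_format] b[rule_format]]])
         (simp add: fun_eq_iff sum.distrib algebra_simps)
    ultimately show ?case
      by (intro exI[of _ "\<lambda>k x. ga k x + gb k x"] conjI) (auto intro: sums_of_products.sum)
  qed
qed

lemma smooth_mult: "smooth f \<Longrightarrow> smooth g \<Longrightarrow> smooth (\<lambda>x. f x * g x)"
  by (simp add: smooth_sums_of_products sums_of_products.prod)

lemma smooth_add: "smooth f \<Longrightarrow> smooth g \<Longrightarrow> smooth (\<lambda>x. f x + g x)"
  using smooth_sums_of_products[OF sums_of_products.sum[OF sums_of_products.prod[OF _ smooth_const[of 1]]
     sums_of_products.prod[OF _ smooth_const[of 1]]]] by simp

lemma smooth_cmult: "smooth f \<Longrightarrow> smooth (\<lambda>x. c * f x)"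
  using smooth_mult[OF smooth_const] .

lemma smooth_diff: "smooth f \<Longrightarrow> smooth g \<Longrightarrow> smooth (\<lambda>x. f x - g x)"
  using smooth_add[OF _ smooth_cmult[of g "-1"]] by simp

lemma smooth_prod: "(\<And>i. i \<in> I \<Longrightarrow> smooth (f i)) \<Longrightarrow> smooth (\<lambda>x. \<Prod>i\<in>I. f i x)"
  by (induction I rule: infinite_finite_induct) (auto intro: smooth_const smooth_mult)

lemma pderiv_cl_shift:
  assumes "smooth f" shows "pderiv_cl k (\<lambda>x. f (x + a)) x = pderiv_cl k f (x + a)"
proof (rule pderiv_cl_eqI)
  have "((\<lambda>x. x + a) has_derivative (\<lambda>h. h)) (at x)" by (auto intro!: derivative_eq_intros)
  from has_derivative_compose[OF this smooth_partials(1)[OF assms]]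
  show "((\<lambda>x. f (x + a)) has_derivative (\<lambda>h. \<Sum>k\<in>UNIV. h $ k * pderiv_cl k f (x + a))) (at x)" .
qed

lemma smooth_shift:
  assumes "smooth f" shows "smooth (\<lambda>x. f (x + a))"
proof (rule smooth_coinduct)
  let ?X = "{\<lambda>x. f (x + a) | f. smooth f}"
  show "(\<lambda>x. f (x + a)) \<in> ?X" using assms by auto
  fix g assume "g \<in> ?X"
  then obtain f where g: "g = (\<lambda>x. f (x + a))" and f: "smooth f" by auto
  have "((\<lambda>x. x + a) has_derivative (\<lambda>h. h)) (at x)" for x by (auto intro!: derivative_eq_intros)
  from has_derivative_compose[OF this smooth_partials(1)[OF f]]
  show "\<exists>d :: 3 \<Rightarrow> R3 \<Rightarrow> real. (\<forall>k. d k \<in> ?X) \<and>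
      (\<forall>x. (g has_derivative (\<lambda>h. \<Sum>k\<in>UNIV. h $ k * d k x)) (at x))"
    unfolding g
    by (intro exI[of _ "\<lambda>k x. pderiv_cl k f (x + a)"]) (auto intro!: smooth_partials(2)[OF f])
qed

lemma pderiv_cl_diff:
  assumes "smooth f" "smooth g"
  shows "pderiv_cl k (\<lambda>x. f x - g x) x = pderiv_cl k f x - pderiv_cl k g x"
  by (rule pderiv_cl_eqI, rule has_derivative_eq_rhs,
      rule has_derivative_diff[OF smooth_partials(1)[OF assms(1)] smooth_partials(1)[OF assms(2)]])
     (simp add: fun_eq_iff sum_subtractf algebra_simps)

lemma pderiv_cl_mult:
  assumes "smooth f" "smooth g"
  shows "pderiv_cl k (\<lambda>x. f x * g x) x = f x * pderiv_cl k g x + pderiv_cl k f x * g x"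
  by (rule pderiv_cl_eqI, rule has_derivative_eq_rhs,
      rule has_derivative_mult[OF smooth_partials(1)[OF assms(1)] smooth_partials(1)[OF assms(2)]])
     (simp add: fun_eq_iff sum_distrib_left sum_distrib_right sum.distrib algebra_simps)

lemma smooth_directional:
  assumes "smooth f"
  shows "((\<lambda>t. f (x + t *\<^sub>R axis k 1)) has_real_derivative pderiv_cl k f (x + t *\<^sub>R axis k 1)) (at t)"
proof -
  have "((\<lambda>t. x + t *\<^sub>R axis k 1) has_derivative (\<lambda>h. h *\<^sub>R axis k 1)) (at t)"
    by (auto intro!: derivative_eq_intros)
  from has_derivative_compose[OF this smooth_partials(1)[OF assms]]
  show ?thesis
    unfolding has_field_derivative_def
    by (rule has_derivative_eq_rhs)
       (auto simp: fun_eq_iff axis_def if_distrib[of "\<lambda>t. t * _"] if_distrib[of "\<lambda>t. _ * t"] sum.delta cong: if_cong)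
qed

text \<open>The mean value theorem is used twice, first in direction \<open>i\<close> for the
  increment in direction \<open>j\<close>, then in direction \<open>j\<close>. The left-hand side is
  symmetric in \<open>i\<close> and \<open>j\<close>, which is what makes the mixed derivatives
  commute.\<close>

lemma pderiv_cl_second_difference:
  assumes "smooth f" "0 < s"
  obtains a b where "0 < a" "a < s" "0 < b" "b < s"
    "f (x + s *\<^sub>R axis i 1 + s *\<^sub>R axis j 1) - f (x + s *\<^sub>R axis i 1) - f (x + s *\<^sub>R axis j 1) + f x
      = s * s * pderiv_cl j (pderiv_cl i f) (x + a *\<^sub>R axis i 1 + b *\<^sub>R axis j 1)"
proof -
  define e e' :: R3 where "e = axis i 1" "e' = axis j 1"
  define F where "F t = f (x + t *\<^sub>R e + s *\<^sub>R e') - f (x + t *\<^sub>R e)" for t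
  have F: "DERIV F t :> pderiv_cl i f (x + t *\<^sub>R e + s *\<^sub>R e') - pderiv_cl i f (x + t *\<^sub>R e)" for t
    using DERIV_diff[OF smooth_directional[OF assms(1), of "x + s *\<^sub>R e'" i t] smooth_directional[OF assms(1), of x i t]]
    by (simp add: F_def[abs_def] e_e'_def algebra_simps)
  obtain a where a: "0 < a" "a < s"
    and Fa: "F s - F 0 = (s - 0) * (pderiv_cl i f (x + a *\<^sub>R e + s *\<^sub>R e') - pderiv_cl i f (x + a *\<^sub>R e))"
    using MVT2[OF assms(2) F] by blast
  define g where "g t = pderiv_cl i f (x + a *\<^sub>R e + t *\<^sub>R e')" for t
  have g: "DERIV g t :> pderiv_cl j (pderiv_cl i f) (x + a *\<^sub>R e + t *\<^sub>R e')" for t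
    using smooth_directional[OF smooth_partials(2)[OF assms(1)], of i "x + a *\<^sub>R e" j t]
    by (simp add: g_def[abs_def] e_e'_def)
  obtain b where b: "0 < b" "b < s"
    and gb: "g s - g 0 = (s - 0) * pderiv_cl j (pderiv_cl i f) (x + a *\<^sub>R e + b *\<^sub>R e')"
    using MVT2[OF assms(2) g] by blast
  show ?thesis
    using that[OF a b] Fa gb by (simp add: F_def g_def e_e'_def algebra_simps)
qed

text \<open>Evaluating the same second difference in both orders gives the two mixed derivatives at
  two points within reach of the step size \<open>s n\<close>; continuity lets both points tend to
  \<open>x\<close>.\<close>

lemma pderiv_cl_commute:
  assumes "smooth f"
  shows "pderiv_cl i (pderiv_cl j f) x = pderiv_cl j (pderiv_cl i f) x"
proof -
  define s where "s n = 1 / real (Suc n)" for n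
  have s: "0 < s n" for n by (simp add: s_def)
  have s0: "s \<longlonglongrightarrow> 0" unfolding s_def by (rule LIMSEQ_Suc[OF lim_1_over_n])
  have "\<exists>a b. 0 < a \<and> a < s n \<and> 0 < b \<and> b < s n \<and>
      f (x + s n *\<^sub>R axis i 1 + s n *\<^sub>R axis j 1) - f (x + s n *\<^sub>R axis i 1) - f (x + s n *\<^sub>R axis j 1) + f x
      = s n * s n * pderiv_cl j (pderiv_cl i f) (x + a *\<^sub>R axis i 1 + b *\<^sub>R axis j 1)" for n
    using pderiv_cl_second_difference[OF assms s[of n], of x i j] by metis
  then obtain a b where ab: "\<And>n. 0 < a n \<and> a n < s n \<and> 0 < b n \<and> b n < s n"
    and 1: "\<And>n. f (x + s n *\<^sub>R axis i 1 + s n *\<^sub>R axis j 1) - f (x + s n *\<^sub>R axis i 1) - f (x + s n *\<^sub>R axis j 1) + f x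
      = s n * s n * pderiv_cl j (pderiv_cl i f) (x + a n *\<^sub>R axis i 1 + b n *\<^sub>R axis j 1)" by metis
  have "\<exists>a b. 0 < a \<and> a < s n \<and> 0 < b \<and> b < s n \<and>
      f (x + s n *\<^sub>R axis j 1 + s n *\<^sub>R axis i 1) - f (x + s n *\<^sub>R axis j 1) - f (x + s n *\<^sub>R axis i 1) + f x
      = s n * s n * pderiv_cl i (pderiv_cl j f) (x + a *\<^sub>R axis j 1 + b *\<^sub>R axis i 1)" for n
    using pderiv_cl_second_difference[OF assms s[of n], of x j i] by metis
  then obtain a' b' where ab': "\<And>n. 0 < a' n \<and> a' n < s n \<and> 0 < b' n \<and> b' n < s n"
    and 2: "\<And>n. f (x + s n *\<^sub>R axis j 1 + s n *\<^sub>R axis i 1) - f (x + s n *\<^sub>R axis j 1) - f (x + s n *\<^sub>R axis i 1) + f x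
      = s n * s n * pderiv_cl i (pderiv_cl j f) (x + a' n *\<^sub>R axis j 1 + b' n *\<^sub>R axis i 1)" by metis
  have lim: "(\<lambda>n. pderiv_cl k (pderiv_cl l f) (x + \<alpha> n *\<^sub>R v + \<beta> n *\<^sub>R w)) \<longlonglongrightarrow> pderiv_cl k (pderiv_cl l f) x"
    if "\<And>n. 0 < \<alpha> n \<and> \<alpha> n < s n \<and> 0 < \<beta> n \<and> \<beta> n < s n" for k l \<alpha> \<beta> v w
  proof -
    have "\<alpha> \<longlonglongrightarrow> 0" "\<beta> \<longlonglongrightarrow> 0"
      by (rule tendsto_sandwich[OF _ _ tendsto_const s0], use that in \<open>auto intro!: always_eventually less_imp_le\<close>)+
    then have "(\<lambda>n. x + \<alpha> n *\<^sub>R v + \<beta> n *\<^sub>R w) \<longlonglongrightarrow> x + 0 *\<^sub>R v + 0 *\<^sub>R w"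
      by (intro tendsto_intros)
    moreover have "isCont (pderiv_cl k (pderiv_cl l f)) x"
      using smooth_continuous[OF smooth_partials(2)[OF smooth_partials(2)[OF assms]], of UNIV]
      by (simp add: continuous_on_eq_continuous_at)
    ultimately show ?thesis
      using isCont_tendsto_compose[of x "pderiv_cl k (pderiv_cl l f)"] by simp
  qed
  have "pderiv_cl j (pderiv_cl i f) (x + a n *\<^sub>R axis i 1 + b n *\<^sub>R axis j 1)
     = pderiv_cl i (pderiv_cl j f) (x + a' n *\<^sub>R axis j 1 + b' n *\<^sub>R axis i 1)" for n
    using 1[of n] 2[of n] s[of n] by (simp add: algebra_simps)
  with lim[OF ab, of j i "axis i 1" "axis j 1"] lim[OF ab', of i j "axis j 1" "axis i 1"]
  show ?thesis using LIMSEQ_unique by simp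
qed

section \<open>Smooth bump functions on boxes\<close>

definition flat :: "real poly \<Rightarrow> real \<Rightarrow> real" where
  "flat q t = (if t > 0 then poly q (1 / t) * exp (- (1 / t)) else 0)"

lemma poly_exp_tendsto_0: "((\<lambda>s. poly q s * exp (- s)) \<longlongrightarrow> (0::real)) at_top"
proof -
  have "((\<lambda>s. \<Sum>i\<le>degree q. coeff q i * (s ^ i / exp s)) \<longlongrightarrow> (\<Sum>i\<le>degree q. coeff q i * 0)) at_top"
    by (intro tendsto_intros tendsto_power_div_exp_0)
  then show ?thesis
    by (simp add: poly_altdef sum_distrib_right sum_divide_distrib exp_minus field_simps)
qed

lemma flat_tendsto_0: "(flat q \<longlongrightarrow> 0) (at 0)"
proof -
  have "(flat q \<longlongrightarrow> 0) (at_right 0)"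
  proof (rule Lim_transform_eventually)
    show "((\<lambda>t. poly q (inverse t) * exp (- inverse t)) \<longlongrightarrow> 0) (at_right 0)"
      by (rule filterlim_compose[OF poly_exp_tendsto_0 filterlim_inverse_at_top_right])
    show "\<forall>\<^sub>F t in at_right 0. poly q (inverse t) * exp (- inverse t) = flat q t"
      unfolding flat_def by (simp add: eventually_at_filter inverse_eq_divide)
  qed
  moreover have "(flat q \<longlongrightarrow> 0) (at_left 0)"
    by (rule Lim_transform_eventually[OF tendsto_const]) (simp add: eventually_at_filter flat_def)
  ultimately show ?thesis by (simp add: filterlim_split_at)
qed

text \<open>In the variable \<open>s = 1 / t\<close> one has d/dt = - s^2 d/ds, which sends q(s)
  exp(-s) to s^2 (q(s) - q'(s)) exp(-s). So the polynomial factor keeps the family closed under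
  differentiation.\<close>

lemma flat_deriv: "(flat q has_real_derivative flat ([:0, 0, 1:] * (q - pderiv q)) t) (at t)"
proof -
  consider "t > 0" | "t < 0" | "t = 0" by linarith
  then show ?thesis
  proof cases
    case 1
    have "((\<lambda>t. poly q (1 / t) * exp (- (1 / t))) has_real_derivative
      flat ([:0, 0, 1:] * (q - pderiv q)) t) (at t)"
      using 1 by (auto intro!: derivative_eq_intros DERIV_chain'[where f = "\<lambda>t. 1 / t" and g = "poly q"] poly_DERIV
          simp: flat_def divide_simps power2_eq_square) (auto simp: algebra_simps)
    then show ?thesis
      by (rule DERIV_cong_ev[OF refl _ refl, THEN iffD1, rotated])
         (use 1 in \<open>auto simp: flat_def eventually_nhds intro!: exI[of _ "{0<..}"]\<close>)
  next
    case 2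
    have "((\<lambda>t. 0) has_real_derivative flat ([:0, 0, 1:] * (q - pderiv q)) t) (at t)"
      using 2 by (auto simp: flat_def)
    then show ?thesis
      by (rule DERIV_cong_ev[OF refl _ refl, THEN iffD1, rotated])
         (use 2 in \<open>auto simp: flat_def eventually_nhds intro!: exI[of _ "{..<0}"]\<close>)
  next
    case 3
    \<comment> \<open>Dividing by \<open>h\<close> multiplies the polynomial by the variable
      \<open>1 / h\<close>. At \<open>h = 0\<close> both sides are 0, the left one by division by
      zero.\<close>
    have "(\<lambda>h. (flat q (0 + h) - flat q 0) / h) = flat ([:0, 1:] * q)"
      by (auto simp: flat_def fun_eq_iff)
    then show ?thesis
      unfolding 3 DERIV_def using flat_tendsto_0[of "[:0, 1:] * q"] by (simp add: flat_def)
  qed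
qed

lemma smooth_flat: "smooth (\<lambda>x. flat q (a * x $ i + b))"
proof (rule smooth_coinduct)
  \<comment> \<open>The scalar \<open>c\<close> absorbs the chain rule factor \<open>a\<close>, and
    the value 0 in the directions other than \<open>i\<close>.\<close>
  let ?X = "{\<lambda>x :: R3. c * flat q (a * x $ i + b) | c q. True}"
  show "(\<lambda>x. flat q (a * x $ i + b)) \<in> ?X" by (auto intro!: exI[of _ 1] exI[of _ q])
  fix g assume "g \<in> ?X"
  then obtain c q where g: "g = (\<lambda>x. c * flat q (a * x $ i + b))" by auto
  let ?q = "[:0, 0, 1:] * (q - pderiv q)"
  have "(g has_derivative (\<lambda>h. \<Sum>k\<in>UNIV. h $ k * ((if k = i then c * a else 0) * flat ?q (a * x $ i + b)))) (at x)" for x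
  proof -
    have "((\<lambda>x. a * x $ i + b) has_derivative (\<lambda>h. a * h $ i)) (at x)"
      by (auto intro!: derivative_eq_intros bounded_linear.has_derivative[OF bounded_linear_vec_nth])
    from has_derivative_compose[OF this flat_deriv[unfolded has_field_derivative_def]]
    have "((\<lambda>x. flat q (a * x $ i + b)) has_derivative (\<lambda>h. flat ?q (a * x $ i + b) * (a * h $ i))) (at x)" .
    then have "((\<lambda>x. c * flat q (a * x $ i + b)) has_derivative (\<lambda>h. c * (flat ?q (a * x $ i + b) * (a * h $ i)))) (at x)"
      by (rule has_derivative_mult_right)
    then show ?thesis unfolding g
      by (rule has_derivative_eq_rhs)
         (auto simp: fun_eq_iff if_distrib[of "\<lambda>t. t * _"] if_distrib[of "\<lambda>t. _ * t"] sum.delta cong: if_cong)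
  qed
  then show "\<exists>d :: 3 \<Rightarrow> R3 \<Rightarrow> real. (\<forall>k. d k \<in> ?X) \<and>
      (\<forall>x. (g has_derivative (\<lambda>h. \<Sum>k\<in>UNIV. h $ k * d k x)) (at x))"
    by (intro exI[of _ "\<lambda>k x. (if k = i then c * a else 0) * flat ?q (a * x $ i + b)"] conjI allI) blast+
qed

text \<open>The parameter \<open>n\<close> steepens the factors without moving the support: for
  growing \<open>n\<close> the values tend to 1 inside the box, while they remain 0 outside.\<close>

definition box_bump :: "real \<Rightarrow> R3 \<Rightarrow> R3 \<Rightarrow> R3 \<Rightarrow> real" where
  "box_bump n a b x = (\<Prod>i\<in>UNIV. flat 1 (n * (x $ i - a $ i)) * flat 1 (n * (b $ i - x $ i)))"

lemma flat_1: "0 \<le> flat 1 t" "flat 1 t \<le> 1" "0 < flat 1 t \<longleftrightarrow> 0 < t" "flat 1 t = 0 \<longleftrightarrow> t \<le> 0"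
  by (auto simp: flat_def)

lemma smooth_box_bump: "smooth (box_bump n a b)"
proof -
  have "smooth (\<lambda>x. flat 1 (n * x $ i + (- n * a $ i)) * flat 1 ((- n) * x $ i + n * b $ i))" for i
    by (intro smooth_mult smooth_flat)
  then have "smooth (\<lambda>x. \<Prod>i\<in>UNIV. flat 1 (n * x $ i + (- n * a $ i)) * flat 1 ((- n) * x $ i + n * b $ i))"
    by (intro smooth_prod) 
  then show ?thesis by (simp add: box_bump_def[abs_def] algebra_simps)
qed

lemma box_bump_nonneg: "0 \<le> box_bump n a b x"
  unfolding box_bump_def by (intro prod_nonneg ballI mult_nonneg_nonneg flat_1)

lemma box_bump_le_1: "box_bump n a b x \<le> 1"
  unfolding box_bump_def by (intro prod_le_1 conjI mult_nonneg_nonneg mult_le_one flat_1)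

lemma box_bump_eq_0_iff: "n > 0 \<Longrightarrow> box_bump n a b x = 0 \<longleftrightarrow> x \<notin> box a b"
  by (auto simp: box_bump_def flat_1 mem_box_cart mult_le_0_iff not_less)

lemma support_box_bump: "n > 0 \<Longrightarrow> closure {x. box_bump n a b x \<noteq> 0} \<subseteq> cbox a b"
  by (simp add: box_bump_eq_0_iff closure_minimal box_subset_cbox closed_cbox)

lemma test_functions_box_bump:
  assumes "n > 0" "cbox a b \<subseteq> A"
  shows "box_bump n a b \<in> test_functions A"
proof -
  have "closure {x. box_bump n a b x \<noteq> 0} \<subseteq> cbox a b"
    by (rule support_box_bump) fact
  then show ?thesis
    using assms unfolding test_functions_def
    by (auto simp: smooth_box_bump intro: compact_closure[THEN iffD2] bounded_subset[OF bounded_cbox]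
        dest: subset_trans[OF closure_subset])
qed

lemma box_bump_tendsto_indicator: "(\<lambda>n. box_bump (real (Suc n)) a b x) \<longlonglongrightarrow> indicator (box a b) x"
proof (cases "x \<in> box a b")
  case True
  have "(\<lambda>n. flat 1 (real (Suc n) * t)) \<longlonglongrightarrow> 1" if "t > 0" for t
  proof -
    have "(\<lambda>n. exp (- (inverse (real (Suc n)) * (1 / t)))) \<longlonglongrightarrow> exp (- (0 * (1 / t)))"
      by (intro tendsto_intros LIMSEQ_inverse_real_of_nat)
    then show ?thesis using that by (simp add: flat_def divide_simps)
  qed
  then have "(\<lambda>n. box_bump (real (Suc n)) a b x) \<longlonglongrightarrow> (\<Prod>i\<in>(UNIV :: 3 set). 1 * 1)"
    unfolding box_bump_def using True by (intro tendsto_prod tendsto_mult) (auto simp: mem_box_cart)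
  then show ?thesis using True by simp
next
  case False
  then have "box_bump (real (Suc n)) a b x = 0" for n by (subst box_bump_eq_0_iff) auto
  then show ?thesis using False by simp
qed

section \<open>Integration by parts and the inequalities of Poincare and Korn\<close>

lemma smooth_coord: "smooth (\<lambda>x. x $ i)"
proof (rule smooth_coinduct)
  let ?X = "insert (\<lambda>x :: R3. x $ i) (range (\<lambda>c x. c))"
  show "(\<lambda>x. x $ i) \<in> ?X" by auto
  fix g assume "g \<in> ?X"
  then consider "g = (\<lambda>x. x $ i)" | c where "g = (\<lambda>x. c)" by auto
  then show "\<exists>d :: 3 \<Rightarrow> R3 \<Rightarrow> real. (\<forall>k. d k \<in> ?X) \<and>
      (\<forall>x. (g has_derivative (\<lambda>h. \<Sum>k\<in>UNIV. h $ k * d k x)) (at x))"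
  proof cases
    case 1
    then show ?thesis
      by (intro exI[of _ "\<lambda>k x. if k = i then 1 else 0"])
         (auto simp: if_distrib[of "\<lambda>t. _ * t"] sum.delta bounded_linear_imp_has_derivative[OF bounded_linear_vec_nth] cong: if_cong)
  next
    case 2
    then show ?thesis by (intro exI[of _ "\<lambda>k x. 0"]) auto
  qed
qed

lemma test_functions_smooth: "f \<in> test_functions A \<Longrightarrow> smooth f"
  by (simp add: test_functions_def)

lemma test_functions_support:
  assumes "f \<in> test_functions A" "smooth g" "\<And>x. g x \<noteq> 0 \<Longrightarrow> x \<in> closure {x. f x \<noteq> 0}"
  shows "g \<in> test_functions A"
proof -
  have "closure {x. g x \<noteq> 0} \<subseteq> closure {x. f x \<noteq> 0}"
    by (intro closure_minimal) (use assms(3) in auto)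
  then show ?thesis
    using assms(1,2) closed_Int_compact[of "closure {x. g x \<noteq> 0}" "closure {x. f x \<noteq> 0}"]
    unfolding test_functions_def by (auto simp: inf.absorb1)
qed

lemma test_functions_mult:
  "f \<in> test_functions A \<Longrightarrow> smooth g \<Longrightarrow> (\<lambda>x. f x * g x) \<in> test_functions A"
  by (rule test_functions_support[of f])
     (auto intro!: smooth_mult closure_subset[THEN subsetD] dest: test_functions_smooth)

lemma test_functions_diff:
  assumes "f \<in> test_functions A" "g \<in> test_functions A"
  shows "(\<lambda>x. f x - g x) \<in> test_functions A"
proof -
  have c: "closure {x. f x - g x \<noteq> 0} \<subseteq> closure {x. f x \<noteq> 0} \<union> closure {x. g x \<noteq> 0}"
    by (intro closure_minimal) (auto intro!: closure_subset[THEN subsetD])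
  have k: "compact (closure {x. f x \<noteq> 0} \<union> closure {x. g x \<noteq> 0})"
    using assms by (intro compact_Un) (simp_all only: test_functions_def mem_Collect_eq)
  have "compact (closure {x. f x - g x \<noteq> 0})"
    using closed_Int_compact[OF closed_closure k, of "{x. f x - g x \<noteq> 0}"] unfolding Int_absorb2[OF c] .
  moreover have "closure {x. f x - g x \<noteq> 0} \<subseteq> A"
    using assms c unfolding test_functions_def by blast
  moreover have "smooth (\<lambda>x. f x - g x)"
    using assms unfolding test_functions_def by (intro smooth_diff) blast+
  ultimately show ?thesis unfolding test_functions_def by blast
qed

lemma test_functions_pderiv_cl:
  assumes "f \<in> test_functions A"
  shows "pderiv_cl k f \<in> test_functions A"
proof (rule test_functions_support[OF assms])
  show "smooth (pderiv_cl k f)" using assms by (intro smooth_partials(2) test_functions_smooth)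
  fix x assume ne: "pderiv_cl k f x \<noteq> 0"
  show "x \<in> closure {x. f x \<noteq> 0}"
  proof (rule ccontr)
    assume x: "x \<notin> closure {x. f x \<noteq> 0}"
    have "((\<lambda>x. 0) has_derivative (\<lambda>h. 0)) (at x)" by simp
    then have "(f has_derivative (\<lambda>h. 0)) (at x)"
      by (rule has_derivative_transform_within_open[where s = "- closure {x. f x \<noteq> 0}"])
         (use x closure_subset[of "{x. f x \<noteq> 0}"] in auto)
    then show False using pderiv_cl_eqI[of f "\<lambda>k. 0" x k] ne by simp
  qed
qed

lemma test_functions_shift:
  assumes "f \<in> test_functions A" "\<And>x. x \<in> closure {x. f x \<noteq> 0} \<Longrightarrow> x - a \<in> B"
  shows "(\<lambda>x. f (x + a)) \<in> test_functions B"
proof -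
  have "{x. f (x + a) \<noteq> 0} = (+) (- a) ` {x. f x \<noteq> 0}"
    by (auto simp: image_iff intro!: exI[of _ "_ + a"])
  then have "closure {x. f (x + a) \<noteq> 0} = (+) (- a) ` closure {x. f x \<noteq> 0}"
    by (simp only: closure_translation)
  then show ?thesis
    using assms compact_translation[of "closure {x. f x \<noteq> 0}" "- a"]
    by (auto simp: test_functions_def smooth_shift simp del: compact_closure)
qed

lemma test_functions_integrable:
  assumes "f \<in> test_functions A"
  shows "integrable lebesgue f"
proof -
  let ?K = "closure {x. f x \<noteq> 0}"
  have "integrable lborel (\<lambda>x. indicator ?K x *\<^sub>R f x)"
    using assms by (intro borel_integrable_compact) (auto simp: test_functions_def intro: smooth_continuous)
  moreover have "(\<lambda>x. indicator ?K x *\<^sub>R f x) = f"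
    using closure_subset[of "{x. f x \<noteq> 0}"] by (auto simp: indicator_def fun_eq_iff)
  ultimately have "integrable lborel f" by (simp only:)
  then show ?thesis by (rule integrable_completion[THEN iffD2, rotated]) (use \<open>integrable lborel f\<close> in auto)
qed

lemma test_functions_bounded:
  assumes "f \<in> test_functions A"
  obtains C where "\<And>x. \<bar>f x\<bar> \<le> C" "C \<ge> 0"
proof -
  let ?K = "closure {x. f x \<noteq> 0}"
  have "compact (f ` ?K)"
    using assms by (intro compact_continuous_image) (auto simp: test_functions_def intro: smooth_continuous)
  then obtain C where C: "\<And>x. x \<in> ?K \<Longrightarrow> \<bar>f x\<bar> \<le> C"
    by (force dest: compact_imp_bounded simp: bounded_real)
  have "\<bar>f x\<bar> \<le> max C 0" for x
    using C[of x] closure_subset[of "{x. f x \<noteq> 0}"] by (cases "f x = 0") auto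
  then show ?thesis using that by (meson max.cobounded2)
qed

lemma integrable_lebesgue_shift:
  fixes f :: "R3 \<Rightarrow> real"
  assumes "integrable lebesgue f"
  shows "integrable lebesgue (\<lambda>x. f (x + a))" "(\<integral>x. f (x + a) \<partial>lebesgue) = (\<integral>x. f x \<partial>lebesgue)"
proof -
  have T: "(\<lambda>x :: R3. a + x) \<in> lebesgue \<rightarrow>\<^sub>M lebesgue"
    using lebesgue_affine_measurable[of "\<lambda>_. 1" a] by (simp add: euclidean_representation)
  have D: "lebesgue = distr lebesgue lebesgue (\<lambda>x. a + x)"
    using lebesgue_affine_euclidean[of "\<lambda>_. 1" a] by (simp add: euclidean_representation density_1)
  have f: "f \<in> borel_measurable lebesgue" using assms by auto
  show "integrable lebesgue (\<lambda>x. f (x + a))"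
    using integrable_distr_eq[OF T f] D assms by (simp add: add.commute)
  show "(\<integral>x. f (x + a) \<partial>lebesgue) = (\<integral>x. f x \<partial>lebesgue)"
    using integral_distr[OF T f] D by (simp add: add.commute)
qed

lemma lebesgue_integral_shift:
  fixes f :: "R3 \<Rightarrow> real"
  shows "(\<integral>x. f (x + a) \<partial>lebesgue) = (\<integral>x. f x \<partial>lebesgue)"
\<comment> \<open>Translation preserves non-integrability as well, and then both integrals have the
  default value 0.\<close>
proof (cases "integrable lebesgue f")
  case False
  then have "\<not> integrable lebesgue (\<lambda>x. f (x + a))"
    using integrable_lebesgue_shift(1)[of "\<lambda>x. f (x + a)" "- a"] by auto
  then show ?thesis using False by (simp add: not_integrable_integral_eq)
qed (rule integrable_lebesgue_shift(2))

text \<open>The partial derivative is a limit of difference quotients, and each of these has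
  integral 0 by translation invariance.\<close>

lemma integral_pderiv_cl_eq_0:
  assumes f: "f \<in> test_functions A"
  shows "(\<integral>x. pderiv_cl k f x \<partial>lebesgue) = 0"
proof -
  let ?K = "closure {x. f x \<noteq> 0}"
  obtain R where R: "\<And>x. x \<in> ?K \<Longrightarrow> norm x \<le> R"
  proof -
    have "bounded ?K" using f by (intro compact_imp_bounded) (simp only: test_functions_def mem_Collect_eq)
    then show ?thesis using that unfolding bounded_iff by blast
  qed
  obtain C where C: "\<And>x. \<bar>pderiv_cl k f x\<bar> \<le> C" "C \<ge> 0"
    using test_functions_bounded[OF test_functions_pderiv_cl[OF f]] by metis
  define h where "h n = inverse (real (Suc n))" for n
  have h: "0 < h n" "h n \<le> 1" for n by (auto simp: h_def inverse_le_1_iff)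
  define g where "g n x = (f (x + h n *\<^sub>R axis k 1) - f x) / h n" for n x
  have fK: "f x = 0" if "norm x > R" for x
    using R closure_subset[of "{x. f x \<noteq> 0}"] that by force
  have fint: "integrable lebesgue f" by (rule test_functions_integrable[OF f])
  have "(\<lambda>n. \<integral>x. g n x \<partial>lebesgue) \<longlonglongrightarrow> (\<integral>x. pderiv_cl k f x \<partial>lebesgue)"
  \<comment> \<open>The steps \<open>h n\<close> are at most 1, so all difference quotients vanish
    outside the ball of radius \<open>R + 1\<close>; the mean value theorem bounds them by
    \<open>C\<close>.\<close>
  proof (rule integral_dominated_convergence[where w = "\<lambda>x. C * indicator (cball 0 (R + 1)) x"])
    show "pderiv_cl k f \<in> borel_measurable lebesgue"
      using test_functions_integrable[OF test_functions_pderiv_cl[OF f]] by auto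
    show "g n \<in> borel_measurable lebesgue" for n
      using integrable_lebesgue_shift(1)[OF fint] fint unfolding g_def
      by (intro borel_measurable_divide borel_measurable_diff) auto
    show "integrable lebesgue (\<lambda>x :: R3. C * indicator (cball 0 (R + 1)) x)"
      using emeasure_compact_finite[of "cball (0 :: R3) (R + 1)"]
      by (intro integrable_mult_right integrable_real_indicator) auto
    show "AE x in lebesgue. (\<lambda>n. g n x) \<longlonglongrightarrow> pderiv_cl k f x"
    proof (rule AE_I2)
      fix x
      have "((\<lambda>t. (f (x + t *\<^sub>R axis k 1) - f x) / t) \<longlongrightarrow> pderiv_cl k f x) (at 0)"
        using smooth_directional[OF test_functions_smooth[OF f], of x k 0] unfolding DERIV_def by simp
      moreover have "filterlim h (at 0) sequentially"
        unfolding filterlim_at using LIMSEQ_inverse_real_of_nat h(1) less_imp_neq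
        by (auto simp: h_def[abs_def])
      ultimately show "(\<lambda>n. g n x) \<longlonglongrightarrow> pderiv_cl k f x"
        unfolding g_def by (rule filterlim_compose)
    qed
    show "AE x in lebesgue. norm (g n x) \<le> C * indicator (cball 0 (R + 1)) x" for n
    proof (rule AE_I2)
      fix x
      show "norm (g n x) \<le> C * indicator (cball 0 (R + 1)) x"
      proof (cases "norm x \<le> R + 1")
        case True
        obtain t where "f (x + h n *\<^sub>R axis k 1) - f (x + 0 *\<^sub>R axis k 1) = (h n - 0) * pderiv_cl k f (x + t *\<^sub>R axis k 1)"
          using MVT2[OF h(1), where f = "\<lambda>t. f (x + t *\<^sub>R axis k 1)" and f' = "\<lambda>t. pderiv_cl k f (x + t *\<^sub>R axis k 1)"]
            smooth_directional[OF test_functions_smooth[OF f]] by metis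
        then have "g n x = pderiv_cl k f (x + t *\<^sub>R axis k 1)" using h(1)[of n] by (simp add: g_def)
        then show ?thesis using C True by simp
      next
        case False
        have "norm x \<le> norm (x + h n *\<^sub>R axis k 1) + norm (h n *\<^sub>R axis k 1 :: R3)"
          using norm_triangle_ineq4[of "x + h n *\<^sub>R axis k 1" "h n *\<^sub>R axis k 1"] by simp
        then have "norm (x + h n *\<^sub>R axis k 1) > R" using False h[of n] by (simp add: norm_axis_1)
        then show ?thesis using False fK by (simp add: g_def)
      qed
    qed
  qed
  moreover have "(\<integral>x. g n x \<partial>lebesgue) = 0" for n
    unfolding g_def using integrable_lebesgue_shift[OF fint] fint
    by (simp add: Bochner_Integration.integral_diff)
  ultimately show ?thesis by (simp add: LIMSEQ_const_iff)
qed

lemma integral_by_parts: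
  assumes f: "f \<in> test_functions A" and g: "smooth g"
  shows "(\<integral>x. f x * pderiv_cl k g x \<partial>lebesgue) = - (\<integral>x. pderiv_cl k f x * g x \<partial>lebesgue)"
proof -
  have 1: "integrable lebesgue (\<lambda>x. f x * pderiv_cl k g x)" "integrable lebesgue (\<lambda>x. pderiv_cl k f x * g x)"
    using f g by (auto intro!: test_functions_integrable[of _ A] test_functions_mult test_functions_pderiv_cl smooth_partials(2))
  have "(\<integral>x. pderiv_cl k (\<lambda>x. f x * g x) x \<partial>lebesgue) = 0"
    by (rule integral_pderiv_cl_eq_0[OF test_functions_mult[OF f g]])
  then show ?thesis
    using 1 by (simp add: pderiv_cl_mult[OF test_functions_smooth[OF f] g] Bochner_Integration.integral_add)
qed

text \<open>Writing the square of \<open>f\<close> as its product with the derivative 1 of the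
  coordinate \<open>x $ k\<close> and integrating by parts leaves a mixed term. Young's inequality
  bounds it by half of the left-hand side plus \<open>2 * R\<^sup>2\<close> times the gradient term;
  absorbing the half doubles this constant to 4.\<close>

lemma poincare:
  assumes f: "f \<in> test_functions A" and R: "\<And>x. x \<in> A \<Longrightarrow> \<bar>x $ k\<bar> \<le> R"
  shows "(\<integral>x. (f x)\<^sup>2 \<partial>lebesgue) \<le> 4 * R\<^sup>2 * (\<integral>x. (pderiv_cl k f x)\<^sup>2 \<partial>lebesgue)"
proof -
  note sf = test_functions_smooth[OF f]
  have ff: "(\<lambda>x. f x * f x) \<in> test_functions A" by (rule test_functions_mult[OF f sf])
  have dd: "(\<lambda>x. pderiv_cl k f x * pderiv_cl k f x) \<in> test_functions A"
    by (intro test_functions_mult test_functions_pderiv_cl f smooth_partials(2) sf)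
  have c: "pderiv_cl k (\<lambda>x. x $ k) x = 1" for x :: R3
  proof -
    have "((\<lambda>x. x $ k) has_derivative (\<lambda>h. \<Sum>j\<in>UNIV. h $ j * (if j = k then 1 else 0))) (at x)"
      by (auto simp: if_distrib[of "\<lambda>t. _ * t"] sum.delta bounded_linear_imp_has_derivative[OF bounded_linear_vec_nth] cong: if_cong)
    from pderiv_cl_eqI[where g = "\<lambda>j. if j = k then 1 else 0", OF this, of k] show ?thesis by simp
  qed
  have d: "pderiv_cl k (\<lambda>x. f x * f x) x = 2 * f x * pderiv_cl k f x" for x
    using pderiv_cl_mult[OF sf sf] by simp
  have "(\<integral>x. f x * f x \<partial>lebesgue) = - (\<integral>x. 2 * f x * pderiv_cl k f x * x $ k \<partial>lebesgue)"
    using integral_by_parts[OF ff smooth_coord[of k], of k] by (simp add: c d)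
  also have "\<dots> = (\<integral>x. - (2 * f x * pderiv_cl k f x * x $ k) \<partial>lebesgue)" by simp
  also have "\<dots> \<le> (\<integral>x. f x * f x / 2 + 2 * R\<^sup>2 * (pderiv_cl k f x * pderiv_cl k f x) \<partial>lebesgue)"
  proof (rule integral_mono)
    have "(\<lambda>x. f x * pderiv_cl k f x * x $ k) \<in> test_functions A"
      by (intro test_functions_mult f smooth_partials(2) sf smooth_coord)
    from integrable_mult_right[OF test_functions_integrable[OF this], of "-2"]
    show "integrable lebesgue (\<lambda>x. - (2 * f x * pderiv_cl k f x * x $ k))" by (simp add: mult.assoc)
    show "integrable lebesgue (\<lambda>x. f x * f x / 2 + 2 * R\<^sup>2 * (pderiv_cl k f x * pderiv_cl k f x))"
      using test_functions_integrable[OF ff] test_functions_integrable[OF dd] by auto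
    fix x
    show "- (2 * f x * pderiv_cl k f x * x $ k) \<le> f x * f x / 2 + 2 * R\<^sup>2 * (pderiv_cl k f x * pderiv_cl k f x)"
    proof (cases "x \<in> A")
      case True
      have "(x $ k)\<^sup>2 \<le> R\<^sup>2" using R[OF True] abs_le_square_iff[of "x $ k" R] by simp
      then have "2 * (x $ k)\<^sup>2 * (pderiv_cl k f x)\<^sup>2 \<le> 2 * R\<^sup>2 * (pderiv_cl k f x)\<^sup>2"
        by (intro mult_right_mono mult_left_mono) auto
      \<comment> \<open>Expanding this completed square gives exactly Young's inequality with the
        weights 1/2 and 2.\<close>
      moreover have "0 \<le> (f x + 2 * (x $ k) * pderiv_cl k f x)\<^sup>2 / 2" by simp
      ultimately show ?thesis by (simp add: power2_eq_square algebra_simps)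
    next
      case False
      then have "f x = 0" using f closure_subset[of "{x. f x \<noteq> 0}"] by (auto simp: test_functions_def)
      then show ?thesis by simp
    qed
  qed
  also have "\<dots> = (\<integral>x. f x * f x \<partial>lebesgue) / 2 + 2 * R\<^sup>2 * (\<integral>x. pderiv_cl k f x * pderiv_cl k f x \<partial>lebesgue)"
    using test_functions_integrable[OF ff] test_functions_integrable[OF dd] by simp
  finally show ?thesis by (simp add: power2_eq_square)
qed

text \<open>Two integrations by parts exchange the derivatives in the product of
  \<open>pderiv_cl i (f j)\<close> and \<open>pderiv_cl j (f i)\<close>, so the sum of these cross
  terms is the integral of the squared divergence, which is nonnegative. Expanding the square on the
  right then leaves at least twice the squared gradient.\<close>

lemma korn_first:
  fixes f :: "3 \<Rightarrow> R3 \<Rightarrow> real"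
  assumes f: "\<And>j. f j \<in> test_functions A"
  shows "(\<integral>x. (\<Sum>i\<in>UNIV. \<Sum>j\<in>UNIV. (pderiv_cl i (f j) x)\<^sup>2) \<partial>lebesgue)
    \<le> (\<integral>x. (\<Sum>i\<in>UNIV. \<Sum>j\<in>UNIV. (pderiv_cl i (f j) x + pderiv_cl j (f i) x)\<^sup>2) \<partial>lebesgue) / 2"
proof -
  define a where "a i j x = pderiv_cl i (f j) x" for i j x
  have ta: "a i j \<in> test_functions A" for i j
    unfolding a_def using f by (auto intro: test_functions_pderiv_cl)
  have int: "integrable lebesgue (\<lambda>x. a i j x * a k l x)" for i j k l
    by (rule test_functions_integrable[OF test_functions_mult[OF ta test_functions_smooth[OF ta]]])
  have swap: "(\<integral>x. a i j x * a j i x \<partial>lebesgue) = (\<integral>x. a j j x * a i i x \<partial>lebesgue)" for i j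
  proof -
    have "(\<integral>x. a i j x * a j i x \<partial>lebesgue) = - (\<integral>x. f j x * pderiv_cl i (a j i) x \<partial>lebesgue)"
      using integral_by_parts[OF f test_functions_smooth[OF ta], of j i j i] by (simp add: a_def[abs_def])
    also have "\<dots> = - (\<integral>x. f j x * pderiv_cl j (a i i) x \<partial>lebesgue)"
      by (simp add: a_def[abs_def] pderiv_cl_commute[OF test_functions_smooth[OF f], of i j])
    also have "\<dots> = (\<integral>x. a j j x * a i i x \<partial>lebesgue)"
      using integral_by_parts[OF f test_functions_smooth[OF ta], of j j i i] by (simp add: a_def[abs_def])
    finally show ?thesis .
  qed
  have "(\<Sum>i\<in>UNIV. \<Sum>j\<in>UNIV. \<integral>x. a i j x * a j i x \<partial>lebesgue)
      = (\<Sum>i\<in>UNIV. \<Sum>j\<in>UNIV. \<integral>x. a j j x * a i i x \<partial>lebesgue)"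
    by (intro sum.cong refl swap)
  also have "\<dots> = (\<integral>x. (\<Sum>i\<in>UNIV. \<Sum>j\<in>UNIV. a j j x * a i i x) \<partial>lebesgue)"
    by (simp add: int Bochner_Integration.integral_sum)
  also have "\<dots> = (\<integral>x. (\<Sum>i\<in>UNIV. a i i x)\<^sup>2 \<partial>lebesgue)"
    by (subst sum.swap) (simp add: power2_eq_square sum_product)
  finally have nonneg: "0 \<le> (\<Sum>i\<in>UNIV. \<Sum>j\<in>UNIV. \<integral>x. a i j x * a j i x \<partial>lebesgue)" by simp
  have flip: "(\<Sum>i\<in>UNIV. \<Sum>j\<in>UNIV. \<integral>x. a j i x * a j i x \<partial>lebesgue)
     = (\<Sum>i\<in>UNIV. \<Sum>j\<in>UNIV. \<integral>x. a i j x * a i j x \<partial>lebesgue)" by (rule sum.swap)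
  have "(\<integral>x. (\<Sum>i\<in>UNIV. \<Sum>j\<in>UNIV. (a i j x + a j i x)\<^sup>2) \<partial>lebesgue)
     = (\<Sum>i\<in>UNIV. \<Sum>j\<in>UNIV. (\<integral>x. a i j x * a i j x \<partial>lebesgue) + 2 * (\<integral>x. a i j x * a j i x \<partial>lebesgue)
         + (\<integral>x. a j i x * a j i x \<partial>lebesgue))"
  proof -
    have "(a i j x + a j i x)\<^sup>2 = a i j x * a i j x + 2 * (a i j x * a j i x) + a j i x * a j i x" for i j x
      by (simp add: power2_eq_square algebra_simps)
    then show ?thesis using int by (simp add: Bochner_Integration.integral_sum)
  qed
  also have "\<dots> \<ge> 2 * (\<Sum>i\<in>UNIV. \<Sum>j\<in>UNIV. \<integral>x. a i j x * a i j x \<partial>lebesgue)"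
    using nonneg flip by (simp add: sum.distrib sum_distrib_left[symmetric])
  also have "(\<Sum>i\<in>UNIV. \<Sum>j\<in>UNIV. \<integral>x. a i j x * a i j x \<partial>lebesgue)
      = (\<integral>x. (\<Sum>i\<in>UNIV. \<Sum>j\<in>UNIV. (a i j x)\<^sup>2) \<partial>lebesgue)"
    using int by (simp add: Bochner_Integration.integral_sum power2_eq_square)
  finally show ?thesis by (simp add: a_def)
qed

section \<open>Uniqueness of weak derivatives\<close>

lemma AE_lebesgue_on_iff_negligible:
  assumes "S \<in> sets lebesgue"
  shows "(AE x in lebesgue_on S. P x) \<longleftrightarrow> negligible {x \<in> S. \<not> P x}"
proof -
  have "(AE x in lebesgue_on S. P x) \<longleftrightarrow> (AE x in lebesgue. x \<in> S \<longrightarrow> P x)"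
    using assms by (subst AE_restrict_space_iff) auto
  also have "\<dots> \<longleftrightarrow> {x \<in> S. \<not> P x} \<in> null_sets lebesgue"
    by (subst completion.AE_iff_null_sets) simp
  finally show ?thesis by (simp add: negligible_iff_null_sets)
qed

text \<open>Lebesgue measure is complete: \<open>measurable_on\<close> describes measurability by
  almost everywhere limits of continuous functions and so ignores null sets. This carries
  measurability over to the representatives chosen by \<open>wderiv\<close>.\<close>

lemma borel_measurable_lebesgue_on_AE:
  fixes f h :: "R3 \<Rightarrow> real"
  assumes S: "S \<in> sets lebesgue" and f: "f \<in> borel_measurable (lebesgue_on S)"
    and eq: "AE x in lebesgue_on S. f x = h x"
  shows "h \<in> borel_measurable (lebesgue_on S)"
proof -
  have "f measurable_on S" by (rule iffD2[OF measurable_on_iff_borel_measurable[OF S] f])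
  then obtain N g where N: "negligible N" and g: "\<And>n. continuous_on UNIV (g n)"
    "\<And>x. x \<notin> N \<Longrightarrow> (\<lambda>n. g n x) \<longlonglongrightarrow> (if x \<in> S then f x else 0)"
    unfolding measurable_on_def by metis
  have neg: "negligible (N \<union> {x \<in> S. f x \<noteq> h x})"
    using N eq AE_lebesgue_on_iff_negligible[OF S] by (simp add: negligible_Un)
  have "(\<lambda>n. g n x) \<longlonglongrightarrow> (if x \<in> S then h x else 0)" if "x \<notin> N \<union> {x \<in> S. f x \<noteq> h x}" for x
    using g(2)[of x] that by (auto split: if_splits)
  then have "h measurable_on S"
    unfolding measurable_on_def using neg g(1) by blast
  then show ?thesis by (rule iffD1[OF measurable_on_iff_borel_measurable[OF S]])
qed

lemma borel_measurable_lebesgue_on_AE_LIMSEQ: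
  fixes f :: "nat \<Rightarrow> R3 \<Rightarrow> real"
  assumes S: "S \<in> sets lebesgue" and f: "\<And>n. f n \<in> borel_measurable (lebesgue_on S)"
    and lim: "AE x in lebesgue_on S. (\<lambda>n. f n x) \<longlonglongrightarrow> h x"
  shows "h \<in> borel_measurable (lebesgue_on S)"
proof (rule borel_measurable_lebesgue_on_AE[OF S])
  show "(\<lambda>x. lim (\<lambda>n. f n x)) \<in> borel_measurable (lebesgue_on S)"
    using f by (rule borel_measurable_lim_metric)
  show "AE x in lebesgue_on S. lim (\<lambda>n. f n x) = h x"
    using lim by eventually_elim (rule limI)
qed

text \<open>Open boxes form an intersection-stable generator of the Borel sets, and the Borel sets
  over which the integral vanishes form a Dynkin system; uniqueness of densities then gives the
  claim. The Borel representative \<open>g'\<close> is needed because the generator yields the Borel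
  sets only.\<close>

lemma AE_0_if_box_integrals_0:
  fixes g :: "R3 \<Rightarrow> real"
  assumes g: "integrable lebesgue g" and box0: "\<And>a b. (LINT x:box a b|lebesgue. g x) = 0"
  shows "AE x in lebesgue. g x = 0"
proof -
  obtain g' where g': "g' \<in> borel_measurable lborel" and gg': "AE x in lborel. g x = g' x"
    using completion_ex_borel_measurable_real[of g lborel] g by auto
  have gg'2: "AE x in lebesgue. g x = g' x" using gg' by (rule AE_completion)
  have "integrable lebesgue g'"
    by (rule integrable_cong_AE_imp[OF g]) (use g' gg'2 in \<open>auto intro: measurable_completion\<close>)
  then have int: "integrable lborel g'" using integrable_completion g' by blast
  have eq: "(LINT x:A|lborel. g' x) = (LINT x:A|lebesgue. g x)" if A: "A \<in> sets borel" for A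
  proof -
    have "(LINT x:A|lborel. g' x) = (LINT x:A|lebesgue. g' x)"
      unfolding set_lebesgue_integral_def using g' A by (subst integral_completion) auto
    also have "\<dots> = (LINT x:A|lebesgue. g x)"
      unfolding set_lebesgue_integral_def
    proof (rule integral_cong_AE)
      have "g' \<in> borel_measurable lebesgue" "g \<in> borel_measurable lebesgue" "A \<in> sets lebesgue"
        using g' g A by (auto intro: measurable_completion)
      then show "(\<lambda>x. indicator A x *\<^sub>R g' x) \<in> borel_measurable lebesgue"
        "(\<lambda>x. indicator A x *\<^sub>R g x) \<in> borel_measurable lebesgue"
        by (simp_all add: borel_measurable_times borel_measurable_indicator)
    qed (use gg'2 in auto)
    finally show ?thesis .
  qed
  let ?G = "range (\<lambda>(a, b). box a b :: R3 set)"
  \<comment> \<open>Closure under complements subtracts from the integral over the whole space,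
    which is not a bounded box; that integral is obtained by exhausting the space with growing
    cubes.\<close>
  have UNIV0: "(LINT x|lborel. g' x) = 0"
  proof -
    define B where "B n = box (\<chi> i. - real n) ((\<chi> i. real n) :: R3)" for n :: nat
    have "(\<lambda>n. LINT x|lborel. indicator (B n :: R3 set) x *\<^sub>R g' x) \<longlonglongrightarrow> (LINT x|lborel. g' x)"
    proof (rule integral_dominated_convergence[where w = "\<lambda>x. \<bar>g' x\<bar>"])
      show "AE x in lborel. (\<lambda>n. indicator (B n) x *\<^sub>R g' x) \<longlonglongrightarrow> g' x"
      proof (rule AE_I2)
        fix x :: R3
        obtain N :: nat where N: "norm x < real N" using reals_Archimedean2 by blast
        have "x \<in> B n" if "n \<ge> N" for n
        proof -
          have "\<bar>x $ i\<bar> < real n" for i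
            using component_le_norm_cart[of x i] N that by simp
          then have "- real n < x $ i \<and> x $ i < real n" for i by (simp add: abs_less_iff minus_less_iff)
          then show ?thesis by (auto simp: B_def mem_box_cart)
        qed
        then have "\<forall>\<^sub>F n in sequentially. indicator (B n) x *\<^sub>R g' x = g' x"
            by (intro eventually_sequentiallyI[of N]) simp
          then show "(\<lambda>n. indicator (B n) x *\<^sub>R g' x) \<longlonglongrightarrow> g' x" by (rule tendsto_eventually)
      qed
      show "(\<lambda>x. indicator (B n) x *\<^sub>R g' x) \<in> borel_measurable lborel" for n
        using g' unfolding B_def by auto
    qed (use int g' in \<open>auto simp: indicator_def\<close>)
    moreover have "(LINT x|lborel. indicator (B n) x *\<^sub>R g' x) = 0" for n
      using eq[of "B n"] box0 by (simp add: B_def set_lebesgue_integral_def)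
    ultimately show ?thesis by (simp add: LIMSEQ_const_iff)
  qed
  have si: "set_integrable lborel A g'" if "A \<in> sets borel" for A
    using that int unfolding set_integrable_def by (intro integrable_mult_indicator) auto
  have "(LINT x:A|lborel. g' x) = 0" if "A \<in> sets borel" for A
  proof -
    have bs: "sets borel = sigma_sets UNIV ?G" unfolding borel_eq_box by simp
    have "Int_stable ?G"
    proof (rule Int_stableI)
      fix X Y assume "X \<in> ?G" "Y \<in> ?G"
      then obtain a b c d where "X = box a b" "Y = box c d" by auto
      then have "X \<inter> Y = box (\<chi> i. max (a $ i) (c $ i)) (\<chi> i. min (b $ i) (d $ i))"
        by (auto simp: mem_box_cart)
      then show "X \<inter> Y \<in> ?G" by auto
    qed
    moreover have "?G \<subseteq> Pow UNIV" by simp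
    moreover have "A \<in> sigma_sets UNIV ?G" using that bs by simp
    ultimately show ?thesis
    proof (induction rule: sigma_sets_induct_disjoint)
      case (basic A)
      then show ?case using eq box0 by auto
    next
      case (compl A)
      have "(LINT x:UNIV|lborel. g' x) = (LINT x:A|lborel. g' x) + (LINT x:UNIV - A|lborel. g' x)"
      proof -
        have "A \<in> sets borel" using compl(1) bs by simp
        then have "set_integrable lborel A g'" "set_integrable lborel (UNIV - A) g'" by (auto intro!: si)
        then show ?thesis using set_integral_Un[of A "UNIV - A" lborel g'] by simp
      qed
      then show ?case using compl UNIV0 by (simp add: set_lebesgue_integral_def)
    next
      case (union A)
      have "(LINT x:(\<Union>i. A i)|lborel. g' x) = (\<Sum>i. (LINT x:(A i)|lborel. g' x))"
      proof (rule lebesgue_integral_countable_add)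
        have Ai: "A i \<in> sets borel" for i using union(2) bs by blast
        then show "A i \<in> sets lborel" for i by simp
        show "A i \<inter> A j = {}" if "i \<noteq> j" for i j
          using union(1) that by (auto simp: disjoint_family_on_def)
        show "set_integrable lborel (\<Union>i. A i) g'" using Ai by (intro si) auto
      qed
      then show ?case using union by simp
    qed (simp add: set_lebesgue_integral_def)
  qed
  then have "AE x in lborel. g' x = 0" 
    using density_unique_real[OF int, of "\<lambda>x. 0"] by (simp add: set_lebesgue_integral_def)
  with gg' have "AE x in lborel. g x = 0" by eventually_elim simp
  then show ?thesis by (rule AE_completion)
qed

lemma test_function_outside: "\<phi> \<in> test_functions A \<Longrightarrow> x \<notin> A \<Longrightarrow> \<phi> x = 0"
  using closure_subset[of "{x. \<phi> x \<noteq> 0}"] by (auto simp: test_functions_def)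

lemma integral_lebesgue_on_test_function:
  assumes "open A" "\<phi> \<in> test_functions A"
  shows "(\<integral>x. g x * \<phi> x \<partial>lebesgue_on A) = (\<integral>x. g x * \<phi> x \<partial>lebesgue)"
proof -
  have "(\<lambda>x. indicator A x *\<^sub>R (g x * \<phi> x)) = (\<lambda>x. g x * \<phi> x)"
    using test_function_outside[OF assms(2)] by (auto simp: indicator_def fun_eq_iff)
  moreover have "A \<inter> space lebesgue \<in> sets lebesgue" using assms(1) by auto
  ultimately show ?thesis using integral_restrict_space[of A lebesgue "\<lambda>x. g x * \<phi> x"] by simp
qed

lemma integrable_test_function:
  assumes g: "locally_integrable_in A g" and p: "\<phi> \<in> test_functions A"
  shows "integrable lebesgue (\<lambda>x. g x * \<phi> x)"
proof -
  let ?K = "closure {x. \<phi> x \<noteq> 0}"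
  have "compact ?K" "?K \<subseteq> A" using p by (simp_all only: test_functions_def mem_Collect_eq)
  then have K: "integrable lebesgue (\<lambda>x. indicator ?K x *\<^sub>R g x)"
    using g unfolding locally_integrable_in_def set_integrable_def by blast
  obtain C where C: "\<And>x. \<bar>\<phi> x\<bar> \<le> C" "C \<ge> 0" using test_functions_bounded[OF p] by metis
  have "(\<lambda>x. g x * \<phi> x) = (\<lambda>x. (indicator ?K x *\<^sub>R g x) * \<phi> x)"
    using closure_subset[of "{x. \<phi> x \<noteq> 0}"] by (auto simp: indicator_def fun_eq_iff)
  moreover have "integrable lebesgue (\<lambda>x. (indicator ?K x *\<^sub>R g x) * \<phi> x)"
  proof (rule Bochner_Integration.integrable_bound[OF integrable_mult_left[OF K, of C]])
    show "(\<lambda>x. (indicator ?K x *\<^sub>R g x) * \<phi> x) \<in> borel_measurable lebesgue"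
      using K test_functions_integrable[OF p] by (intro borel_measurable_times) auto
    show "AE x in lebesgue. norm ((indicator ?K x *\<^sub>R g x) * \<phi> x) \<le> norm ((indicator ?K x *\<^sub>R g x) * C)"
      using C by (auto simp: abs_mult intro!: mult_left_mono)
  qed
  ultimately show ?thesis by simp
qed

text \<open>Steepening bumps turn integrals against test functions into integrals over boxes. A
  countable cover of \<open>A\<close> by closed boxes then assembles one null set.\<close>

theorem fundamental_lemma:
  assumes A: "open A" and f: "locally_integrable_in A f"
    and 0: "\<And>\<phi>. \<phi> \<in> test_functions A \<Longrightarrow> (\<integral>x. f x * \<phi> x \<partial>lebesgue) = 0"
  shows "AE x in lebesgue_on A. f x = 0"
proof -
  have cb: "AE x in lebesgue. x \<in> cbox a b \<longrightarrow> f x = 0" if ab: "cbox a b \<subseteq> A" for a b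
  proof -
    \<comment> \<open>Local integrability becomes global integrability by cutting off at a compact
      box inside \<open>A\<close>.\<close>
    define g where "g x = indicator (cbox a b) x *\<^sub>R f x" for x
    have g: "integrable lebesgue g"
      using f ab unfolding locally_integrable_in_def set_integrable_def g_def by auto
    have sub: "(\<integral>x. g x * indicator (box p q) x \<partial>lebesgue) = 0" if pq: "cbox p q \<subseteq> cbox a b" for p q
    proof -
      have "(\<lambda>n. \<integral>x. g x * box_bump (real (Suc n)) p q x \<partial>lebesgue) \<longlonglongrightarrow> (\<integral>x. g x * indicator (box p q) x \<partial>lebesgue)"
      proof (rule integral_dominated_convergence[where w = "\<lambda>x. \<bar>g x\<bar>"])
        show "(\<lambda>x. g x * box_bump (real (Suc n)) p q x) \<in> borel_measurable lebesgue" for n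
          using g test_functions_integrable[OF test_functions_box_bump[of "real (Suc n)" p q UNIV]]
          by (intro borel_measurable_times) auto
        show "(\<lambda>x. g x * indicator (box p q) x) \<in> borel_measurable lebesgue"
          using g by (intro borel_measurable_times borel_measurable_indicator) auto
        show "AE x in lebesgue. (\<lambda>n. g x * box_bump (real (Suc n)) p q x) \<longlonglongrightarrow> g x * indicator (box p q) x"
          by (intro AE_I2 tendsto_mult_left box_bump_tendsto_indicator)
        show "AE x in lebesgue. norm (g x * box_bump (real (Suc n)) p q x) \<le> \<bar>g x\<bar>" for n
          using box_bump_nonneg box_bump_le_1 by (auto simp: abs_mult mult_left_le)
      qed (use g in auto)
      moreover have "(\<integral>x. g x * box_bump (real (Suc n)) p q x \<partial>lebesgue) = 0" for n
      proof -
        have "(\<lambda>x. g x * box_bump (real (Suc n)) p q x) = (\<lambda>x. f x * box_bump (real (Suc n)) p q x)"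
          using pq box_subset_cbox[of p q] box_bump_eq_0_iff[of "real (Suc n)" p q]
          by (auto simp: g_def indicator_def fun_eq_iff)
        moreover have "cbox p q \<subseteq> A" using ab pq by blast
        ultimately show ?thesis
          using 0[OF test_functions_box_bump[of "real (Suc n)" p q A]] by (simp only: of_nat_0_less_iff zero_less_Suc simp_thms)
      qed
      ultimately show ?thesis by (simp add: LIMSEQ_const_iff)
    qed
    have "AE x in lebesgue. g x = 0"
    proof (rule AE_0_if_box_integrals_0[OF g])
      fix c d :: R3
      \<comment> \<open>An arbitrary box meets the cut-off box in the box with corners
        \<open>?p\<close> and \<open>?q\<close>, up to the boundary of the cut-off box, which is a
        null set.\<close>
      let ?p = "\<chi> i. max (a $ i) (c $ i)" and ?q = "\<chi> i. min (b $ i) (d $ i)"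
      have "negligible (cbox a b - box a b)" by (rule negligible_frontier_interval)
      then have "AE x in lebesgue. x \<notin> cbox a b - box a b"
        using AE_not_in negligible_iff_null_sets by blast
      then have "AE x in lebesgue. indicator (box c d) x *\<^sub>R g x = g x * indicator (box ?p ?q) x"
        by eventually_elim (auto simp: g_def indicator_def mem_box_cart)
      then have "(LINT x:box c d|lebesgue. g x) = (\<integral>x. g x * indicator (box ?p ?q) x \<partial>lebesgue)"
        unfolding set_lebesgue_integral_def using g
        by (intro integral_cong_AE) (auto intro!: borel_measurable_times borel_measurable_indicator)
      also have "\<dots> = 0" by (rule sub) (auto simp: mem_box_cart)
      finally show "(LINT x:box c d|lebesgue. g x) = 0" .
    qed
    then show ?thesis by eventually_elim (auto simp: g_def)
  qed
  obtain \<D> where D: "countable \<D>" "\<D> \<subseteq> Pow A" "\<And>X. X \<in> \<D> \<Longrightarrow> \<exists>a b. X = cbox a b" "\<Union>\<D> = A"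
    using open_countable_Union_open_cbox[OF A] by metis
  have "AE x in lebesgue. \<forall>X\<in>\<D>. x \<in> X \<longrightarrow> f x = 0"
    unfolding AE_ball_countable[OF D(1)]
  proof
    fix X assume "X \<in> \<D>"
    then obtain a b where "X = cbox a b" "X \<subseteq> A" using D(2,3) by blast
    then show "AE x in lebesgue. x \<in> X \<longrightarrow> f x = 0" using cb by blast
  qed
  then have "AE x in lebesgue. x \<in> A \<longrightarrow> f x = 0"
    by eventually_elim (use D(4) in blast)
  then show ?thesis using A by (subst AE_restrict_space_iff) auto
qed

lemma is_weak_deriv_iff:
  assumes "open A"
  shows "is_weak_deriv A k v g \<longleftrightarrow> locally_integrable_in A v \<and> locally_integrable_in A g \<and>
     (\<forall>\<phi>\<in>test_functions A. (\<integral>x. v x * pderiv_cl k \<phi> x \<partial>lebesgue) = - (\<integral>x. g x * \<phi> x \<partial>lebesgue))"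
  unfolding is_weak_deriv_def
  by (intro conj_cong ball_cong refl)
     (simp only: integral_lebesgue_on_test_function[OF assms] integral_lebesgue_on_test_function[OF assms test_functions_pderiv_cl])

lemma locally_integrable_lincomb:
  assumes "locally_integrable_in A v" "locally_integrable_in A w"
  shows "locally_integrable_in A (\<lambda>x. a * v x + b * w x)"
  unfolding locally_integrable_in_def
proof (intro allI impI)
  fix K assume "compact K \<and> K \<subseteq> A"
  then have "set_integrable lebesgue K v" "set_integrable lebesgue K w"
    using assms unfolding locally_integrable_in_def by blast+
  then show "set_integrable lebesgue K (\<lambda>x. a * v x + b * w x)"
    by (intro set_integral_add set_integrable_mult_right)
qed

lemma is_weak_deriv_lincomb:
  assumes A: "open A" and v: "is_weak_deriv A k v g" and w: "is_weak_deriv A k w h"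
  shows "is_weak_deriv A k (\<lambda>x. a * v x + b * w x) (\<lambda>x. a * g x + b * h x)"
  unfolding is_weak_deriv_iff[OF A]
proof (intro conjI ballI)
  have l: "locally_integrable_in A v" "locally_integrable_in A w" "locally_integrable_in A g" "locally_integrable_in A h"
    using v w unfolding is_weak_deriv_def by blast+
  then show "locally_integrable_in A (\<lambda>x. a * v x + b * w x)" "locally_integrable_in A (\<lambda>x. a * g x + b * h x)"
    by (auto intro: locally_integrable_lincomb)
  fix \<phi> assume p: "\<phi> \<in> test_functions A"
  note p' = test_functions_pderiv_cl[OF p, of k]
  have "(\<integral>x. (a * v x + b * w x) * pderiv_cl k \<phi> x \<partial>lebesgue)
      = a * (\<integral>x. v x * pderiv_cl k \<phi> x \<partial>lebesgue) + b * (\<integral>x. w x * pderiv_cl k \<phi> x \<partial>lebesgue)"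
    using integrable_test_function[OF l(1) p'] integrable_test_function[OF l(2) p']
    by (simp add: distrib_right mult.assoc)
  also have "(\<integral>x. v x * pderiv_cl k \<phi> x \<partial>lebesgue) = - (\<integral>x. g x * \<phi> x \<partial>lebesgue)"
    using v[unfolded is_weak_deriv_iff[OF A]] p by blast
  also have "(\<integral>x. w x * pderiv_cl k \<phi> x \<partial>lebesgue) = - (\<integral>x. h x * \<phi> x \<partial>lebesgue)"
    using w[unfolded is_weak_deriv_iff[OF A]] p by blast
  also have "a * - (\<integral>x. g x * \<phi> x \<partial>lebesgue) + b * - (\<integral>x. h x * \<phi> x \<partial>lebesgue) = - (\<integral>x. (a * g x + b * h x) * \<phi> x \<partial>lebesgue)"
    using integrable_test_function[OF l(3) p] integrable_test_function[OF l(4) p]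
    by (simp add: distrib_right mult.assoc)
  finally show "(\<integral>x. (a * v x + b * w x) * pderiv_cl k \<phi> x \<partial>lebesgue)
      = - (\<integral>x. (a * g x + b * h x) * \<phi> x \<partial>lebesgue)" .
qed

lemma is_weak_deriv_zero: "is_weak_deriv A k (\<lambda>x. 0) (\<lambda>x. 0)"
  by (simp add: is_weak_deriv_def locally_integrable_in_def set_integrable_def)

lemma weak_deriv_unique:
  assumes A: "open A" and g: "is_weak_deriv A k v g" and h: "is_weak_deriv A k v h"
  shows "AE x in lebesgue_on A. g x = h x"
proof -
  have "is_weak_deriv A k (\<lambda>x. 1 * v x + (- 1) * v x) (\<lambda>x. 1 * g x + (- 1) * h x)"
    by (rule is_weak_deriv_lincomb[OF A g h])
  then have "AE x in lebesgue_on A. 1 * g x + (- 1) * h x = 0"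
    unfolding is_weak_deriv_iff[OF A] by (intro fundamental_lemma[OF A]) auto
  then show ?thesis by eventually_elim simp
qed

lemma is_weak_deriv_wderiv: "is_weak_deriv A k v g \<Longrightarrow> is_weak_deriv A k v (wderiv A k v)"
  unfolding wderiv_def by (rule someI[of "is_weak_deriv A k v"])

lemma wderiv_AE_eq:
  assumes "open A" "is_weak_deriv A k v g"
  shows "AE x in lebesgue_on A. wderiv A k v x = g x"
  by (rule weak_deriv_unique[OF assms(1) is_weak_deriv_wderiv[OF assms(2)] assms(2)])

lemma wderiv_lincomb:
  assumes "open A" "is_weak_deriv A k v g" "is_weak_deriv A k w h"
  shows "AE x in lebesgue_on A. wderiv A k (\<lambda>x. a * v x + b * w x) x = a * wderiv A k v x + b * wderiv A k w x"
  by (intro wderiv_AE_eq is_weak_deriv_lincomb is_weak_deriv_wderiv) (rule assms)+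

lemma wderiv_zero: "open A \<Longrightarrow> AE x in lebesgue_on A. wderiv A k (\<lambda>x. 0) x = 0"
  by (rule wderiv_AE_eq[OF _ is_weak_deriv_zero])

section \<open>Periodic functions with constant gradient or strain\<close>

definition integer_vectors :: "R3 set" where
  "integer_vectors = {a. \<forall>i. a $ i \<in> \<int>}"

lemma countable_integer_vectors: "countable integer_vectors"
proof -
  have "integer_vectors \<subseteq> (\<lambda>(p, q, r). vector [of_int p, of_int q, of_int r]) ` (UNIV :: (int \<times> int \<times> int) set)"
  proof
    fix a assume "a \<in> integer_vectors"
    then have "\<forall>i. \<exists>m. a $ i = of_int m" by (auto simp: integer_vectors_def elim: Ints_cases)
    then obtain m where "\<And>i. a $ i = of_int (m i)" by metis
    then have "a = (\<lambda>(p, q, r). vector [of_int p, of_int q, of_int r]) (m 1, m 2, m 3)"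
      by (simp add: vec_eq_iff forall_3 vector_3)
    then show "a \<in> (\<lambda>(p, q, r). vector [of_int p, of_int q, of_int r]) ` (UNIV :: (int \<times> int \<times> int) set)"
      by blast
  qed
  then show ?thesis by (rule countable_subset) simp
qed

lemma periodic_integer_shift:
  fixes F :: "R3 \<Rightarrow> 'b"
  assumes per: "\<And>y k. F (y + axis k 1) = F y" and a: "a \<in> integer_vectors"
  shows "F (y + a) = F y"
proof -
  have nat: "F (y + real n *\<^sub>R axis k 1) = F y" for y k n
  proof (induction n)
    case (Suc n)
    have "y + real (Suc n) *\<^sub>R axis k 1 = (y + real n *\<^sub>R axis k 1) + axis k 1"
      by (simp add: algebra_simps)
    then show ?case by (simp only: per Suc)
  qed simp
  have int: "F (y + of_int m *\<^sub>R axis k 1) = F y" for y k m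
  proof (cases "m \<ge> 0")
    case True
    then show ?thesis using nat[of y "nat m" k] by simp
  next
    case False
    then show ?thesis using nat[of "y + of_int m *\<^sub>R axis k 1" "nat (- m)" k] by simp
  qed
  have fin: "F (y + (\<Sum>i\<in>I. (a $ i) *\<^sub>R axis i 1)) = F y" for I :: "3 set"
  proof -
    have "finite I" by simp
    then show ?thesis
    proof (induction I)
      case (insert i I)
      obtain m where "a $ i = of_int m" using a by (auto simp: integer_vectors_def elim: Ints_cases)
      then show ?case
        using insert int[of "y + (\<Sum>i\<in>I. (a $ i) *\<^sub>R axis i 1)" m i] by (simp add: algebra_simps)
    qed simp
  qed
  show ?thesis using fin[of UNIV] basis_expansion[of a] by (simp add: scalar_mult_eq_scaleR)
qed

lemma is_weak_deriv_shift:
  assumes S: "open S" and per: "\<And>y. y + a \<in> S \<longleftrightarrow> y \<in> S" and v: "\<And>y. y \<in> S \<Longrightarrow> v (y + a) = v y"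
    and w: "is_weak_deriv S k v g"
  shows "is_weak_deriv S k v (\<lambda>y. g (y + a))"
  unfolding is_weak_deriv_iff[OF S]
proof (intro conjI ballI)
  show "locally_integrable_in S v" using w by (simp add: is_weak_deriv_def)
  have lg: "locally_integrable_in S g" using w by (simp add: is_weak_deriv_def)
  show "locally_integrable_in S (\<lambda>y. g (y + a))"
    unfolding locally_integrable_in_def
  proof (intro allI impI)
    fix K assume K: "compact K \<and> K \<subseteq> S"
    then have "compact ((+) a ` K)" "(+) a ` K \<subseteq> S"
      using per compact_translation[of K a] by (blast, auto simp: add.commute)
    then have "integrable lebesgue (\<lambda>y. indicator ((+) a ` K) y *\<^sub>R g y)"
      using lg unfolding locally_integrable_in_def set_integrable_def by blast
    from integrable_lebesgue_shift(1)[OF this, of a]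
    show "set_integrable lebesgue K (\<lambda>y. g (y + a))"
      unfolding set_integrable_def
      by (rule Bochner_Integration.integrable_cong[THEN iffD1, rotated 2]) (auto simp: indicator_def)
  qed
  fix \<phi> assume p: "\<phi> \<in> test_functions S"
  have p': "(\<lambda>x. \<phi> (x + (- a))) \<in> test_functions S"
  proof (rule test_functions_shift[OF p])
    show "x - - a \<in> S" if "x \<in> closure {x. \<phi> x \<noteq> 0}" for x
      using that p per by (auto simp: test_functions_def)
  qed
  have "- (\<integral>x. g (x + a) * \<phi> x \<partial>lebesgue) = - (\<integral>x. g x * \<phi> (x + (- a)) \<partial>lebesgue)"
    using lebesgue_integral_shift[of "\<lambda>x. g x * \<phi> (x + (- a))" a] by simp
  also have "\<dots> = (\<integral>x. v x * pderiv_cl k (\<lambda>x. \<phi> (x + (- a))) x \<partial>lebesgue)"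
    using w p' unfolding is_weak_deriv_iff[OF S] by simp
  also have "\<dots> = (\<integral>x. v x * pderiv_cl k \<phi> (x + (- a)) \<partial>lebesgue)"
    by (simp only: pderiv_cl_shift[OF test_functions_smooth[OF p]])
  also have "\<dots> = (\<integral>x. v (x + a) * pderiv_cl k \<phi> x \<partial>lebesgue)"
    using lebesgue_integral_shift[of "\<lambda>x. v x * pderiv_cl k \<phi> (x + (- a))" a] by simp
  also have "(\<lambda>x. v (x + a) * pderiv_cl k \<phi> x) = (\<lambda>x. v x * pderiv_cl k \<phi> x)"
    using v test_function_outside[OF test_functions_pderiv_cl[OF p]] by (auto simp: fun_eq_iff)
  finally show "(\<integral>x. v x * pderiv_cl k \<phi> x \<partial>lebesgue) = - (\<integral>x. g (x + a) * \<phi> x \<partial>lebesgue)" by simp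
qed

lemma periodic_set_integer_shift:
  assumes "\<And>y k. y + axis k 1 \<in> S \<longleftrightarrow> y \<in> S" "a \<in> integer_vectors"
  shows "y + a \<in> S \<longleftrightarrow> y \<in> S"
  using periodic_integer_shift[of "\<lambda>y. y \<in> S" a y] assms by simp

lemma periodic_on_integer_shift:
  assumes S: "\<And>y k. y + axis k 1 \<in> S \<longleftrightarrow> y \<in> S" and v: "\<And>y k. y \<in> S \<Longrightarrow> v (y + axis k 1) = v y"
    and a: "a \<in> integer_vectors" and y: "y \<in> S"
  shows "v (y + a) = v y"
proof -
  \<comment> \<open>The function \<open>v\<close> is constrained only on \<open>S\<close>. Wrapping
    it in \<open>Some\<close>, with \<open>None\<close> outside \<open>S\<close>, gives a map that
    is periodic on the whole space.\<close>
  have "(if y + a \<in> S then Some (v (y + a)) else None) = (if y \<in> S then Some (v y) else None)"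
    by (rule periodic_integer_shift[of "\<lambda>y. if y \<in> S then Some (v y) else None", OF _ a]) (use S v in auto)
  then show ?thesis using y periodic_set_integer_shift[OF S a] by simp
qed

text \<open>A translate of \<open>g\<close> by a lattice vector is again a weak derivative of
  \<open>v\<close>, so uniqueness identifies it with \<open>g\<close> almost everywhere. Since the
  lattice is countable, one null set serves all translations.\<close>

lemma weak_deriv_periodic:
  assumes S: "open S" and per: "\<And>y k. y + axis k 1 \<in> S \<longleftrightarrow> y \<in> S"
    and v: "\<And>y k. y \<in> S \<Longrightarrow> v (y + axis k 1) = v y" and w: "is_weak_deriv S k v g"
  shows "AE y in lebesgue_on S. \<forall>a\<in>integer_vectors. g (y + a) = g y"
  unfolding AE_ball_countable[OF countable_integer_vectors]
proof
  fix a assume a: "a \<in> integer_vectors"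
  show "AE y in lebesgue_on S. g (y + a) = g y"
    by (rule weak_deriv_unique[OF S is_weak_deriv_shift[OF S _ _ w] w])
       (use periodic_set_integer_shift[OF per a] periodic_on_integer_shift[OF per v a] in auto)
qed

lemma negligible_integer_coordinates: "negligible {y :: R3. \<exists>i. y $ i \<in> \<int>}"
proof -
  have "{y :: R3. \<exists>i. y $ i \<in> \<int>} = (\<Union>(i, n)\<in>UNIV. {y. y $ i = of_int n})"
    by (auto elim!: Ints_cases) (metis Ints_of_int)
  moreover have "negligible {y :: R3. y $ i = c}" for i c
    using negligible_hyperplane[of "axis i (1 :: real)" c] by (simp add: inner_axis' axis_eq_0_iff)
  ultimately show ?thesis
    by (auto intro!: negligible_countable_Union countable_image countableI_type)
qed

lemma unit_cell_eq_box: "unit_cell = box 0 1"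
  by (auto simp: unit_cell_def mem_box_cart)

text \<open>The lattice translates of \<open>material S\<close> cover \<open>S\<close> except for
  the cell faces. These consist of points with an integer coordinate and form a null set.\<close>

lemma AE_material_imp_AE:
  assumes S: "open S" and per: "\<And>y k. y + axis k 1 \<in> S \<longleftrightarrow> y \<in> S"
    and h: "AE y in lebesgue_on S. \<forall>a\<in>integer_vectors. h (y + a) = h y"
    and C: "AE y in lebesgue_on (material S). h y = C"
  shows "AE y in lebesgue_on S. h y = C"
proof -
  have M: "material S \<in> sets lebesgue" using S by (simp add: material_def unit_cell_eq_box)
  have S': "S \<in> sets lebesgue" using S by auto
  let ?N1 = "{y \<in> material S. h y \<noteq> C}" and ?N2 = "{y \<in> S. \<not> (\<forall>a\<in>integer_vectors. h (y + a) = h y)}"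
  have "negligible ?N1" by (rule iffD1[OF AE_lebesgue_on_iff_negligible[OF M] C])
  then have "negligible (\<Union>a\<in>integer_vectors. (+) a ` ?N1)"
    by (intro negligible_countable_Union countable_image countable_integer_vectors) (auto intro: negligible_translation)
  moreover have "negligible ?N2" by (rule iffD1[OF AE_lebesgue_on_iff_negligible[OF S'] h])
  ultimately have neg: "negligible ((\<Union>a\<in>integer_vectors. (+) a ` ?N1) \<union> ?N2 \<union> {y. \<exists>i. y $ i \<in> \<int>})"
    using negligible_integer_coordinates by (intro negligible_Un)
  have "{y \<in> S. h y \<noteq> C} \<subseteq> (\<Union>a\<in>integer_vectors. (+) a ` ?N1) \<union> ?N2 \<union> {y. \<exists>i. y $ i \<in> \<int>}"
  proof
    fix y assume y: "y \<in> {y \<in> S. h y \<noteq> C}"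
    show "y \<in> (\<Union>a\<in>integer_vectors. (+) a ` ?N1) \<union> ?N2 \<union> {y. \<exists>i. y $ i \<in> \<int>}"
    proof (cases "y \<in> ?N2 \<or> (\<exists>i. y $ i \<in> \<int>)")
      case False
      \<comment> \<open>Subtracting the vector of integer parts moves \<open>y\<close> into the
        cell; its coordinates are not integers, so the result is in the open cell.\<close>
      define a :: R3 where "a = (\<chi> i. of_int \<lfloor>y $ i\<rfloor>)"
      have a: "a \<in> integer_vectors" "- a \<in> integer_vectors" by (auto simp: a_def integer_vectors_def)
      have "h (y + - a) = h y" using False y a(2) by blast
      moreover have "y + - a \<in> S" using periodic_set_integer_shift[OF per a(2)] y by simp
      moreover have "y + - a \<in> unit_cell"
      proof -
        have "0 < y $ i - of_int \<lfloor>y $ i\<rfloor> \<and> y $ i - of_int \<lfloor>y $ i\<rfloor> < 1" for i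
        proof -
          have "of_int \<lfloor>y $ i\<rfloor> \<noteq> y $ i" using False by (metis Ints_of_int)
          then show ?thesis by linarith
        qed
        then show ?thesis by (auto simp: unit_cell_def a_def)
      qed
      ultimately have "y + - a \<in> ?N1" using y by (auto simp: material_def)
      then have "y \<in> (+) a ` ?N1" by (intro image_eqI[of _ _ "y + - a"]) auto
      then show ?thesis using a by blast
    qed auto
  qed
  from negligible_subset[OF neg this] show ?thesis
    by (rule iffD2[OF AE_lebesgue_on_iff_negligible[OF S']])
qed

section \<open>Mollification and rigidity of periodic functions\<close>

lemma test_function_lipschitz:
  assumes "f \<in> test_functions A"
  obtains C where "C \<ge> 0" "\<And>a b. \<bar>f a - f b\<bar> \<le> C * norm (a - b)"
proof -
  have "\<exists>C. (\<forall>x. \<bar>pderiv_cl k f x\<bar> \<le> C) \<and> C \<ge> 0" for k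
    using test_functions_bounded[OF test_functions_pderiv_cl[OF assms, of k]] by metis
  then obtain C where C: "\<And>k x. \<bar>pderiv_cl k f x\<bar> \<le> C k" "\<And>k. C k \<ge> 0" by metis
  have "norm (f a - f b) \<le> (\<Sum>k\<in>UNIV. C k) * norm (a - b)" for a b
  proof (rule differentiable_bound[where S = UNIV])
    show "(f has_derivative (\<lambda>h. \<Sum>k\<in>UNIV. h $ k * pderiv_cl k f x)) (at x within UNIV)" for x
      using smooth_partials(1)[OF test_functions_smooth[OF assms]] by simp
    show "onorm (\<lambda>h. \<Sum>k\<in>UNIV. h $ k * pderiv_cl k f x) \<le> (\<Sum>k\<in>UNIV. C k)" for x
    proof (rule onorm_le)
      fix h :: R3
      have "norm (\<Sum>k\<in>UNIV. h $ k * pderiv_cl k f x) \<le> (\<Sum>k\<in>UNIV. norm h * C k)"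
        by (intro sum_norm_le) (auto simp: abs_mult intro!: mult_mono C component_le_norm_cart)
      also have "(\<Sum>k\<in>UNIV. norm h * C k) = (\<Sum>k\<in>UNIV. C k) * norm h"
        using sum_distrib_left[of "norm h" C UNIV] by (simp only: mult.commute[of "norm h"])
      finally show "norm (\<Sum>k\<in>UNIV. h $ k * pderiv_cl k f x) \<le> (\<Sum>k\<in>UNIV. C k) * norm h" .
    qed
  qed auto
  then show ?thesis using that[of "\<Sum>k\<in>UNIV. C k"] C(2) by (simp add: sum_nonneg)
qed

text \<open>The remainder bound is uniform in the base point \<open>a\<close>; this lets it be
  integrated against a locally integrable function when differentiating under the integral.\<close>

lemma test_function_taylor:
  assumes "f \<in> test_functions A"
  obtains C where "C \<ge> 0" "\<And>a h. \<bar>f (a + h) - f a - (\<Sum>k\<in>UNIV. h $ k * pderiv_cl k f a)\<bar> \<le> C * (norm h)\<^sup>2"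
proof -
  have "\<exists>C. C \<ge> 0 \<and> (\<forall>a b. \<bar>pderiv_cl k f a - pderiv_cl k f b\<bar> \<le> C * norm (a - b))" for k
    using test_function_lipschitz[OF test_functions_pderiv_cl[OF assms, of k]] by metis
  then obtain C where C: "\<And>k. C k \<ge> 0" "\<And>k a b. \<bar>pderiv_cl k f a - pderiv_cl k f b\<bar> \<le> C k * norm (a - b)" by metis
  have "norm (f (a + h) - f a - (\<lambda>h. \<Sum>k\<in>UNIV. h $ k * pderiv_cl k f a) ((a + h) - a))
     \<le> norm ((a + h) - a) * ((\<Sum>k\<in>UNIV. C k) * norm h)" for a h
  proof (rule differentiable_bound_linearization[where S = "cball a (norm h)" and f' = "\<lambda>x h. \<Sum>k\<in>UNIV. h $ k * pderiv_cl k f x"])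
    show "a + t *\<^sub>R (a + h - a) \<in> cball a (norm h)" if "t \<in> {0..1}" for t
      using that by (simp add: dist_norm mult_left_le_one_le)
    show "(f has_derivative (\<lambda>h. \<Sum>k\<in>UNIV. h $ k * pderiv_cl k f x)) (at x within cball a (norm h))" for x
      using smooth_partials(1)[OF test_functions_smooth[OF assms]] has_derivative_at_withinI by blast
    show "onorm ((\<lambda>h. \<Sum>k\<in>UNIV. h $ k * pderiv_cl k f x) - (\<lambda>h. \<Sum>k\<in>UNIV. h $ k * pderiv_cl k f a)) \<le> (\<Sum>k\<in>UNIV. C k) * norm h"
      if x: "x \<in> cball a (norm h)" for x
    proof (rule onorm_le)
      fix h' :: R3
      have "norm (\<Sum>k\<in>UNIV. h' $ k * (pderiv_cl k f x - pderiv_cl k f a)) \<le> (\<Sum>k\<in>UNIV. norm h' * (C k * norm h))"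
      proof (intro sum_norm_le)
        fix k
        have "\<bar>pderiv_cl k f x - pderiv_cl k f a\<bar> \<le> C k * norm h"
          using C(2)[of k x a] x C(1)[of k] by (smt (verit) mem_cball dist_norm dist_commute mult_left_mono)
        then show "norm (h' $ k * (pderiv_cl k f x - pderiv_cl k f a)) \<le> norm h' * (C k * norm h)"
          by (auto simp: abs_mult intro!: mult_mono component_le_norm_cart)
      qed
      also have "\<dots> = (\<Sum>k\<in>UNIV. C k) * norm h * norm h'"
        by (simp add: sum_distrib_right sum_distrib_left algebra_simps)
      finally show "norm (((\<lambda>h. \<Sum>k\<in>UNIV. h $ k * pderiv_cl k f x) - (\<lambda>h. \<Sum>k\<in>UNIV. h $ k * pderiv_cl k f a)) h')
        \<le> (\<Sum>k\<in>UNIV. C k) * norm h * norm h'"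
        by (simp add: right_diff_distrib sum_subtractf)
    qed
  qed auto
  then show ?thesis using that[of "\<Sum>k\<in>UNIV. C k"] C(1) by (simp add: sum_nonneg power2_eq_square algebra_simps)
qed

text \<open>A correlation with a kernel centred at \<open>z\<close>, without rescaling or
  normalization: the mollified function is used for its exact derivatives, not as an approximation
  of \<open>v\<close>. A derivative in \<open>z\<close> falls on the kernel with a minus
  sign.\<close>

definition mollify :: "(R3 \<Rightarrow> real) \<Rightarrow> (R3 \<Rightarrow> real) \<Rightarrow> R3 \<Rightarrow> real" where
  "mollify v \<psi> z = (\<integral>y. v y * \<psi> (y - z) \<partial>lebesgue)"

lemma test_functions_translate:
  assumes p: "\<psi> \<in> test_functions (cball 0 r)" and z: "cball z r \<subseteq> S"
  shows "(\<lambda>y. \<psi> (y - z)) \<in> test_functions S"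
proof -
  have "(\<lambda>y. \<psi> (y + (- z))) \<in> test_functions S"
  proof (rule test_functions_shift[OF p])
    fix x assume "x \<in> closure {x. \<psi> x \<noteq> 0}"
    then have "norm x \<le> r" using p by (auto simp: test_functions_def)
    then have "x + z \<in> cball z r" by (simp add: dist_norm)
    then show "x - - z \<in> S" using z by auto
  qed
  then show ?thesis by simp
qed

lemma mollify_weak_deriv:
  assumes S: "open S" and w: "is_weak_deriv S k v g"
    and p: "\<psi> \<in> test_functions (cball 0 r)" and z: "cball z r \<subseteq> S"
  shows "mollify v (pderiv_cl k \<psi>) z = - mollify g \<psi> z"
proof -
  have "(\<integral>x. v x * pderiv_cl k (\<lambda>y. \<psi> (y + - z)) x \<partial>lebesgue) = - (\<integral>x. g x * \<psi> (x + - z) \<partial>lebesgue)"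
    using w test_functions_translate[OF p z] unfolding is_weak_deriv_iff[OF S] by simp
  then show ?thesis
    unfolding mollify_def by (simp add: pderiv_cl_shift[OF test_functions_smooth[OF p], of k "- z", simplified])
qed

lemma mollify_periodic:
  assumes "\<And>y. y \<in> S \<Longrightarrow> v (y + a) = v y"
    and p: "\<psi> \<in> test_functions (cball 0 r)" and z: "cball z r \<subseteq> S"
  shows "mollify v \<psi> (z + a) = mollify v \<psi> z"
proof -
  have "mollify v \<psi> (z + a) = (\<integral>y. v (y + a) * \<psi> (y - z) \<partial>lebesgue)"
    unfolding mollify_def using lebesgue_integral_shift[of "\<lambda>y. v y * \<psi> (y - (z + a))" a]
    by (simp add: algebra_simps)
  also have "(\<lambda>y. v (y + a) * \<psi> (y - z)) = (\<lambda>y. v y * \<psi> (y - z))"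
    using test_function_outside[OF test_functions_translate[OF p z]] assms(1) by (auto simp: fun_eq_iff)
  finally show ?thesis by (simp add: mollify_def)
qed

text \<open>Integrating the second-order Taylor remainder of the kernel against
  \<open>\<bar>v\<bar>\<close> bounds the error by a multiple of the squared step. All kernels with
  centre near \<open>z\<close> live on one compact subset of \<open>S\<close>, where
  \<open>v\<close> is integrable.\<close>

lemma mollify_has_derivative:
  assumes S: "open S" and v: "locally_integrable_in S v"
    and p: "\<psi> \<in> test_functions (cball 0 r)" and z: "cball z r \<subseteq> S"
  shows "(mollify v \<psi> has_derivative (\<lambda>h. \<Sum>k\<in>UNIV. h $ k * - mollify v (pderiv_cl k \<psi>) z)) (at z)"
proof -
  obtain \<epsilon> where \<epsilon>: "\<epsilon> > 0" "(\<Union>x\<in>cball z r. cball x \<epsilon>) \<subseteq> S"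
    using compact_subset_open_imp_cball_epsilon_subset[OF compact_cball S z] by metis
  have near: "cball z' r \<subseteq> S" "cball z' r \<subseteq> cball z (r + \<epsilon>)" if "dist z' z < \<epsilon>" for z'
  proof -
    show "cball z' r \<subseteq> S"
    proof
      fix y assume "y \<in> cball z' r"
      then have "y + z - z' \<in> cball z r" "y \<in> cball (y + z - z') \<epsilon>"
        using that by (auto simp: dist_norm algebra_simps norm_minus_commute)
      then show "y \<in> S" using \<epsilon>(2) by blast
    qed
    show "cball z' r \<subseteq> cball z (r + \<epsilon>)"
    proof
      fix y assume "y \<in> cball z' r"
      then show "y \<in> cball z (r + \<epsilon>)"
        using that dist_triangle[of z y z'] by (auto simp: dist_commute)
    qed
  qed
  have int: "integrable lebesgue (\<lambda>y. v y * \<psi> (y - z'))" if "cball z' r \<subseteq> S" for z'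
    by (rule integrable_test_function[OF v test_functions_translate[OF p that]])
  have int': "integrable lebesgue (\<lambda>y. v y * pderiv_cl k \<psi> (y - z))" for k
    by (rule integrable_test_function[OF v test_functions_translate[OF test_functions_pderiv_cl[OF p] z]])
  have KS: "cball z r + cball 0 \<epsilon> \<subseteq> S"
  proof
    fix y assume "y \<in> cball z r + cball 0 \<epsilon>"
    then obtain x w where "y = x + w" "x \<in> cball z r" "w \<in> cball 0 \<epsilon>" by (auto elim: set_plus_elim)
    then have "y \<in> cball x \<epsilon>" by (simp add: dist_norm)
    then show "y \<in> S" using \<epsilon>(2) \<open>x \<in> cball z r\<close> by blast
  qed
  have Kc: "compact (cball z r + cball 0 \<epsilon>)"
  proof -
    have "cball z r + cball 0 \<epsilon> = {x + y |x y. x \<in> cball z r \<and> y \<in> cball 0 \<epsilon>}"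
      unfolding set_plus_def by blast
    then show ?thesis using compact_sums[OF compact_cball[of z r] compact_cball[of 0 \<epsilon>]] by (simp only:)
  qed
  \<comment> \<open>Cutting \<open>v\<close> off at the compact set that contains the supports of
    all kernels with centres within \<open>\<epsilon>\<close> of \<open>z\<close> makes the
    dominating function independent of the step.\<close>
  define kf where "kf y = indicator (cball z r + cball 0 \<epsilon>) y *\<^sub>R v y" for y
  have kf: "integrable lebesgue kf"
    using v Kc KS unfolding locally_integrable_in_def set_integrable_def kf_def by blast
  obtain C where C: "C \<ge> 0" "\<And>a h. \<bar>\<psi> (a + h) - \<psi> a - (\<Sum>k\<in>UNIV. h $ k * pderiv_cl k \<psi> a)\<bar> \<le> C * (norm h)\<^sup>2"
    using test_function_taylor[OF p] by metis
  define I where "I = (\<integral>y. \<bar>kf y\<bar> \<partial>lebesgue)"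
  show ?thesis
  proof (rule has_derivativeI_sandwich[where e = \<epsilon> and H = "\<lambda>y. C * I * norm (y - z)"])
    show "bounded_linear (\<lambda>h. \<Sum>k\<in>UNIV. h $ k * - mollify v (pderiv_cl k \<psi>) z)"
      by (intro bounded_linear_sum bounded_linear_mult_left[THEN bounded_linear_compose] bounded_linear_vec_nth)
    have "((\<lambda>y. C * I * norm (y - z)) \<longlongrightarrow> C * I * norm (z - z)) (at z)"
      by (intro tendsto_intros)
    then show "((\<lambda>y. C * I * norm (y - z)) \<longlongrightarrow> 0) (at z)" by simp
    fix z' assume z': "z' \<noteq> z" "dist z' z < \<epsilon>"
    let ?h = "z' - z"
    let ?E = "\<lambda>y. \<psi> (y - z') - \<psi> (y - z) - (\<Sum>k\<in>UNIV. ?h $ k * - pderiv_cl k \<psi> (y - z))"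
    have E0: "?E y = 0" if "y \<notin> cball z r + cball 0 \<epsilon>" for y
    proof -
      have "y \<notin> cball z r" using that set_plus_intro[of y "cball z r" 0 "cball 0 \<epsilon>"] \<epsilon>(1) by auto
      moreover have "y \<notin> cball z' r"
      proof
        assume "y \<in> cball z' r"
        then have "(y + z - z') + (z' - z) \<in> cball z r + cball 0 \<epsilon>"
          using z'(2) by (intro set_plus_intro) (auto simp: dist_norm algebra_simps norm_minus_commute[of z z'])
        then show False using that by simp
      qed
      ultimately show ?thesis
        using test_function_outside[OF p, of "y - z'"] test_function_outside[OF p, of "y - z"]
          test_function_outside[OF test_functions_pderiv_cl[OF p], of "y - z"]
        by (simp add: dist_norm norm_minus_commute)
    qed
    have "mollify v \<psi> z' - mollify v \<psi> z - (\<Sum>k\<in>UNIV. ?h $ k * - mollify v (pderiv_cl k \<psi>) z)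
      = (\<integral>y. v y * \<psi> (y - z') - v y * \<psi> (y - z) - (\<Sum>k\<in>UNIV. ?h $ k * - (v y * pderiv_cl k \<psi> (y - z))) \<partial>lebesgue)"
      unfolding mollify_def using int[OF near(1)[OF z'(2)]] int[OF z] int'
      by (simp add: Bochner_Integration.integral_sum)
    also have "\<dots> = (\<integral>y. kf y * ?E y \<partial>lebesgue)"
    proof (rule Bochner_Integration.integral_cong[OF refl])
      fix y
      have "v y * \<psi> (y - z') - v y * \<psi> (y - z) - (\<Sum>k\<in>UNIV. ?h $ k * - (v y * pderiv_cl k \<psi> (y - z))) = v y * ?E y"
        by (simp add: algebra_simps sum_distrib_left)
      also have "\<dots> = kf y * ?E y"
        using E0[of y] by (cases "y \<in> cball z r + cball 0 \<epsilon>") (simp_all add: kf_def)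
      finally show "v y * \<psi> (y - z') - v y * \<psi> (y - z) - (\<Sum>k\<in>UNIV. ?h $ k * - (v y * pderiv_cl k \<psi> (y - z))) = kf y * ?E y" .
    qed
    also have "norm \<dots> \<le> (\<integral>y. \<bar>kf y\<bar> * (C * (norm ?h)\<^sup>2) \<partial>lebesgue)"
    proof (rule Bochner_Integration.integral_norm_bound_integral[THEN order_trans, OF _ _ _ order_refl] )
      have b: "\<bar>?E y\<bar> \<le> C * (norm ?h)\<^sup>2" for y
      proof -
        have e: "(y - z) + - ?h = y - z'"
          "(\<Sum>k\<in>UNIV. (- ?h) $ k * pderiv_cl k \<psi> (y - z)) = (\<Sum>k\<in>UNIV. ?h $ k * - pderiv_cl k \<psi> (y - z))"
          by (auto intro!: sum.cong simp: algebra_simps)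
        show ?thesis using C(2)[of "y - z" "- ?h"] unfolding e norm_minus_cancel .
      qed
      show "integrable lebesgue (\<lambda>y. \<bar>kf y\<bar> * (C * (norm ?h)\<^sup>2))" using kf by auto
      show nb: "norm (kf y * ?E y) \<le> \<bar>kf y\<bar> * (C * (norm ?h)\<^sup>2)" for y
        using b[of y] by (simp add: abs_mult mult_left_mono)
      show "integrable lebesgue (\<lambda>y. kf y * ?E y)"
      proof (rule Bochner_Integration.integrable_bound[of _ "\<lambda>y. \<bar>kf y\<bar> * (C * (norm ?h)\<^sup>2)"])
        have "(\<lambda>y. \<psi> (y - z')) \<in> borel_measurable lebesgue" "(\<lambda>y. \<psi> (y - z)) \<in> borel_measurable lebesgue"
          "\<And>k. (\<lambda>y. pderiv_cl k \<psi> (y - z)) \<in> borel_measurable lebesgue"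
          using test_functions_translate[OF p z] test_functions_translate[OF p near(1)[OF z'(2)]]
            test_functions_translate[OF test_functions_pderiv_cl[OF p] z] test_functions_integrable by blast+
        then show "(\<lambda>y. kf y * ?E y) \<in> borel_measurable lebesgue"
          using kf by (intro borel_measurable_times borel_measurable_diff borel_measurable_sum borel_measurable_uminus borel_measurable_const) auto
      qed (use kf nb in \<open>auto simp: abs_mult C(1)\<close>)
    qed
    also have "\<dots> = C * I * (norm ?h)\<^sup>2" by (simp add: I_def)
    finally show "norm (mollify v \<psi> z' - mollify v \<psi> z - (\<Sum>k\<in>UNIV. ?h $ k * - mollify v (pderiv_cl k \<psi>) z)) / norm ?h
       \<le> C * I * norm ?h"
      using z' by (simp add: divide_simps power2_eq_square mult.assoc)
  qed fact
qed


text \<open>The points of \<open>S\<close> at distance more than \<open>r\<close> from its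
  complement need not form a connected set. Therefore \<open>V\<close> is a thin neighbourhood of
  paths in \<open>S\<close> from \<open>y0\<close> to its three translates, with a radius provided
  by compactness.\<close>

lemma obtain_mollification_domain:
  fixes S :: "R3 set"
  assumes S: "open S" "connected S" "S \<noteq> {}" and per: "\<And>y k. y + axis k 1 \<in> S \<longleftrightarrow> y \<in> S"
  obtains r V y0 where "r > 0" "open V" "connected V" "y0 \<in> V" "\<And>k :: 3. y0 + axis k 1 \<in> V"
    "\<And>z. z \<in> V \<Longrightarrow> cball z r \<subseteq> S"
proof -
  obtain y0 where y0: "y0 \<in> S" using S by blast
  have pc: "path_connected S" by (rule connected_open_path_connected[OF S(1,2)])
  then have "\<exists>g. path g \<and> path_image g \<subseteq> S \<and> pathstart g = y0 \<and> pathfinish g = y0 + axis k 1" for k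
    using pc[unfolded path_connected_def, rule_format, OF y0, of "y0 + axis k 1"] y0 per[of y0 k] by simp
  then obtain g where g: "\<And>k. path (g k)" "\<And>k. path_image (g k) \<subseteq> S" "\<And>k. pathstart (g k) = y0"
    "\<And>k. pathfinish (g k) = y0 + axis k 1" by metis
  define K where "K = (\<Union>k. path_image (g k))"
  have K: "compact K" unfolding K_def by (intro compact_UN ballI compact_path_image g(1)) simp
  have K': "K \<subseteq> S" unfolding K_def using g(2) by blast
  have conK: "connected K" unfolding K_def
  proof (rule connected_Union)
    show "\<And>s. s \<in> range (\<lambda>k. path_image (g k)) \<Longrightarrow> connected s" using g connected_path_image by blast
    have "y0 \<in> path_image (g k)" for k using g(3)[of k] pathstart_in_path_image by metis
    then show "\<Inter> (range (\<lambda>k. path_image (g k))) \<noteq> {}" by blast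
  qed
  obtain r where r: "r > 0" "(\<Union>x\<in>K. cball x r) \<subseteq> S"
    using compact_subset_open_imp_cball_epsilon_subset[OF K S(1) K'] by metis
  \<comment> \<open>Half of the radius is spent on thickening the paths, the other half remains for
    the mollification.\<close>
  define V where "V = (\<Union>x\<in>K. ball x (r / 2))"
  show ?thesis
  proof (rule that[of "r / 2" V y0])
    show "open V" unfolding V_def by auto
    have KV: "K \<subseteq> V" unfolding V_def using r by force
    have yk: "y0 \<in> K" "y0 + axis k 1 \<in> K" for k
      unfolding K_def using g(3,4)[of k] pathstart_in_path_image[of "g k"] pathfinish_in_path_image[of "g k"] by auto
    then show "y0 \<in> V" "\<And>k. y0 + axis k 1 \<in> V" using KV by auto
    \<comment> \<open>Adjoining the connected set \<open>K\<close> to every ball makes all members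
      share a point, which gives connectedness of the union.\<close>
    have "V = (\<Union>x\<in>K. K \<union> ball x (r / 2))" using KV yk(1) unfolding V_def by blast
    moreover have "connected (\<Union>x\<in>K. K \<union> ball x (r / 2))"
    proof (rule connected_Union)
      show "connected s" if "s \<in> (\<lambda>x. K \<union> ball x (r / 2)) ` K" for s
        using that r conK by (auto intro!: connected_Un simp: disjoint_iff)
      show "\<Inter> ((\<lambda>x. K \<union> ball x (r / 2)) ` K) \<noteq> {}" using yk by blast
    qed
    ultimately show "connected V" by simp
    show "cball z (r / 2) \<subseteq> S" if zV: "z \<in> V" for z
    proof
      fix y assume "y \<in> cball z (r / 2)"
      moreover obtain x where "x \<in> K" "dist x z < r / 2" using zV unfolding V_def by auto
      ultimately have "y \<in> cball x r" using dist_triangle[of x y z] by auto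
      then show "y \<in> S" using r(2) \<open>x \<in> K\<close> by blast
    qed
  qed (use r in auto)
qed

lemma obtain_mollifier:
  assumes "r > 0"
  obtains \<eta> where "\<eta> \<in> test_functions (cball 0 r)" "(\<integral>y. \<eta> y \<partial>lebesgue) > 0"
proof -
  have "0 \<in> ball (0 :: R3) r" using assms by simp
  then obtain a b :: R3 where "cbox a b \<subseteq> ball 0 r" "0 \<in> box a b"
    by (rule open_contains_cbox[OF open_ball])
  then have ab: "0 \<in> box a b" "cbox a b \<subseteq> cball 0 r" using ball_subset_cball by blast+
  let ?\<eta> = "box_bump 1 a b"
  have t: "?\<eta> \<in> test_functions (cball 0 r)" by (rule test_functions_box_bump) (use ab in auto)
  have int: "integrable lebesgue ?\<eta>" by (rule test_functions_integrable[OF t])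
  have "(\<integral>y. ?\<eta> y \<partial>lebesgue) \<noteq> 0"
  proof
    assume "(\<integral>y. ?\<eta> y \<partial>lebesgue) = 0"
    then have "AE y in lebesgue. ?\<eta> y = 0"
      using integral_nonneg_eq_0_iff_AE[OF int] box_bump_nonneg by simp
    then have "AE y in lebesgue. y \<notin> box a b"
      by eventually_elim (simp add: box_bump_eq_0_iff)
    then have "negligible (box a b)"
      by (simp add: completion.AE_iff_null_sets negligible_iff_null_sets)
    then have "box a b = {}" using open_box box_ne_empty by (metis negligible_interval(2))
    then show False using ab(1) by blast
  qed
  moreover have "(\<integral>y. ?\<eta> y \<partial>lebesgue) \<ge> 0" using box_bump_nonneg by simp
  ultimately show ?thesis using that t by (simp add: less_le)
qed

text \<open>Subtracting the linear part leaves a function that is constant on the connected set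
  \<open>V\<close>, so the increment of \<open>f\<close> over a period in direction \<open>k\<close>
  is exactly \<open>c k\<close>.\<close>

lemma affine_periodic_imp_0:
  fixes f :: "R3 \<Rightarrow> real"
  assumes V: "open V" "connected V" "y0 \<in> V" "y0 + axis k 1 \<in> V"
    and f: "\<And>z. z \<in> V \<Longrightarrow> (f has_derivative (\<lambda>h. \<Sum>k\<in>UNIV. h $ k * c k)) (at z)"
    and per: "f (y0 + axis k 1) = f y0"
  shows "c k = 0"
proof -
  define L :: "R3 \<Rightarrow> real" where "L h = (\<Sum>k\<in>UNIV. h $ k * c k)" for h
  have L: "bounded_linear L" unfolding L_def[abs_def]
    by (intro bounded_linear_sum bounded_linear_mult_left[THEN bounded_linear_compose] bounded_linear_vec_nth)
  have "((\<lambda>z. f z - L z) has_derivative (\<lambda>h. 0)) (at z)" if "z \<in> V" for z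
    by (rule has_derivative_eq_rhs[OF has_derivative_diff[OF f[OF that] bounded_linear_imp_has_derivative[OF L]]])
       (simp add: L_def)
  then have "f (y0 + axis k 1) - L (y0 + axis k 1) = f y0 - L y0"
    by (rule has_derivative_zero_unique_connected[OF V(1,2) _ V(4,3)])
  moreover have "L (y0 + axis k 1) = L y0 + c k"
    by (simp add: L_def distrib_right sum.distrib axis_def if_distrib[of "\<lambda>t. t * _"] sum.delta cong: if_cong)
  ultimately show ?thesis using per by simp
qed

lemma mollify_AE_const:
  assumes S: "open S" and g: "AE y in lebesgue_on S. g y = C" and gl: "locally_integrable_in S g"
    and p: "\<psi> \<in> test_functions (cball 0 r)" and z: "cball z r \<subseteq> S"
  shows "mollify g \<psi> z = C * (\<integral>y. \<psi> y \<partial>lebesgue)"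
proof -
  note t = test_functions_translate[OF p z]
  have "AE y in lebesgue. y \<in> S \<longrightarrow> g y = C"
    using g S by (subst (asm) AE_restrict_space_iff) auto
  then have "AE y in lebesgue. g y * \<psi> (y - z) = C * \<psi> (y - z)"
    by eventually_elim (use test_function_outside[OF t] in auto)
  then have "mollify g \<psi> z = (\<integral>y. C * \<psi> (y + - z) \<partial>lebesgue)"
    unfolding mollify_def using integrable_test_function[OF gl t] test_functions_integrable[OF t]
    by (intro integral_cong_AE) auto
  also have "\<dots> = C * (\<integral>y. \<psi> y \<partial>lebesgue)" using lebesgue_integral_shift[of \<psi> "- z"] by simp
  finally show ?thesis .
qed

text \<open>After mollification the constant weak gradient becomes a classical one, multiplied by
  the positive integral of the kernel, and periodicity survives between \<open>y0\<close> and its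
  translates.\<close>

lemma periodic_constant_gradient:
  assumes S: "open S" "connected S" "S \<noteq> {}" and per: "\<And>y k. y + axis k 1 \<in> S \<longleftrightarrow> y \<in> S"
    and v: "\<And>y k. y \<in> S \<Longrightarrow> v (y + axis k 1) = v y"
    and w: "\<And>k. is_weak_deriv S k v (g k)"
    and C: "\<And>k. AE y in lebesgue_on S. g k y = C k"
  shows "C k = 0"
proof -
  obtain r V y0 where V: "r > 0" "open V" "connected V" "y0 \<in> V" "\<And>k :: 3. y0 + axis k 1 \<in> V"
    "\<And>z. z \<in> V \<Longrightarrow> cball z r \<subseteq> S" using obtain_mollification_domain[OF S per] by metis
  obtain \<eta> where \<eta>: "\<eta> \<in> test_functions (cball 0 r)" "(\<integral>y. \<eta> y \<partial>lebesgue) > 0"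
    using obtain_mollifier[OF V(1)] by metis
  have l: "locally_integrable_in S v" "\<And>k. locally_integrable_in S (g k)" using w by (auto simp: is_weak_deriv_def)
  have "C k * (\<integral>y. \<eta> y \<partial>lebesgue) = 0"
  proof (rule affine_periodic_imp_0[OF V(2-5)])
    show "mollify v \<eta> (y0 + axis k 1) = mollify v \<eta> y0"
      by (rule mollify_periodic[of S v, OF v \<eta>(1) V(6)[OF V(4)]])
    fix z assume z: "z \<in> V"
    show "(mollify v \<eta> has_derivative (\<lambda>h. \<Sum>k\<in>UNIV. h $ k * (C k * (\<integral>y. \<eta> y \<partial>lebesgue)))) (at z)"
      using mollify_has_derivative[OF S(1) l(1) \<eta>(1) V(6)[OF z]]
      by (simp add: mollify_weak_deriv[OF S(1) w \<eta>(1) V(6)[OF z]] mollify_AE_const[OF S(1) C l(2) \<eta>(1) V(6)[OF z]])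
  qed
  then show ?thesis using \<eta>(2) by simp
qed

text \<open>A displacement with constant strain has vanishing second derivatives \<open>T\<^sub>i\<^sub>j\<^sub>k = \<partial>\<^sub>j\<partial>\<^sub>k W\<^sub>i\<close> after
  mollification, because they are symmetric in \<open>j, k\<close> and antisymmetric in \<open>i, j\<close>.  Hence it is
  affine along a path from \<open>y\<^sub>0\<close> to \<open>y\<^sub>0 + e\<^sub>k\<close>, and periodicity forces its gradient to vanish.\<close>

lemma periodic_constant_strain:
  fixes W :: "3 \<Rightarrow> R3 \<Rightarrow> real" and G :: "3 \<Rightarrow> 3 \<Rightarrow> R3 \<Rightarrow> real"
  assumes S: "open S" "connected S" "S \<noteq> {}" and per: "\<And>y k. y + axis k 1 \<in> S \<longleftrightarrow> y \<in> S"
    and W: "\<And>i y k. y \<in> S \<Longrightarrow> W i (y + axis k 1) = W i y"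
    and w: "\<And>i j. is_weak_deriv S j (W i) (G i j)"
    and C: "\<And>i j. AE y in lebesgue_on S. G i j y + G j i y = C i j"
  shows "C i j = 0"
proof -
  obtain r V y0 where V: "r > 0" "open V" "connected V" "y0 \<in> V" "\<And>k :: 3. y0 + axis k 1 \<in> V"
    "\<And>z. z \<in> V \<Longrightarrow> cball z r \<subseteq> S" using obtain_mollification_domain[OF S per] by metis
  obtain \<eta> where \<eta>: "\<eta> \<in> test_functions (cball 0 r)" "(\<integral>y. \<eta> y \<partial>lebesgue) > 0"
    using obtain_mollifier[OF V(1)] by metis
  have l: "locally_integrable_in S (W i)" "locally_integrable_in S (G i j)" for i j
    using w by (auto simp: is_weak_deriv_def)
  have sym: "mollify (W i) (pderiv_cl j \<psi>) z + mollify (W j) (pderiv_cl i \<psi>) z = - C i j * (\<integral>y. \<psi> y \<partial>lebesgue)"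
    if p: "\<psi> \<in> test_functions (cball 0 r)" and z: "z \<in> V" for i j \<psi> z
  proof -
    note t = test_functions_translate[OF p V(6)[OF z]]
    have "mollify (W i) (pderiv_cl j \<psi>) z + mollify (W j) (pderiv_cl i \<psi>) z = - (mollify (G i j) \<psi> z + mollify (G j i) \<psi> z)"
      by (simp add: mollify_weak_deriv[OF S(1) w p V(6)[OF z]])
    also have "mollify (G i j) \<psi> z + mollify (G j i) \<psi> z = mollify (\<lambda>y. 1 * G i j y + 1 * G j i y) \<psi> z"
      using integrable_test_function[OF l(2) t] unfolding mollify_def by (simp add: distrib_right)
    also have "\<dots> = C i j * (\<integral>y. \<psi> y \<partial>lebesgue)"
      by (rule mollify_AE_const[OF S(1) _ locally_integrable_lincomb[OF l(2) l(2)] p V(6)[OF z]]) (use C in simp)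
    finally show ?thesis by simp
  qed
  define T where "T i j k z = mollify (W i) (pderiv_cl j (pderiv_cl k \<eta>)) z" for i j k z
  note d = test_functions_pderiv_cl[OF \<eta>(1)]
  have T0: "T i j k z = 0" if z: "z \<in> V" for i j k z
  proof -
    have c: "T i j k z = T i k j z" for i j k
      using pderiv_cl_commute[OF test_functions_smooth[OF \<eta>(1)], of j k] by (simp add: T_def mollify_def)
    \<comment> \<open>The symmetry relation is applied to the kernel
      \<open>pderiv_cl k \<eta>\<close>, whose integral is 0, so the constant \<open>C i j\<close>
      drops out.\<close>
    have a: "T i j k z = - T j i k z" for i j k
      using sym[OF d z, of i j k] integral_pderiv_cl_eq_0[OF \<eta>(1), of k] by (simp add: T_def)
    show ?thesis using c[of i j k] a[of i k j] c[of k i j] a[of k j i] c[of j k i] a[of j i k] by linarith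
  qed
  define b where "b i j z = - mollify (W i) (pderiv_cl j \<eta>) z" for i j z
  have b: "b i j z = b i j y0" if z: "z \<in> V" for i j z
  proof (rule has_derivative_zero_unique_connected[OF V(2,3) _ z V(4)])
    fix z assume z: "z \<in> V"
    have "(mollify (W i) (pderiv_cl j \<eta>) has_derivative
       (\<lambda>h. \<Sum>k\<in>UNIV. h $ k * - mollify (W i) (pderiv_cl k (pderiv_cl j \<eta>)) z)) (at z)"
      by (rule mollify_has_derivative[OF S(1) l(1) d V(6)[OF z]])
    then have "(mollify (W i) (pderiv_cl j \<eta>) has_derivative (\<lambda>h. 0)) (at z)"
      using T0[OF z] by (simp add: T_def)
    from has_derivative_minus[OF this] show "(b i j has_derivative (\<lambda>h. 0)) (at z)"
      by (simp add: b_def[abs_def])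
  qed
  have b0: "b i j y0 = 0" for i j
  proof (rule affine_periodic_imp_0[OF V(2-5)])
    show "mollify (W i) \<eta> (y0 + axis j 1) = mollify (W i) \<eta> y0"
      by (rule mollify_periodic[of S "W i", OF W \<eta>(1) V(6)[OF V(4)]])
    fix z assume z: "z \<in> V"
    show "(mollify (W i) \<eta> has_derivative (\<lambda>h. \<Sum>k\<in>UNIV. h $ k * b i k y0)) (at z)"
      using mollify_has_derivative[OF S(1) l(1) \<eta>(1) V(6)[OF z]] b[OF z] by (simp add: b_def)
  qed
  have "C i j * (\<integral>y. \<eta> y \<partial>lebesgue) = b i j y0 + b j i y0"
    using sym[OF \<eta>(1) V(4), of i j] by (simp add: b_def)
  then show ?thesis using b0 \<eta>(2) by simp
qed

section \<open>Square integrable functions on the cell\<close>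

lemma L2_on_measurable: "f \<in> L2_on B \<Longrightarrow> f \<in> borel_measurable (lebesgue_on B)"
  by (simp add: L2_on_def)

lemma L2_on_integrable_mult:
  assumes "f \<in> L2_on B" "g \<in> L2_on B"
  shows "integrable (lebesgue_on B) (\<lambda>x. f x * g x)"
proof (rule Bochner_Integration.integrable_bound)
  show "integrable (lebesgue_on B) (\<lambda>x. (f x)\<^sup>2 + (g x)\<^sup>2)"
    using assms by (simp add: L2_on_def)
  show "(\<lambda>x. f x * g x) \<in> borel_measurable (lebesgue_on B)"
    using assms by (intro borel_measurable_times) (auto simp: L2_on_def)
  have "\<bar>a * b\<bar> \<le> a\<^sup>2 + b\<^sup>2" for a b :: real
  proof -
    have "0 \<le> (\<bar>a\<bar> - \<bar>b\<bar>)\<^sup>2" by simp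
    then have "2 * \<bar>a * b\<bar> \<le> a\<^sup>2 + b\<^sup>2" by (simp add: power2_diff abs_mult)
    then show ?thesis by (smt (verit) abs_ge_zero)
  qed
  then show "AE x in lebesgue_on B. norm (f x * g x) \<le> norm ((f x)\<^sup>2 + (g x)\<^sup>2)"
    by (simp add: order_trans[OF _ abs_ge_self])
qed

lemma L2_on_cmult: "f \<in> L2_on B \<Longrightarrow> (\<lambda>x. c * f x) \<in> L2_on B"
  by (auto simp: L2_on_def power_mult_distrib)

lemma L2_on_add:
  assumes "f \<in> L2_on B" "g \<in> L2_on B"
  shows "(\<lambda>x. f x + g x) \<in> L2_on B"
  using assms L2_on_integrable_mult[OF assms]
  by (auto simp: L2_on_def power2_sum mult.assoc intro!: Bochner_Integration.integrable_add)

lemma L2_on_diff: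
  assumes "f \<in> L2_on B" "g \<in> L2_on B"
  shows "(\<lambda>x. f x - g x) \<in> L2_on B"
  using L2_on_add[OF assms(1) L2_on_cmult[OF assms(2), of "- 1"]] by simp

lemma L2_on_const: "B \<in> lmeasurable \<Longrightarrow> (\<lambda>x. c) \<in> L2_on B"
  using finite_measure.integrable_const[OF finite_measure_lebesgue_on, of B] by (simp add: L2_on_def)

lemma L2_on_zero: "(\<lambda>x. 0) \<in> L2_on B"
  by (simp add: L2_on_def)

lemma L2_on_sum: "(\<And>i. i \<in> I \<Longrightarrow> f i \<in> L2_on B) \<Longrightarrow> (\<lambda>x. \<Sum>i\<in>I. f i x) \<in> L2_on B"
  by (induction I rule: infinite_finite_induct) (auto intro: L2_on_zero L2_on_add)

lemma L2_on_bounded_mult: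
  assumes f: "f \<in> L2_on B" and m: "m \<in> borel_measurable (lebesgue_on B)" and C: "\<And>x. \<bar>m x\<bar> \<le> C"
  shows "(\<lambda>x. m x * f x) \<in> L2_on B"
  unfolding L2_on_def
proof (intro CollectI conjI)
  show mf: "(\<lambda>x. m x * f x) \<in> borel_measurable (lebesgue_on B)"
    using f m by (intro borel_measurable_times) (auto simp: L2_on_def)
  show "integrable (lebesgue_on B) (\<lambda>x. (m x * f x)\<^sup>2)"
  proof (rule Bochner_Integration.integrable_bound)
    show "integrable (lebesgue_on B) (\<lambda>x. C\<^sup>2 * (f x)\<^sup>2)" using f by (simp add: L2_on_def)
    show "(\<lambda>x. (m x * f x)\<^sup>2) \<in> borel_measurable (lebesgue_on B)" using mf by (rule borel_measurable_power)
    have "(m x)\<^sup>2 \<le> C\<^sup>2" for x using C[of x] abs_le_square_iff[of "m x" C] by simp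
    then show "AE x in lebesgue_on B. norm ((m x * f x)\<^sup>2) \<le> norm (C\<^sup>2 * (f x)\<^sup>2)"
      by (simp add: power_mult_distrib mult_right_mono)
  qed
qed

lemma L2_on_AE:
  assumes B: "B \<in> sets lebesgue" and f: "f \<in> L2_on B" and eq: "AE x in lebesgue_on B. f x = h x"
  shows "h \<in> L2_on B"
proof -
  have h: "h \<in> borel_measurable (lebesgue_on B)"
    using borel_measurable_lebesgue_on_AE[OF B L2_on_measurable[OF f] eq] .
  have "integrable (lebesgue_on B) (\<lambda>x. (h x)\<^sup>2)"
    by (rule integrable_cong_AE_imp[of _ "\<lambda>x. (f x)\<^sup>2"])
       (use f h eq in \<open>auto simp: L2_on_def intro: borel_measurable_power\<close>)
  then show ?thesis using h by (simp add: L2_on_def)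
qed

lemma AE_lebesgue_on_subset:
  assumes "A \<in> sets lebesgue" "B \<in> sets lebesgue" "B \<subseteq> A" "AE x in lebesgue_on A. P x"
  shows "AE x in lebesgue_on B. P x"
proof -
  have "negligible {x \<in> A. \<not> P x}" by (rule iffD1[OF AE_lebesgue_on_iff_negligible[OF assms(1)] assms(4)])
  then have "negligible {x \<in> B. \<not> P x}" by (rule negligible_subset) (use assms(3) in auto)
  then show ?thesis by (rule iffD2[OF AE_lebesgue_on_iff_negligible[OF assms(2)]])
qed

lemma material_lmeasurable:
  assumes "open S" shows "material S \<in> lmeasurable"
  using assms by (auto simp: material_def unit_cell_eq_box intro!: lmeasurable_open bounded_Int)

lemma material_sets: "open S \<Longrightarrow> material S \<in> sets lebesgue"
  using material_lmeasurable by blast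

text \<open>Membership in \<open>H1\<close> provides some square integrable weak derivative, while
  \<open>wderiv\<close> is an arbitrary choice. Uniqueness almost everywhere transfers the
  integrability.\<close>

lemma H1_wderiv:
  assumes A: "open A" and v: "v \<in> H1 A"
  shows "is_weak_deriv A k v (wderiv A k v)" "wderiv A k v \<in> L2_on A"
proof -
  obtain g where g: "is_weak_deriv A k v g" "g \<in> L2_on A" using v by (auto simp: H1_def)
  show "is_weak_deriv A k v (wderiv A k v)" by (rule is_weak_deriv_wderiv[OF g(1)])
  have "AE x in lebesgue_on A. g x = wderiv A k v x"
    using wderiv_AE_eq[OF A g(1)] by eventually_elim simp
  then show "wderiv A k v \<in> L2_on A" using A by (intro L2_on_AE[OF _ g(2)]) auto
qed

lemma H1_per_wderiv:
  assumes S: "open S" and v: "v \<in> H1_per S"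
  shows "is_weak_deriv S k v (wderiv S k v)" "wderiv S k v \<in> L2_on (material S)"
proof -
  obtain g where g: "is_weak_deriv S k v g" "g \<in> L2_on (material S)" using v unfolding H1_per_def by blast
  show "is_weak_deriv S k v (wderiv S k v)" by (rule is_weak_deriv_wderiv[OF g(1)])
  have "AE x in lebesgue_on S. g x = wderiv S k v x"
    using wderiv_AE_eq[OF S g(1)] by eventually_elim simp
  then have "AE x in lebesgue_on (material S). g x = wderiv S k v x"
    by (rule AE_lebesgue_on_subset[rotated 3]) (use S material_sets[OF S] in \<open>auto simp: material_def\<close>)
  then show "wderiv S k v \<in> L2_on (material S)" by (rule L2_on_AE[OF material_sets[OF S] g(2)])
qed

lemma H1_per_lincomb:
  assumes S: "open S" and v: "v \<in> H1_per S" and w: "w \<in> H1_per S"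
  shows "(\<lambda>y. a * v y + b * w y) \<in> H1_per S"
    and "AE y in lebesgue_on (material S). wderiv S k (\<lambda>y. a * v y + b * w y) y = a * wderiv S k v y + b * wderiv S k w y"
proof -
  have "is_weak_deriv S k (\<lambda>y. a * v y + b * w y) (\<lambda>y. a * wderiv S k v y + b * wderiv S k w y)
    \<and> (\<lambda>y. a * wderiv S k v y + b * wderiv S k w y) \<in> L2_on (material S)" for k
    using H1_per_wderiv[OF S v, of k] H1_per_wderiv[OF S w, of k]
    by (intro conjI is_weak_deriv_lincomb[OF S] L2_on_add L2_on_cmult)
  moreover have "(\<lambda>y. a * v y + b * w y) \<in> L2_on (material S)"
    using v w by (intro L2_on_add L2_on_cmult) (auto simp: H1_per_def)
  ultimately show "(\<lambda>y. a * v y + b * w y) \<in> H1_per S"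
    using v w unfolding H1_per_def mem_Collect_eq by (intro conjI ballI allI) (simp, assumption, rule exI)
  have "AE y in lebesgue_on S. wderiv S k (\<lambda>y. a * v y + b * w y) y = a * wderiv S k v y + b * wderiv S k w y"
    by (rule wderiv_lincomb[OF S H1_per_wderiv(1)[OF S v] H1_per_wderiv(1)[OF S w]])
  then show "AE y in lebesgue_on (material S). wderiv S k (\<lambda>y. a * v y + b * w y) y = a * wderiv S k v y + b * wderiv S k w y"
    by (rule AE_lebesgue_on_subset[rotated 3]) (use S material_sets[OF S] in \<open>auto simp: material_def\<close>)
qed

lemma H1_per_zero: "(\<lambda>y. 0) \<in> H1_per S"
  using is_weak_deriv_zero L2_on_zero unfolding H1_per_def by blast

lemma wderiv_zero_material:
  assumes "open S" shows "AE y in lebesgue_on (material S). wderiv S k (\<lambda>y. 0) y = 0"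
  by (rule AE_lebesgue_on_subset[OF _ _ _ wderiv_zero[OF assms]])
     (use assms material_sets[OF assms] in \<open>auto simp: material_def\<close>)

section \<open>Step functions with rational values and separability on the cell\<close>

definition grid :: "nat \<Rightarrow> R3 \<Rightarrow> int \<times> int \<times> int" where
  "grid n y = (\<lfloor>real n * y $ 1\<rfloor>, \<lfloor>real n * y $ 2\<rfloor>, \<lfloor>real n * y $ 3\<rfloor>)"

text \<open>Clipping by \<open>nat\<close> is harmless on the unit cell, where all the integer parts
  are nonnegative.\<close>

definition grid_code :: "int \<times> int \<times> int \<Rightarrow> nat" where
  "grid_code = (\<lambda>(p, q, r). prod_encode (nat p, prod_encode (nat q, nat r)))"

text \<open>Mesh \<open>1 / n\<close> together with a list of rational cube values: this encoding
  makes the family countable by its type alone. Cubes whose code exceeds the list get the value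
  0.\<close>

definition step :: "nat \<times> rat list \<Rightarrow> R3 \<Rightarrow> real" where
  "step s y = (let c = grid_code (grid (fst s) y) in if c < length (snd s) then of_rat (snd s ! c) else 0)"

lemma step_measurable: "step s \<in> borel_measurable borel"
proof -
  have g: "grid n \<in> borel \<rightarrow>\<^sub>M count_space UNIV" for n
  proof (subst measurable_count_space_eq_countable)
    have "grid n -` {a} \<inter> space borel \<in> sets borel" for a
    proof -
      obtain p q r where a: "a = (p, q, r)" by (cases a) auto
      have fl: "{y :: R3. \<lfloor>real n * y $ i\<rfloor> = m} \<in> sets borel" for i m
      proof -
        have "{y :: R3. \<lfloor>real n * y $ i\<rfloor> = m} = {y. of_int m \<le> real n * y $ i} \<inter> {y. real n * y $ i < of_int m + 1}"
          by (auto simp: floor_eq_iff)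
        moreover have "{y :: R3. of_int m \<le> real n * y $ i} \<in> sets borel"
          by (intro borel_closed closed_Collect_le continuous_intros)
        moreover have "{y :: R3. real n * y $ i < of_int m + 1} \<in> sets borel"
          by (intro borel_open open_Collect_less continuous_intros)
        ultimately show ?thesis by auto
      qed
      have "grid n -` {a} \<inter> space borel = {y. \<lfloor>real n * y $ 1\<rfloor> = p} \<inter> {y. \<lfloor>real n * y $ 2\<rfloor> = q} \<inter> {y. \<lfloor>real n * y $ 3\<rfloor> = r}"
        by (auto simp: grid_def a)
      then show ?thesis using fl by (simp add: sets.Int)
    qed
    then show "grid n \<in> space borel \<rightarrow> UNIV \<and> (\<forall>a\<in>UNIV. grid n -` {a} \<inter> space borel \<in> sets borel)" by simp
  qed simp
  show ?thesis
    unfolding step_def[abs_def] Let_def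
    by (rule measurable_compose[OF g]) simp
qed

lemma step_L2: 
  assumes "B \<in> lmeasurable" shows "step s \<in> L2_on B"
proof -
  define C where "C = (\<Sum>c\<leftarrow>snd s. \<bar>of_rat c :: real\<bar>)"
  have "\<bar>of_rat c\<bar> \<le> C" if "c \<in> set (snd s)" for c
    unfolding C_def using that by (intro member_le_sum_list) auto
  moreover have "0 \<le> C" unfolding C_def by (intro sum_list_nonneg) auto
  ultimately have C: "\<bar>step s x\<bar> \<le> C" for x by (simp add: step_def Let_def)
  have "step s \<in> borel_measurable (lebesgue_on B)"
    using step_measurable[of s] by (intro measurable_restrict_space1 measurable_completion) simp
  from L2_on_bounded_mult[OF L2_on_const[OF assms, of 1] this C] show ?thesis by simp
qed

definition step_approximable :: "R3 set \<Rightarrow> (R3 \<Rightarrow> real) set" where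
  "step_approximable B = {F \<in> L2_on B. \<forall>\<epsilon>>0. \<exists>s. (\<integral>x. (F x - step s x)\<^sup>2 \<partial>lebesgue_on B) < \<epsilon>}"

lemma L2_dist_triangle:
  assumes "f \<in> L2_on B" "g \<in> L2_on B" "h \<in> L2_on B"
  shows "(\<integral>x. (f x - h x)\<^sup>2 \<partial>lebesgue_on B) \<le> 2 * (\<integral>x. (f x - g x)\<^sup>2 \<partial>lebesgue_on B) + 2 * (\<integral>x. (g x - h x)\<^sup>2 \<partial>lebesgue_on B)"
proof -
  have i: "integrable (lebesgue_on B) (\<lambda>x. (f x - h x)\<^sup>2)" "integrable (lebesgue_on B) (\<lambda>x. (f x - g x)\<^sup>2)"
    "integrable (lebesgue_on B) (\<lambda>x. (g x - h x)\<^sup>2)"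
    using L2_on_diff[OF assms(1,3)] L2_on_diff[OF assms(1,2)] L2_on_diff[OF assms(2,3)] by (auto simp: L2_on_def)
  have "(\<integral>x. (f x - h x)\<^sup>2 \<partial>lebesgue_on B) \<le> (\<integral>x. 2 * (f x - g x)\<^sup>2 + 2 * (g x - h x)\<^sup>2 \<partial>lebesgue_on B)"
  proof (rule integral_mono)
    fix x
    have "0 \<le> ((f x - g x) - (g x - h x))\<^sup>2" by simp
    then show "(f x - h x)\<^sup>2 \<le> 2 * (f x - g x)\<^sup>2 + 2 * (g x - h x)\<^sup>2"
      by (simp add: power2_eq_square algebra_simps)
  qed (use i in auto)
  then show ?thesis using i by simp
qed

lemma step_approximable_limit:
  assumes F: "F \<in> L2_on B" and B: "B \<in> lmeasurable" and Fn: "\<And>n. Fn n \<in> step_approximable B"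
    and lim: "(\<lambda>n. \<integral>x. (F x - Fn n x)\<^sup>2 \<partial>lebesgue_on B) \<longlonglongrightarrow> 0"
  shows "F \<in> step_approximable B"
  unfolding step_approximable_def
proof (intro CollectI conjI F allI impI)
  fix \<epsilon> :: real assume \<epsilon>: "\<epsilon> > 0"
  have "\<forall>\<^sub>F n in sequentially. (\<integral>x. (F x - Fn n x)\<^sup>2 \<partial>lebesgue_on B) < \<epsilon> / 4"
    using order_tendstoD(2)[OF lim, of "\<epsilon> / 4"] \<epsilon> by simp
  then obtain n where n: "(\<integral>x. (F x - Fn n x)\<^sup>2 \<partial>lebesgue_on B) < \<epsilon> / 4"
    unfolding eventually_sequentially by blast
  have "0 < \<epsilon> / 4" using \<epsilon> by simp
  then obtain s where s: "(\<integral>x. (Fn n x - step s x)\<^sup>2 \<partial>lebesgue_on B) < \<epsilon> / 4"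
    using Fn[of n] unfolding step_approximable_def mem_Collect_eq by blast
  have "Fn n \<in> L2_on B" using Fn by (auto simp: step_approximable_def)
  from L2_dist_triangle[OF F this step_L2[OF B, of s]] n s
  show "\<exists>s. (\<integral>x. (F x - step s x)\<^sup>2 \<partial>lebesgue_on B) < \<epsilon>" by (intro exI[of _ s]) linarith
qed

lemma step_approximable_limit_bounded:
  assumes B: "B \<in> lmeasurable" and F: "F \<in> L2_on B" and Fn: "\<And>n. Fn n \<in> step_approximable B"
    and lim: "AE x in lebesgue_on B. (\<lambda>n. Fn n x) \<longlonglongrightarrow> F x"
    and w: "w \<in> L2_on B" and bd: "\<And>n. AE x in lebesgue_on B. \<bar>F x - Fn n x\<bar> \<le> w x"
  shows "F \<in> step_approximable B"
proof (rule step_approximable_limit[OF F B Fn])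
  have "(\<lambda>n. \<integral>x. (F x - Fn n x)\<^sup>2 \<partial>lebesgue_on B) \<longlonglongrightarrow> (\<integral>x. 0 \<partial>lebesgue_on B)"
  proof (rule integral_dominated_convergence[where w = "\<lambda>x. (w x)\<^sup>2"])
    show "(\<lambda>x. (F x - Fn n x)\<^sup>2) \<in> borel_measurable (lebesgue_on B)" for n
      using F Fn[of n] by (intro borel_measurable_power borel_measurable_diff) (auto simp: step_approximable_def L2_on_def)
    show "integrable (lebesgue_on B) (\<lambda>x. (w x)\<^sup>2)" using w by (simp add: L2_on_def)
    show "AE x in lebesgue_on B. (\<lambda>n. (F x - Fn n x)\<^sup>2) \<longlonglongrightarrow> 0"
      using lim
    proof eventually_elim
      case (elim x)
      have "(\<lambda>n. (F x - Fn n x)\<^sup>2) \<longlonglongrightarrow> (F x - F x)\<^sup>2" by (intro tendsto_intros elim)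
      then show ?case by simp
    qed
    show "AE x in lebesgue_on B. norm ((F x - Fn n x)\<^sup>2) \<le> (w x)\<^sup>2" for n
      using bd[of n]
    proof eventually_elim
      case (elim x)
      then show ?case using power_mono[OF elim, of 2] by simp
    qed
  qed simp
  then show "(\<lambda>n. \<integral>x. (F x - Fn n x)\<^sup>2 \<partial>lebesgue_on B) \<longlonglongrightarrow> 0" by simp
qed

lemma step_step_approximable:
  assumes "B \<in> lmeasurable" shows "step s \<in> step_approximable B"
  unfolding step_approximable_def
proof (intro CollectI conjI allI impI)
  show "step s \<in> L2_on B" by (rule step_L2[OF assms])
  fix \<epsilon> :: real assume "\<epsilon> > 0"
  then show "\<exists>t. (\<integral>x. (step s x - step t x)\<^sup>2 \<partial>lebesgue_on B) < \<epsilon>" by (intro exI[of _ s]) simp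
qed

lemma continuous_step_approximable:
  assumes B: "B \<in> lmeasurable" "B \<subseteq> unit_cell" and g: "continuous_on UNIV g"
  shows "g \<in> step_approximable B"
proof -
  have "compact (g ` cbox 0 1)" by (intro compact_continuous_image continuous_on_subset[OF g]) auto
  then obtain M where M: "\<And>y. y \<in> cbox 0 1 \<Longrightarrow> \<bar>g y\<bar> \<le> M"
    by (force dest: compact_imp_bounded simp: bounded_real)
  have Bc: "y \<in> cbox 0 1" if "y \<in> B" for y
    using that B(2) box_subset_cbox unfolding unit_cell_eq_box by blast
  have m: "g \<in> borel_measurable (lebesgue_on B)"
    using g by (intro measurable_restrict_space1 measurable_completion) (auto intro: borel_measurable_continuous_onI)
  \<comment> \<open>The bound \<open>M\<close> holds only on the closed unit cube. Truncating at
    level \<open>M\<close> gives a globally bounded function that coincides with \<open>g\<close> on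
    \<open>B\<close>.\<close>
  have gL2: "g \<in> L2_on B"
  proof -
    have "(\<lambda>x. max (- M) (min M (g x))) \<in> borel_measurable (lebesgue_on B)"
      using m by (intro borel_measurable_max borel_measurable_min borel_measurable_const)
    from L2_on_bounded_mult[OF L2_on_const[OF B(1), of 1] this, of "\<bar>M\<bar>"]
    have "(\<lambda>x. max (- M) (min M (g x))) \<in> L2_on B" by (simp add: max_def min_def abs_if)
    then show ?thesis
    proof (rule L2_on_AE[OF fmeasurableD[OF B(1)]])
      show "AE x in lebesgue_on B. max (- M) (min M (g x)) = g x"
        using M Bc by (intro AE_I2) (force simp: abs_le_iff)
    qed
  qed
  define pt :: "nat \<Rightarrow> nat \<times> nat \<times> nat \<Rightarrow> R3" where
    "pt n = (\<lambda>(p, q, r). vector [real p / real n, real q / real n, real r / real n])" for n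
  have "\<exists>c. \<bar>of_rat c - g (pt n a)\<bar> < 1 / real (Suc n)" for n a
  proof -
    have "g (pt n a) - 1 / real (Suc n) < g (pt n a) + 1 / real (Suc n)" by simp
    from of_rat_dense[OF this] obtain q where
      "g (pt n a) - 1 / real (Suc n) < of_rat q" "of_rat q < g (pt n a) + 1 / real (Suc n)" by blast
    then show ?thesis by (intro exI[of _ q]) linarith
  qed
  then obtain c where c: "\<And>n a. \<bar>of_rat (c n a) - g (pt n a)\<bar> < 1 / real (Suc n)" by metis
  define dec :: "nat \<Rightarrow> nat \<times> nat \<times> nat" where
    "dec i = (let (p, j) = prod_decode i in (p, prod_decode j))" for i
  \<comment> \<open>The value list has to reach the largest pairing code of an index triple with
    entries at most \<open>n\<close>; inside the cell no larger index occurs.\<close>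
  define N where "N n = Suc (Max ((\<lambda>(p, q, r). prod_encode (p, prod_encode (q, r))) ` ({..n} \<times> {..n} \<times> {..n})))" for n :: nat
  define s where "s n = (n, map (\<lambda>i. c n (dec i)) [0..<N n])" for n
  define G where "G n y = pt n (nat \<lfloor>real n * y $ 1\<rfloor>, nat \<lfloor>real n * y $ 2\<rfloor>, nat \<lfloor>real n * y $ 3\<rfloor>)" for n and y :: R3
  have bnd: "nat \<lfloor>real n * y $ i\<rfloor> \<le> n" "real n * y $ i - 1 \<le> real (nat \<lfloor>real n * y $ i\<rfloor>)"
    "real (nat \<lfloor>real n * y $ i\<rfloor>) \<le> real n * y $ i" if "y \<in> B" for y i n
  proof -
    have y: "0 \<le> y $ i" "y $ i \<le> 1" using Bc[OF that] by (auto simp: mem_box_cart)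
    have "real n * y $ i \<le> real n" using y by (simp add: mult_left_le)
    then show "nat \<lfloor>real n * y $ i\<rfloor> \<le> n" by (simp add: floor_le_iff nat_le_iff)
    have "0 \<le> \<lfloor>real n * y $ i\<rfloor>" using y by simp
    then show "real n * y $ i - 1 \<le> real (nat \<lfloor>real n * y $ i\<rfloor>)"
      "real (nat \<lfloor>real n * y $ i\<rfloor>) \<le> real n * y $ i" by linarith+
  qed
  have step: "\<bar>step (s n) y - g (G n y)\<bar> < 1 / real (Suc n)" if y: "y \<in> B" for n y
  proof -
    let ?p = "nat \<lfloor>real n * y $ 1\<rfloor>" and ?q = "nat \<lfloor>real n * y $ 2\<rfloor>" and ?r = "nat \<lfloor>real n * y $ 3\<rfloor>"
    let ?i = "prod_encode (?p, prod_encode (?q, ?r))"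
    have "?i \<le> Max ((\<lambda>(p, q, r). prod_encode (p, prod_encode (q, r))) ` ({..n} \<times> {..n} \<times> {..n}))"
      using bnd(1)[OF y] by (intro Max_ge) (auto intro!: image_eqI[of _ _ "(?p, ?q, ?r)"])
    then have "?i < N n" by (simp add: N_def)
    then have "step (s n) y = of_rat (c n (dec ?i))"
      by (simp add: step_def grid_code_def grid_def s_def)
    also have "dec ?i = (?p, ?q, ?r)" by (simp add: dec_def)
    finally show ?thesis using c by (simp add: G_def)
  qed
  have Gc: "G n y \<in> cbox 0 1" if y: "y \<in> B" for n y
  proof -
    have "real (nat \<lfloor>real n * y $ i\<rfloor>) / real n \<le> 1" for i
      using bnd(1)[OF y, of n i] by (cases "n = 0") (auto simp: divide_le_eq_1)
    then show ?thesis by (simp add: G_def pt_def mem_box_cart forall_3 vector_3)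
  qed
  have Glim: "(\<lambda>n. G n y) \<longlonglongrightarrow> y" if y: "y \<in> B" for y
  proof (rule vec_tendstoI)
    fix i :: 3
    have "(\<lambda>n. real (nat \<lfloor>real n * y $ i\<rfloor>) / real n) \<longlonglongrightarrow> y $ i"
    proof (rule tendsto_sandwich)
      have "(\<lambda>n. y $ i - 1 / real n) \<longlonglongrightarrow> y $ i - 0" by (intro tendsto_intros lim_1_over_n)
      then show "(\<lambda>n. y $ i - 1 / real n) \<longlonglongrightarrow> y $ i" by simp
      show "\<forall>\<^sub>F n in sequentially. y $ i - 1 / real n \<le> real (nat \<lfloor>real n * y $ i\<rfloor>) / real n"
        using eventually_gt_at_top[of 0]
      proof eventually_elim
        case (elim n)
        have "(real n * y $ i - 1) / real n \<le> real (nat \<lfloor>real n * y $ i\<rfloor>) / real n"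
          by (intro divide_right_mono bnd(2)[OF y]) simp
        then show ?case using elim by (simp add: diff_divide_distrib)
      qed
      show "\<forall>\<^sub>F n in sequentially. real (nat \<lfloor>real n * y $ i\<rfloor>) / real n \<le> y $ i"
        using eventually_gt_at_top[of 0]
      proof eventually_elim
        case (elim n)
        have "real (nat \<lfloor>real n * y $ i\<rfloor>) / real n \<le> (real n * y $ i) / real n"
          by (intro divide_right_mono bnd(3)[OF y]) simp
        then show ?case using elim by simp
      qed
    qed simp
    moreover have "G n y $ i = real (nat \<lfloor>real n * y $ i\<rfloor>) / real n" for n
      using exhaust_3[of i] by (auto simp: G_def pt_def vector_3)
    ultimately show "(\<lambda>n. G n y $ i) \<longlonglongrightarrow> y $ i" by simp
  qed
  show ?thesis
  \<comment> \<open>The grid values differ from values of \<open>g\<close> on the closed cube by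
    less than 1, hence are at most \<open>M + 1\<close> in absolute value, while \<open>g\<close>
    contributes another \<open>M\<close>.\<close>
  proof (rule step_approximable_limit_bounded[OF B(1) gL2 step_step_approximable[OF B(1)], where w = "\<lambda>x. 2 * M + 1"])
    show "(\<lambda>x. 2 * M + 1) \<in> L2_on B" by (rule L2_on_const[OF B(1)])
    show "AE x in lebesgue_on B. (\<lambda>n. step (s n) x) \<longlonglongrightarrow> g x"
    proof (rule AE_I2)
      fix x assume "x \<in> space (lebesgue_on B)"
      then have x: "x \<in> B" by simp
      have "isCont g x" using g by (simp add: continuous_on_eq_continuous_at)
      then have 1: "(\<lambda>n. g (G n x)) \<longlonglongrightarrow> g x" by (rule isCont_tendsto_compose[OF _ Glim[OF x]])
      have "(\<lambda>n. step (s n) x - g (G n x)) \<longlonglongrightarrow> 0"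
        by (rule Lim_null_comparison[OF _ LIMSEQ_Suc[OF lim_1_over_n]])
           (use step[OF x] in \<open>auto intro!: always_eventually less_imp_le\<close>)
      from tendsto_add[OF this 1] show "(\<lambda>n. step (s n) x) \<longlonglongrightarrow> g x" by simp
    qed
    show "AE x in lebesgue_on B. \<bar>g x - step (s n) x\<bar> \<le> 2 * M + 1" for n
    proof (rule AE_I2)
      fix x assume "x \<in> space (lebesgue_on B)"
      then have x: "x \<in> B" by simp
      have "1 / real (Suc n) \<le> 1" by simp
      then show "\<bar>g x - step (s n) x\<bar> \<le> 2 * M + 1"
        using step[OF x, of n] M[OF Gc[OF x, of n]] M[OF Bc[OF x]] by linarith
    qed
  qed
qed

text \<open>The class is enlarged by dominated limits: from continuous functions to bounded
  measurable ones, which are almost everywhere limits of truncated continuous functions, and from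
  there to all square integrable ones by truncating at level \<open>n\<close>.\<close>

lemma L2_on_step_approximable:
  assumes B: "B \<in> lmeasurable" "B \<subseteq> unit_cell" and F: "F \<in> L2_on B"
  shows "F \<in> step_approximable B"
proof -
  note Bs = fmeasurableD[OF B(1)]
  have bounded: "F \<in> step_approximable B" if F: "F \<in> borel_measurable (lebesgue_on B)" and M: "\<And>x. \<bar>F x\<bar> \<le> M" for F M
  proof -
    have "F measurable_on B" by (rule iffD2[OF measurable_on_iff_borel_measurable[OF Bs] F])
    then obtain N g where N: "negligible N" and g: "\<And>n. continuous_on UNIV (g n)"
      "\<And>x. x \<notin> N \<Longrightarrow> (\<lambda>n. g n x) \<longlonglongrightarrow> (if x \<in> B then F x else 0)"
      unfolding measurable_on_def by metis
    define h where "h n x = max (- M) (min M (g n x))" for n x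
    have M0: "M \<ge> 0" using M[of 0] by simp
    have "AE x in lebesgue_on B. x \<notin> N"
      unfolding AE_lebesgue_on_iff_negligible[OF Bs] by (rule negligible_subset[OF N]) auto
    then have lim: "AE x in lebesgue_on B. (\<lambda>n. h n x) \<longlonglongrightarrow> F x"
      using AE_space
    proof eventually_elim
      case (elim x)
      then have "(\<lambda>n. g n x) \<longlonglongrightarrow> F x" using g(2)[of x] by simp
      then have "(\<lambda>n. max (- M) (min M (g n x))) \<longlonglongrightarrow> max (- M) (min M (F x))"
        by (intro tendsto_max tendsto_min tendsto_const)
      also have "max (- M) (min M (F x)) = F x" using M[of x] by (auto simp: abs_le_iff)
      finally show ?case by (simp add: h_def)
    qed
    have FL: "F \<in> L2_on B" using L2_on_bounded_mult[OF L2_on_const[OF B(1), of 1] F M] by simp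
    show ?thesis
    proof (rule step_approximable_limit_bounded[OF B(1) FL _ lim L2_on_const[OF B(1), of "2 * M"]])
      show "h n \<in> step_approximable B" for n
        unfolding h_def[abs_def] using g(1)[of n]
        by (intro continuous_step_approximable[OF B] continuous_on_max continuous_on_min continuous_on_const)
      show "AE x in lebesgue_on B. \<bar>F x - h n x\<bar> \<le> 2 * M" for n
      proof (rule AE_I2)
        fix x show "\<bar>F x - h n x\<bar> \<le> 2 * M" using M[of x] M0 unfolding h_def by linarith
      qed
    qed
  qed
  define h where "h n x = max (- real n) (min (real n) (F x))" for n :: nat and x
  show ?thesis
  proof (rule step_approximable_limit_bounded[OF B(1) F])
    show "h n \<in> step_approximable B" for n
    proof (rule bounded)
      show "h n \<in> borel_measurable (lebesgue_on B)" unfolding h_def[abs_def]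
        using L2_on_measurable[OF F] by (intro borel_measurable_max borel_measurable_min borel_measurable_const)
      show "\<bar>h n x\<bar> \<le> real n" for x unfolding h_def by linarith
    qed
    show "AE x in lebesgue_on B. (\<lambda>n. h n x) \<longlonglongrightarrow> F x"
    proof (rule AE_I2)
      fix x
      obtain m :: nat where m: "\<bar>F x\<bar> < real m" using reals_Archimedean2 by blast
      have "h n x = F x" if "n \<ge> m" for n
      proof -
        have "real m \<le> real n" using that by simp
        then show ?thesis unfolding h_def using m by linarith
      qed
      then have "\<forall>\<^sub>F n in sequentially. h n x = F x" by (intro eventually_sequentiallyI[of m])
      then show "(\<lambda>n. h n x) \<longlonglongrightarrow> F x" by (rule tendsto_eventually)
    qed
    have "F \<in> borel_measurable (lebesgue_on B)" by (rule L2_on_measurable[OF F])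
    then show "(\<lambda>x. \<bar>F x\<bar>) \<in> L2_on B" using F by (auto simp: L2_on_def)
    show "AE x in lebesgue_on B. \<bar>F x - h n x\<bar> \<le> \<bar>F x\<bar>" for n
    proof (rule AE_I2)
      fix x
      have "real n \<ge> 0" by simp
      then show "\<bar>F x - h n x\<bar> \<le> \<bar>F x\<bar>" unfolding h_def by linarith
    qed
  qed
qed

text \<open>Step functions are not of the form \<open>\<Phi> v\<close>, so they serve only as
  labels: for each triple of step functions and each tolerance, one element of \<open>\<V>\<close>
  close to the triple is picked, provided that there is one.\<close>

lemma countable_L2_dense:
  fixes \<Phi> :: "'v \<Rightarrow> 3 \<Rightarrow> R3 \<Rightarrow> real"
  assumes B: "B \<in> lmeasurable" "B \<subseteq> unit_cell" and L2: "\<And>v k. v \<in> \<V> \<Longrightarrow> \<Phi> v k \<in> L2_on B"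
  obtains \<G> where "countable \<G>" "\<G> \<subseteq> \<V>"
    "\<And>v \<epsilon>. v \<in> \<V> \<Longrightarrow> \<epsilon> > 0 \<Longrightarrow> \<exists>g\<in>\<G>. \<forall>k. (\<integral>x. (\<Phi> v k x - \<Phi> g k x)\<^sup>2 \<partial>lebesgue_on B) < \<epsilon>"
proof -
  define sel where "sel t k = (case t of (s1, s2, s3) \<Rightarrow> if k = (1 :: 3) then s1 else if k = 2 then s2 else s3)"
    for t :: "(nat \<times> rat list) \<times> (nat \<times> rat list) \<times> (nat \<times> rat list)" and k
  define near where "near v t n \<longleftrightarrow> v \<in> \<V> \<and> (\<forall>k. (\<integral>x. (\<Phi> v k x - step (sel t k) x)\<^sup>2 \<partial>lebesgue_on B) < 1 / real (Suc n))" for v t n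
  define pick where "pick = (\<lambda>(t, n). SOME v. near v t n)"
  define \<G> where "\<G> = pick ` {(t, n). \<exists>v. near v t n}"
  have pick: "near (pick (t, n)) t n" if "near v t n" for v t n
    unfolding pick_def using someI[of "\<lambda>v. near v t n", OF that] by simp
  show ?thesis
  proof (rule that[of \<G>])
    show "countable \<G>" unfolding \<G>_def by (intro countable_image) simp
    show "\<G> \<subseteq> \<V>" unfolding \<G>_def using pick near_def by fast
    fix v and \<epsilon> :: real assume v: "v \<in> \<V>" and \<epsilon>: "\<epsilon> > 0"
    \<comment> \<open>Two errors below \<open>\<epsilon> / 4\<close> suffice, since
      \<open>L2_dist_triangle\<close> doubles squared distances.\<close>
    obtain n where n: "1 / real (Suc n) < \<epsilon> / 4" using nat_approx_posE[of "\<epsilon> / 4"] \<epsilon> by auto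
    have "\<exists>s. (\<integral>x. (\<Phi> v k x - step s x)\<^sup>2 \<partial>lebesgue_on B) < 1 / real (Suc n)" for k
      using L2_on_step_approximable[OF B L2[OF v, of k]] by (simp add: step_approximable_def)
    then obtain \<sigma> where \<sigma>: "\<And>k. (\<integral>x. (\<Phi> v k x - step (\<sigma> k) x)\<^sup>2 \<partial>lebesgue_on B) < 1 / real (Suc n)" by metis
    define t where "t = (\<sigma> 1, \<sigma> 2, \<sigma> 3)"
    have "sel t k = \<sigma> k" for k using exhaust_3[of k] by (auto simp: sel_def t_def)
    then have near: "near v t n" using \<sigma> v by (simp add: near_def)
    let ?g = "pick (t, n)"
    have g: "near ?g t n" by (rule pick[OF near])
    have gG: "?g \<in> \<G>" unfolding \<G>_def using near by blast
    have "(\<integral>x. (\<Phi> v k x - \<Phi> ?g k x)\<^sup>2 \<partial>lebesgue_on B) < \<epsilon>" for k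
    proof -
      have "?g \<in> \<V>" using g by (simp add: near_def)
      from L2_dist_triangle[OF L2[OF v, of k] step_L2[OF B(1), of "sel t k"] L2[OF this, of k]]
      have "(\<integral>x. (\<Phi> v k x - \<Phi> ?g k x)\<^sup>2 \<partial>lebesgue_on B)
         \<le> 2 * (\<integral>x. (\<Phi> v k x - step (sel t k) x)\<^sup>2 \<partial>lebesgue_on B) + 2 * (\<integral>x. (\<Phi> ?g k x - step (sel t k) x)\<^sup>2 \<partial>lebesgue_on B)"
        by (simp add: power2_commute)
      moreover have "(\<integral>x. (\<Phi> v k x - step (sel t k) x)\<^sup>2 \<partial>lebesgue_on B) < 1 / real (Suc n)"
        "(\<integral>x. (\<Phi> ?g k x - step (sel t k) x)\<^sup>2 \<partial>lebesgue_on B) < 1 / real (Suc n)"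
        using near g by (simp_all add: near_def)
      ultimately show ?thesis using n by linarith
    qed
    then show "\<exists>g\<in>\<G>. \<forall>k. (\<integral>x. (\<Phi> v k x - \<Phi> g k x)\<^sup>2 \<partial>lebesgue_on B) < \<epsilon>" using gG by blast
  qed
qed

section \<open>The coefficients at almost every macroscopic point\<close>

text \<open>Every nontrivial relation describes a hyperplane, or the empty set when only
  \<open>d\<close> is nonzero, and there are countably many of them.\<close>

lemma AE_no_integer_relation:
  assumes "A \<in> sets lebesgue"
  shows "AE x in lebesgue_on A. \<forall>(a, b, c, d) \<in> UNIV - {(0, 0, 0, 0 :: int)}.
    of_int a * x $ 1 + of_int b * x $ 2 + of_int c * x $ (3 :: 3) + of_int d \<noteq> (0 :: real)"
proof -
  have "AE x in lebesgue_on A. \<forall>t \<in> UNIV - {(0, 0, 0, 0 :: int)}. case t of (a, b, c, d) \<Rightarrow>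
    of_int a * x $ 1 + of_int b * x $ 2 + of_int c * x $ (3 :: 3) + of_int d \<noteq> (0 :: real)"
    unfolding AE_ball_countable[OF countableI_type]
  proof
    fix t :: "int \<times> int \<times> int \<times> int" assume t: "t \<in> UNIV - {(0, 0, 0, 0 :: int)}"
    obtain a b c d where abcd: "t = (a, b, c, d)" by (cases t) auto
    define v :: R3 where "v = vector [of_int a, of_int b, of_int c]"
    have in_v: "v \<bullet> x = of_int a * x $ 1 + of_int b * x $ 2 + of_int c * x $ 3" for x
      by (simp add: v_def inner_vec_def sum_3 vector_3)
    have "v \<noteq> 0 \<or> - real_of_int d \<noteq> 0"
      using t abcd by (auto simp: v_def vec_eq_iff forall_3 vector_3)
    then have "negligible {x. v \<bullet> x = - real_of_int d}" by (rule negligible_hyperplane)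
    then have "negligible {x \<in> A. \<not> (case t of (a, b, c, d) \<Rightarrow>
      of_int a * x $ 1 + of_int b * x $ 2 + of_int c * x $ 3 + of_int d \<noteq> (0 :: real))}"
      by (rule negligible_subset) (auto simp: in_v abcd)
    then show "AE x in lebesgue_on A. case t of (a, b, c, d) \<Rightarrow>
      of_int a * x $ 1 + of_int b * x $ 2 + of_int c * x $ 3 + of_int d \<noteq> (0 :: real)"
      by (rule iffD2[OF AE_lebesgue_on_iff_negligible[OF assms]])
  qed
  then show ?thesis .
qed

text \<open>Kronecker's theorem yields an integer \<open>k\<close> of either sign; adding a large multiple of a Dirichlet
  denominator \<open>q\<close>, for which \<open>q x\<close> is nearly integral, makes it positive.\<close>

lemma positive_multiples_dense_mod_1:
  fixes x y :: R3
  assumes x: "\<And>a b c d :: int. (a, b, c, d) \<noteq> (0, 0, 0, 0) \<Longrightarrow>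
      of_int a * x $ 1 + of_int b * x $ 2 + of_int c * x $ 3 + of_int d \<noteq> (0 :: real)"
    and \<delta>: "\<delta> > 0"
  obtains n :: nat and a where "n > 0" "a \<in> integer_vectors" "\<And>i. \<bar>(real n *\<^sub>R x - a - y) $ i\<bar> < \<delta>"
proof -
  define \<iota> :: "nat \<Rightarrow> 3" where "\<iota> i = (if i = 0 then 1 else if i = 1 then 2 else 3)" for i
  \<comment> \<open>The additional entry 1 represents the constant term \<open>d\<close>, so the
    absence of integer relations becomes linear independence over the integers.\<close>
  define \<theta> where "\<theta> i = (if i = 3 then 1 else x $ \<iota> i)" for i
  have \<theta>: "\<theta> 0 = x $ 1" "\<theta> (Suc 0) = x $ 2" "\<theta> 2 = x $ 3" "\<theta> 3 = 1" by (auto simp: \<theta>_def \<iota>_def)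
  have S: "{..3 :: nat} = {0, Suc 0, 2, 3}" by auto
  have rel: "m i = 0" if "(\<Sum>i\<le>3. of_int (m i) * \<theta> i) = 0" "i \<le> 3" for m :: "nat \<Rightarrow> int" and i
  proof -
    have "of_int (m 0) * x $ 1 + of_int (m (Suc 0)) * x $ 2 + of_int (m 2) * x $ 3 + of_int (m 3) = 0"
      using that(1) by (simp add: S \<theta>)
    then have "(m 0, m (Suc 0), m 2, m 3) = (0, 0, 0, 0)" using x by blast
    moreover have "i = 0 \<or> i = Suc 0 \<or> i = 2 \<or> i = 3" using that(2) by linarith
    ultimately show ?thesis by auto
  qed
  have inj: "inj_on \<theta> {..3}"
  proof (rule inj_onI, rule ccontr)
    fix i j :: nat assume ij: "i \<in> {..3}" "j \<in> {..3}" "\<theta> i = \<theta> j" "i \<noteq> j"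
    let ?m = "\<lambda>k. (if k = i then 1 else 0) + (if k = j then - 1 else 0 :: int)"
    have "(\<Sum>k\<le>3. of_int (?m k) * \<theta> k)
      = (\<Sum>k\<le>3. (if k = i then \<theta> k else 0) + (if k = j then - \<theta> k else 0))"
      by (intro sum.cong) auto
    also have "\<dots> = 0" using ij by (simp add: sum.distrib sum.delta)
    finally have "?m i = 0" by (rule rel) (use ij in auto)
    then show False using ij by simp
  qed
  interpret Z: Modules.module "\<lambda>r. (*) (real_of_int r)"
    by (simp add: Modules.module.intro distrib_left mult.commute)
  have indep: "Z.independent (\<theta> ` {..3})"
    unfolding Z.independent_explicit_module
  proof (intro allI impI)
    fix t u v assume t: "finite t" "t \<subseteq> \<theta> ` {..3}" "(\<Sum>v\<in>t. real_of_int (u v) * v) = 0" "v \<in> t"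
    define m where "m i = (if \<theta> i \<in> t then u (\<theta> i) else 0)" for i
    have "(\<Sum>i\<le>3. of_int (m i) * \<theta> i) = (\<Sum>v\<in>\<theta> ` {..3}. (if v \<in> t then of_int (u v) * v else 0))"
      by (subst sum.reindex[OF inj]) (auto simp: m_def intro!: sum.cong)
    also have "\<dots> = (\<Sum>v\<in>t. real_of_int (u v) * v)"
      using t(2) by (intro sum.mono_neutral_cong_right) auto
    finally have 0: "(\<Sum>i\<le>3. of_int (m i) * \<theta> i) = 0" using t(3) by simp
    obtain i where "i \<le> 3" "v = \<theta> i" using t(2,4) by auto
    then show "u v = 0" using rel[OF 0, of i] t(4) by (simp add: m_def)
  qed
  obtain k m where km: "\<And>i. i < 3 \<Longrightarrow> \<bar>of_int k * \<theta> i - of_int (m i) - y $ \<iota> i\<bar> < \<delta> / 2"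
    using Kronecker_thm_2[OF indep inj \<theta>(4), of "\<delta> / 2" "\<lambda>i. y $ \<iota> i"] \<delta> by auto
  \<comment> \<open>With \<open>l\<close> larger than \<open>\<bar>k\<bar>\<close> the sum
    \<open>k + l * q\<close> is positive for every \<open>q \<ge> 1\<close>; \<open>N\<close> is
    then taken so large that \<open>l\<close> times the Dirichlet error stays below
    \<open>\<delta> / 2\<close>.\<close>
  define l where "l = nat (1 + \<bar>k\<bar>)"
  obtain N :: nat where N: "2 * real l / \<delta> < real N" using reals_Archimedean2 by blast
  have l: "l > 0" by (simp add: l_def)
  then have N0: "N > 0" using N \<delta> by (cases "N = 0") (auto simp: field_simps)
  obtain q h where q: "0 < q" and h: "\<And>i. i < 3 \<Longrightarrow> \<bar>of_int q * \<theta> i - of_int (h i)\<bar> < 1 / real N"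
    using Dirichlet_approx_simult[OF N0, of 3 \<theta>] by metis
  define n where "n = k + int l * q"
  have n: "n > 0"
  proof -
    have "int l * 1 \<le> int l * q" using q by (intro mult_left_mono) auto
    then show ?thesis by (simp add: n_def l_def)
  qed
  have close: "\<bar>of_int n * \<theta> i - of_int (m i + int l * h i) - y $ \<iota> i\<bar> < \<delta>" if i: "i < 3" for i
  proof -
    have e: "of_int n * \<theta> i - of_int (m i + int l * h i) - y $ \<iota> i
      = (of_int k * \<theta> i - of_int (m i) - y $ \<iota> i) + real l * (of_int q * \<theta> i - of_int (h i))"
      by (simp add: n_def algebra_simps)
    have "real l * \<bar>of_int q * \<theta> i - of_int (h i)\<bar> \<le> real l * (1 / real N)"
      using h[OF i] by (intro mult_left_mono) auto
    also have "\<dots> \<le> \<delta> / 2" using N N0 \<delta> by (simp add: field_simps)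
    finally have "\<bar>real l * (of_int q * \<theta> i - of_int (h i))\<bar> \<le> \<delta> / 2" by (simp add: abs_mult)
    then show ?thesis unfolding e using km[OF i] by linarith
  qed
  define a :: R3 where "a = vector [of_int (m 0 + int l * h 0), of_int (m (Suc 0) + int l * h (Suc 0)), of_int (m 2 + int l * h 2)]"
  show ?thesis
  proof (rule that[of "nat n" a])
    show "a \<in> integer_vectors" by (simp add: integer_vectors_def a_def forall_3 vector_3)
    show "\<bar>(real (nat n) *\<^sub>R x - a - y) $ i\<bar> < \<delta>" for i
      using exhaust_3[of i] close[of 0] close[of "Suc 0"] close[of 2] n
      by (auto simp: a_def vector_3 \<theta> \<iota>_def)
  qed (use n in simp)
qed

text \<open>Kronecker's theorem: for almost every \<open>x\<close> the multiples \<open>n x\<close>, \<open>n > 0\<close>, are dense modulo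
  integer vectors, so a closed periodic condition on \<open>y\<close> that holds along \<open>y = x / \<epsilon>\<close> holds for all \<open>y\<close>.\<close>

lemma AE_oscillating_imp_all:
  fixes P :: "R3 \<Rightarrow> R3 \<Rightarrow> bool"
  assumes A: "A \<in> sets lebesgue"
    and osc: "\<And>\<epsilon> :: real. \<epsilon> > 0 \<Longrightarrow> AE x in lebesgue_on A. P x ((1 / \<epsilon>) *\<^sub>R x)"
    and cl: "AE x in lebesgue_on A. closed {y. P x y} \<and> (\<forall>y k. P x (y + axis k 1) = P x y)"
  shows "AE x in lebesgue_on A. \<forall>y. P x y"
proof -
  have "AE x in lebesgue_on A. \<forall>n :: nat. P x (real (Suc n) *\<^sub>R x)"
    unfolding AE_all_countable using osc[of "1 / real (Suc _)"] by simp
  then show ?thesis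
    using cl AE_no_integer_relation[OF A]
  proof eventually_elim
    case (elim x)
    have rel: "of_int a * x $ 1 + of_int b * x $ 2 + of_int c * x $ 3 + of_int d \<noteq> (0 :: real)"
      if "(a, b, c, d) \<noteq> (0, 0, 0, 0)" for a b c d :: int
      using elim(3) that by blast
    show ?case
    proof
      fix y
      have "y \<in> closure {y. P x y}"
        unfolding closure_approachable
      proof (intro allI impI)
        fix \<delta> :: real assume \<delta>: "\<delta> > 0"
        then obtain n :: nat and a where n: "n > 0" and a: "a \<in> integer_vectors"
          and close: "\<And>i. \<bar>(real n *\<^sub>R x - a - y) $ i\<bar> < \<delta> / 4"
          using positive_multiples_dense_mod_1[OF rel, of "\<delta> / 4" y] by (metis zero_less_divide_iff zero_less_numeral)
        have "P x (real n *\<^sub>R x)" using elim(1) n by (metis Suc_pred)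
        moreover have "- a \<in> integer_vectors" using a by (auto simp: integer_vectors_def)
        ultimately have "P x (real n *\<^sub>R x + - a)"
          using periodic_integer_shift[of "P x" "- a"] elim(2) by blast
        moreover have "norm (real n *\<^sub>R x - a - y) \<le> (\<Sum>i\<in>UNIV. \<bar>(real n *\<^sub>R x - a - y) $ i\<bar>)"
          by (rule norm_le_l1_cart)
        moreover have "\<dots> < \<delta>" using close[of 1] close[of 2] close[of 3] \<delta> unfolding sum_3 by linarith
        ultimately show "\<exists>y'\<in>{y. P x y}. dist y' y < \<delta>"
          by (intro bexI[of _ "real n *\<^sub>R x + - a"]) (auto simp: dist_norm)
      qed
      then show "P x y" using elim(2) by simp
    qed
  qed
qed

text \<open>Only equations and non-strict inequalities between continuous functions of
  \<open>y\<close> occur, so the set of good points \<open>y\<close> is closed, as the density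
  argument requires.\<close>

definition piezo_at :: "(3 \<Rightarrow> 3 \<Rightarrow> 3 \<Rightarrow> 3 \<Rightarrow> R3 \<Rightarrow> real) \<Rightarrow> (3 \<Rightarrow> 3 \<Rightarrow> 3 \<Rightarrow> R3 \<Rightarrow> real) \<Rightarrow> (3 \<Rightarrow> 3 \<Rightarrow> R3 \<Rightarrow> real)
    \<Rightarrow> real \<Rightarrow> real \<Rightarrow> R3 \<Rightarrow> bool" where
  "piezo_at C E D \<alpha>\<^sub>c \<alpha>\<^sub>d y \<longleftrightarrow>
     (\<forall>i j k l. C i j k l y = C j i k l y \<and> C i j k l y = C k l i j y \<and> C i j k l y = C i j l k y) \<and>
     (\<forall>i j k. E i j k y = E i k j y) \<and>
     (\<forall>i j. D i j y = D j i y) \<and>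
     (\<forall>X :: real^3^3. transpose X = X \<longrightarrow>
        (\<Sum>i\<in>UNIV. \<Sum>j\<in>UNIV. \<Sum>k\<in>UNIV. \<Sum>l\<in>UNIV. C i j k l y * X $ i $ j * X $ k $ l)
        \<ge> \<alpha>\<^sub>c * (\<Sum>i\<in>UNIV. \<Sum>j\<in>UNIV. X $ i $ j * X $ i $ j)) \<and>
     (\<forall>X :: real^3. (\<Sum>i\<in>UNIV. \<Sum>j\<in>UNIV. D i j y * X $ i * X $ j) \<ge> \<alpha>\<^sub>d * (\<Sum>i\<in>UNIV. X $ i * X $ i))"

lemma closed_piezo_at:
  assumes "\<And>i j k l. continuous_on UNIV (C i j k l)" "\<And>i j k. continuous_on UNIV (E i j k)" "\<And>i j. continuous_on UNIV (D i j)"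
  shows "closed {y. piezo_at C E D \<alpha>\<^sub>c \<alpha>\<^sub>d y}"
  unfolding piezo_at_def imp_conv_disj
  by (intro closed_Collect_conj closed_Collect_all closed_Collect_disj closed_Collect_eq closed_Collect_le
      closed_Collect_const continuous_intros assms)

lemma piezo_coefficients_AE:
  assumes co: "piezo_coefficients \<Omega> c e d \<alpha>\<^sub>c \<alpha>\<^sub>d" and \<Omega>: "\<Omega> \<in> sets lebesgue"
  shows "AE x in lebesgue_on \<Omega>. \<forall>y. piezo_at (\<lambda>i j k l. apply_bcontfun (c i j k l x))
     (\<lambda>i j k. apply_bcontfun (e i j k x)) (\<lambda>i j. apply_bcontfun (d i j x)) \<alpha>\<^sub>c \<alpha>\<^sub>d y"
proof (rule AE_oscillating_imp_all[OF \<Omega>])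
  show "AE x in lebesgue_on \<Omega>. piezo_at (\<lambda>i j k l. apply_bcontfun (c i j k l x))
     (\<lambda>i j k. apply_bcontfun (e i j k x)) (\<lambda>i j. apply_bcontfun (d i j x)) \<alpha>\<^sub>c \<alpha>\<^sub>d ((1 / \<epsilon>) *\<^sub>R x)" if "\<epsilon> > 0" for \<epsilon>
    using co that unfolding piezo_coefficients_def oscillating_def piezo_at_def by blast
  have "AE x in lebesgue_on \<Omega>. \<forall>i j k l. c i j k l x \<in> C_per" "AE x in lebesgue_on \<Omega>. \<forall>i j k. e i j k x \<in> C_per"
    "AE x in lebesgue_on \<Omega>. \<forall>i j. d i j x \<in> C_per"
    using co unfolding piezo_coefficients_def Linf_C_per_def by (simp_all add: eventually_all_finite)
  then show "AE x in lebesgue_on \<Omega>. closed {y. piezo_at (\<lambda>i j k l. apply_bcontfun (c i j k l x))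
     (\<lambda>i j k. apply_bcontfun (e i j k x)) (\<lambda>i j. apply_bcontfun (d i j x)) \<alpha>\<^sub>c \<alpha>\<^sub>d y} \<and>
     (\<forall>y k. piezo_at (\<lambda>i j k l. apply_bcontfun (c i j k l x))
     (\<lambda>i j k. apply_bcontfun (e i j k x)) (\<lambda>i j. apply_bcontfun (d i j x)) \<alpha>\<^sub>c \<alpha>\<^sub>d (y + axis k 1) =
     piezo_at (\<lambda>i j k l. apply_bcontfun (c i j k l x))
     (\<lambda>i j k. apply_bcontfun (e i j k x)) (\<lambda>i j. apply_bcontfun (d i j x)) \<alpha>\<^sub>c \<alpha>\<^sub>d y)"
  proof eventually_elim
    case (elim x)
    have "apply_bcontfun (c i j k l x) (y + axis m 1) = apply_bcontfun (c i j k l x) y"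
      "apply_bcontfun (e i j k x) (y + axis m 1) = apply_bcontfun (e i j k x) y"
      "apply_bcontfun (d i j x) (y + axis m 1) = apply_bcontfun (d i j x) y" for i j k l m y
      using elim by (simp_all add: C_per_def)
    then show ?case by (intro conjI closed_piezo_at allI) (simp_all add: piezo_at_def)
  qed
qed

section \<open>Localization of the two-scale equations\<close>

lemma L2_cauchy_schwarz:
  assumes f: "f \<in> L2_on B" and g: "g \<in> L2_on B"
  shows "(\<integral>x. f x * g x \<partial>lebesgue_on B)\<^sup>2 \<le> (\<integral>x. (f x)\<^sup>2 \<partial>lebesgue_on B) * (\<integral>x. (g x)\<^sup>2 \<partial>lebesgue_on B)"
proof -
  let ?P = "\<integral>x. f x * g x \<partial>lebesgue_on B" and ?A = "\<integral>x. (f x)\<^sup>2 \<partial>lebesgue_on B" and ?C = "\<integral>x. (g x)\<^sup>2 \<partial>lebesgue_on B"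
  have i: "integrable (lebesgue_on B) (\<lambda>x. (f x)\<^sup>2)" "integrable (lebesgue_on B) (\<lambda>x. (g x)\<^sup>2)"
    "integrable (lebesgue_on B) (\<lambda>x. f x * g x)"
    using f g L2_on_integrable_mult[OF f g] by (auto simp: L2_on_def)
  have q: "0 \<le> ?A - 2 * t * ?P + t\<^sup>2 * ?C" for t
  proof -
    have "0 \<le> (\<integral>x. (f x - t * g x)\<^sup>2 \<partial>lebesgue_on B)" by simp
    also have "(\<lambda>x. (f x - t * g x)\<^sup>2) = (\<lambda>x. (f x)\<^sup>2 - 2 * t * (f x * g x) + t\<^sup>2 * (g x)\<^sup>2)"
      by (simp add: power2_eq_square algebra_simps fun_eq_iff)
    finally show ?thesis using i by simp
  qed
  have C0: "?C \<ge> 0" by simp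
  show ?thesis
  proof (cases "?C = 0")
    case True
    have "?P = 0"
    proof (rule ccontr)
      assume "?P \<noteq> 0"
      \<comment> \<open>If the leading coefficient \<open>?C\<close> vanishes, the nonnegative
        quadratic is affine in \<open>t\<close>; this value of \<open>t\<close> would make it equal
        to -1.\<close>
      then have "?A - 2 * ((?A + 1) / (2 * ?P)) * ?P = - 1" by (simp add: field_simps)
      with q[of "(?A + 1) / (2 * ?P)"] True show False by simp
    qed
    then show ?thesis using True by simp
  next
    case False
    with C0 have C: "?C > 0" by linarith
    have "?A - 2 * (?P / ?C) * ?P + (?P / ?C)\<^sup>2 * ?C = ?A - ?P\<^sup>2 / ?C"
      using C by (simp add: field_simps power2_eq_square)
    with q[of "?P / ?C"] have "?P\<^sup>2 / ?C \<le> ?A" by simp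
    then show ?thesis using C by (simp add: divide_le_eq)
  qed
qed

lemma L2_tendsto_0_mult:
  assumes D: "\<And>n. D n \<in> L2_on B" and G: "G \<in> L2_on B"
    and lim: "(\<lambda>n. \<integral>x. (D n x)\<^sup>2 \<partial>lebesgue_on B) \<longlonglongrightarrow> 0"
  shows "(\<lambda>n. \<integral>x. D n x * G x \<partial>lebesgue_on B) \<longlonglongrightarrow> 0"
proof -
  have "(\<lambda>n. (\<integral>x. (D n x)\<^sup>2 \<partial>lebesgue_on B) * (\<integral>x. (G x)\<^sup>2 \<partial>lebesgue_on B)) \<longlonglongrightarrow> 0 * (\<integral>x. (G x)\<^sup>2 \<partial>lebesgue_on B)"
    by (intro tendsto_intros lim)
  then have l: "(\<lambda>n. (\<integral>x. (D n x)\<^sup>2 \<partial>lebesgue_on B) * (\<integral>x. (G x)\<^sup>2 \<partial>lebesgue_on B)) \<longlonglongrightarrow> 0" by simp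
  have "(\<lambda>n. (\<integral>x. D n x * G x \<partial>lebesgue_on B)\<^sup>2) \<longlonglongrightarrow> 0"
    by (rule tendsto_sandwich[OF _ _ tendsto_const l]) (use L2_cauchy_schwarz[OF D G] in auto)
  from tendsto_real_sqrt[OF this] show ?thesis
    by (simp add: tendsto_rabs_zero_iff)
qed

text \<open>The constant subtracted in the quotient norm affects only the term of order zero, so
  every competitor in the infimum contains the full gradient. Hence convergence in the quotient norm
  implies convergence of the derivatives.\<close>

lemma wderiv_le_quot_norm:
  assumes S: "open S" and w: "w \<in> H1_per S"
  shows "(\<integral>y. (wderiv S k w y)\<^sup>2 \<partial>lebesgue_on (material S)) \<le> (H1_per_quot_norm S w)\<^sup>2"
proof -
  note M = material_lmeasurable[OF S]
  have wL: "w \<in> L2_on (material S)" using w by (simp add: H1_per_def)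
  have d: "integrable (lebesgue_on (material S)) (\<lambda>y. (wderiv S k w y)\<^sup>2)" for k
    using H1_per_wderiv(2)[OF S w] by (simp add: L2_on_def)
  have "sqrt (\<integral>y. (wderiv S k w y)\<^sup>2 \<partial>lebesgue_on (material S)) \<le> H1_per_quot_norm S w"
    unfolding H1_per_quot_norm_def
  proof (rule cINF_greatest)
    fix a :: real
    have wa: "integrable (lebesgue_on (material S)) (\<lambda>y. (w y - a)\<^sup>2)"
      using L2_on_diff[OF wL L2_on_const[OF M]] by (simp add: L2_on_def)
    have "(\<integral>y. (wderiv S k w y)\<^sup>2 \<partial>lebesgue_on (material S))
       \<le> (\<integral>y. (w y - a)\<^sup>2 + (\<Sum>k\<in>UNIV. (wderiv S k w y)\<^sup>2) \<partial>lebesgue_on (material S))"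
    proof (rule integral_mono[OF d])
      show "integrable (lebesgue_on (material S)) (\<lambda>y. (w y - a)\<^sup>2 + (\<Sum>k\<in>UNIV. (wderiv S k w y)\<^sup>2))"
        using wa d by (intro Bochner_Integration.integrable_add Bochner_Integration.integrable_sum)
      fix y
      have "(wderiv S k w y)\<^sup>2 \<le> (\<Sum>k\<in>UNIV. (wderiv S k w y)\<^sup>2)" by (rule member_le_sum) auto
      then show "(wderiv S k w y)\<^sup>2 \<le> (w y - a)\<^sup>2 + (\<Sum>k\<in>UNIV. (wderiv S k w y)\<^sup>2)" by (simp add: add_increasing)
    qed
    then show "sqrt (\<integral>y. (wderiv S k w y)\<^sup>2 \<partial>lebesgue_on (material S))
      \<le> sqrt (\<integral>y. (w y - a)\<^sup>2 + (\<Sum>k\<in>UNIV. (wderiv S k w y)\<^sup>2) \<partial>lebesgue_on (material S))"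
      by (rule real_sqrt_le_mono)
  qed simp
  then have "(sqrt (\<integral>y. (wderiv S k w y)\<^sup>2 \<partial>lebesgue_on (material S)))\<^sup>2 \<le> (H1_per_quot_norm S w)\<^sup>2"
    by (intro power_mono) auto
  then show ?thesis by simp
qed

lemma quot_norm_zero:
  assumes S: "open S" shows "H1_per_quot_norm S (\<lambda>y. 0) = 0"
proof (rule antisym)
  have "AE y in lebesgue_on (material S). \<forall>k. wderiv S k (\<lambda>y. 0) y = 0"
    using wderiv_zero_material[OF S] by (simp add: eventually_all_finite)
  then have "AE y in lebesgue_on (material S). (0 - 0)\<^sup>2 + (\<Sum>k\<in>UNIV. (wderiv S k (\<lambda>y. 0) y)\<^sup>2) = 0"
    by eventually_elim simp
  then have "(\<integral>y. (0 - 0)\<^sup>2 + (\<Sum>k\<in>UNIV. (wderiv S k (\<lambda>y. 0) y)\<^sup>2) \<partial>lebesgue_on (material S)) = 0"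
    by (rule integral_eq_zero_AE)
  moreover have "H1_per_quot_norm S (\<lambda>y. 0)
     \<le> sqrt (\<integral>y. (0 - 0)\<^sup>2 + (\<Sum>k\<in>UNIV. (wderiv S k (\<lambda>y. 0) y)\<^sup>2) \<partial>lebesgue_on (material S))"
    unfolding H1_per_quot_norm_def
    by (rule cINF_lower) (auto intro!: bdd_belowI[of _ 0] Bochner_Integration.integral_nonneg add_nonneg_nonneg sum_nonneg)
  ultimately show "H1_per_quot_norm S (\<lambda>y. 0) \<le> 0" by simp
  show "0 \<le> H1_per_quot_norm S (\<lambda>y. 0)"
    unfolding H1_per_quot_norm_def
    by (rule cINF_greatest) (auto intro!: Bochner_Integration.integral_nonneg add_nonneg_nonneg sum_nonneg)
qed

text \<open>The pairing is Lipschitz in the supremum norm with the integral of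
  \<open>\<bar>G\<bar>\<close> as constant. Composed with a measurable coefficient \<open>a\<close>,
  it gives a measurable function of \<open>x\<close>.\<close>

lemma borel_measurable_bcontfun_integral:
  fixes G :: "R3 \<Rightarrow> real"
  assumes G: "integrable (lebesgue_on B) G"
  shows "(\<lambda>b :: R3 \<Rightarrow>\<^sub>C real. \<integral>y. apply_bcontfun b y * G y \<partial>lebesgue_on B) \<in> borel_measurable borel"
proof (rule borel_measurable_continuous_onI)
  have int: "integrable (lebesgue_on B) (\<lambda>y. apply_bcontfun b y * G y)" for b :: "R3 \<Rightarrow>\<^sub>C real"
  proof (rule Bochner_Integration.integrable_bound)
    show "integrable (lebesgue_on B) (\<lambda>y. norm b * G y)" using G by simp
    have "apply_bcontfun b \<in> borel_measurable (lebesgue_on B)"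
      by (intro measurable_restrict_space1 measurable_completion) (simp add: borel_measurable_continuous_onI)
    then show "(\<lambda>y. apply_bcontfun b y * G y) \<in> borel_measurable (lebesgue_on B)"
      using G by (intro borel_measurable_times) auto
    show "AE y in lebesgue_on B. norm (apply_bcontfun b y * G y) \<le> norm (norm b * G y)"
      using norm_bounded[of b] by (auto simp: abs_mult intro!: mult_right_mono)
  qed
  let ?I = "\<lambda>b :: R3 \<Rightarrow>\<^sub>C real. \<integral>y. apply_bcontfun b y * G y \<partial>lebesgue_on B"
  let ?N = "\<integral>y. \<bar>G y\<bar> \<partial>lebesgue_on B"
  have lip: "\<bar>?I b - ?I b'\<bar> \<le> ?N * dist b b'" for b b'
  proof -
    have "?I b - ?I b' = (\<integral>y. apply_bcontfun b y * G y - apply_bcontfun b' y * G y \<partial>lebesgue_on B)"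
      using int by simp
    also have "norm \<dots> \<le> (\<integral>y. dist b b' * \<bar>G y\<bar> \<partial>lebesgue_on B)"
    proof (rule Bochner_Integration.integral_norm_bound_integral)
      fix y
      have "\<bar>apply_bcontfun b y - apply_bcontfun b' y\<bar> \<le> dist b b'"
        using dist_bounded[of b y b'] by (simp add: dist_real_def)
      then have "\<bar>(apply_bcontfun b y - apply_bcontfun b' y) * G y\<bar> \<le> dist b b' * \<bar>G y\<bar>"
        unfolding abs_mult by (intro mult_right_mono) auto
      then show "norm (apply_bcontfun b y * G y - apply_bcontfun b' y * G y) \<le> dist b b' * \<bar>G y\<bar>"
        by (simp add: left_diff_distrib)
    qed (use int G in auto)
    finally show ?thesis by (simp add: mult.commute)
  qed
  have "?N-lipschitz_on UNIV ?I"
    by (rule lipschitz_onI) (use lip in \<open>auto simp: dist_real_def\<close>)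
  then show "continuous_on UNIV ?I" by (rule lipschitz_on_continuous_on)
qed

text \<open>The quantification over \<open>a\<close> makes this weak form of measurability in \<open>x\<close> stable under
  multiplication by coefficients that depend on both \<open>x\<close> and \<open>y\<close>.\<close>

definition admissible :: "R3 set \<Rightarrow> R3 set \<Rightarrow> (R3 \<Rightarrow> R3 \<Rightarrow> real) \<Rightarrow> bool" where
  "admissible \<Omega> B F \<longleftrightarrow> (AE x in lebesgue_on \<Omega>. F x \<in> L2_on B) \<and>
     (\<forall>a\<in>borel_measurable (lebesgue_on \<Omega>). \<forall>g\<in>L2_on B.
        (\<lambda>x. \<integral>y. apply_bcontfun (a x) y * F x y * g y \<partial>lebesgue_on B) \<in> borel_measurable (lebesgue_on \<Omega>)) \<and>
     (\<exists>K. integrable (lebesgue_on \<Omega>) K \<and> (AE x in lebesgue_on \<Omega>. (\<integral>y. (F x y)\<^sup>2 \<partial>lebesgue_on B) \<le> K x))"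

lemma bcontfun_L2: "g \<in> L2_on B \<Longrightarrow> (\<lambda>y. apply_bcontfun b y * g y) \<in> L2_on B"
  using norm_bounded[of b]
  by (intro L2_on_bounded_mult[of _ _ _ "norm b"])
     (auto intro!: measurable_restrict_space1 measurable_completion borel_measurable_continuous_onI)

lemma admissible_const:
  assumes B: "B \<in> lmeasurable" and X: "X \<in> L2_on \<Omega>"
  shows "admissible \<Omega> B (\<lambda>x y. X x)"
  unfolding admissible_def
proof (intro conjI ballI)
  show "AE x in lebesgue_on \<Omega>. (\<lambda>y. X x) \<in> L2_on B" by (intro AE_I2 L2_on_const B)
  fix a :: "R3 \<Rightarrow> (R3 \<Rightarrow>\<^sub>C real)" and g assume a: "a \<in> borel_measurable (lebesgue_on \<Omega>)" and g: "g \<in> L2_on B"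
  have "integrable (lebesgue_on B) g" using L2_on_integrable_mult[OF g L2_on_const[OF B, of 1]] by simp
  from measurable_compose[OF a borel_measurable_bcontfun_integral[OF this]]
  have "(\<lambda>x. X x * (\<integral>y. apply_bcontfun (a x) y * g y \<partial>lebesgue_on B)) \<in> borel_measurable (lebesgue_on \<Omega>)"
    using L2_on_measurable[OF X] by (intro borel_measurable_times)
  moreover have "(\<integral>y. apply_bcontfun (a x) y * X x * g y \<partial>lebesgue_on B) = X x * (\<integral>y. apply_bcontfun (a x) y * g y \<partial>lebesgue_on B)" for x
    by (subst integral_mult_right_zero[symmetric]) (simp add: algebra_simps)
  ultimately show "(\<lambda>x. \<integral>y. apply_bcontfun (a x) y * X x * g y \<partial>lebesgue_on B) \<in> borel_measurable (lebesgue_on \<Omega>)" by simp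
next
  show "\<exists>K. integrable (lebesgue_on \<Omega>) K \<and> (AE x in lebesgue_on \<Omega>. (\<integral>y. (X x)\<^sup>2 \<partial>lebesgue_on B) \<le> K x)"
    using X by (intro exI[of _ "\<lambda>x. measure (lebesgue_on B) B * (X x)\<^sup>2"]) (auto simp: L2_on_def)
qed

lemma admissible_lincomb:
  assumes F: "admissible \<Omega> B F" and G: "admissible \<Omega> B G" and \<Omega>: "\<Omega> \<in> sets lebesgue"
  shows "admissible \<Omega> B (\<lambda>x y. p * F x y + q * G x y)"
  unfolding admissible_def
proof (intro conjI ballI)
  have L: "AE x in lebesgue_on \<Omega>. F x \<in> L2_on B \<and> G x \<in> L2_on B" using F G by (simp add: admissible_def)
  then show "AE x in lebesgue_on \<Omega>. (\<lambda>y. p * F x y + q * G x y) \<in> L2_on B"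
    by eventually_elim (intro L2_on_add L2_on_cmult; simp)
  fix a :: "R3 \<Rightarrow> (R3 \<Rightarrow>\<^sub>C real)" and g assume a: "a \<in> borel_measurable (lebesgue_on \<Omega>)" and g: "g \<in> L2_on B"
  show "(\<lambda>x. \<integral>y. apply_bcontfun (a x) y * (p * F x y + q * G x y) * g y \<partial>lebesgue_on B) \<in> borel_measurable (lebesgue_on \<Omega>)"
  proof (rule borel_measurable_lebesgue_on_AE[OF \<Omega>])
    show "(\<lambda>x. p * (\<integral>y. apply_bcontfun (a x) y * F x y * g y \<partial>lebesgue_on B) + q * (\<integral>y. apply_bcontfun (a x) y * G x y * g y \<partial>lebesgue_on B)) \<in> borel_measurable (lebesgue_on \<Omega>)"
      using F G a g unfolding admissible_def by (intro borel_measurable_add borel_measurable_times borel_measurable_const) auto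
    show "AE x in lebesgue_on \<Omega>. p * (\<integral>y. apply_bcontfun (a x) y * F x y * g y \<partial>lebesgue_on B) + q * (\<integral>y. apply_bcontfun (a x) y * G x y * g y \<partial>lebesgue_on B)
      = (\<integral>y. apply_bcontfun (a x) y * (p * F x y + q * G x y) * g y \<partial>lebesgue_on B)"
      using L
    proof eventually_elim
      case (elim x)
      have "integrable (lebesgue_on B) (\<lambda>y. apply_bcontfun (a x) y * F x y * g y)" "integrable (lebesgue_on B) (\<lambda>y. apply_bcontfun (a x) y * G x y * g y)"
        using elim by (auto intro!: L2_on_integrable_mult bcontfun_L2 g)
      moreover have "(\<lambda>y. apply_bcontfun (a x) y * (p * F x y + q * G x y) * g y) = (\<lambda>y. p * (apply_bcontfun (a x) y * F x y * g y) + q * (apply_bcontfun (a x) y * G x y * g y))"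
        by (simp add: algebra_simps fun_eq_iff)
      ultimately show ?case by simp
    qed
  qed
next
  obtain K K' where K: "integrable (lebesgue_on \<Omega>) K" "AE x in lebesgue_on \<Omega>. (\<integral>y. (F x y)\<^sup>2 \<partial>lebesgue_on B) \<le> K x"
    and K': "integrable (lebesgue_on \<Omega>) K'" "AE x in lebesgue_on \<Omega>. (\<integral>y. (G x y)\<^sup>2 \<partial>lebesgue_on B) \<le> K' x"
    using F G unfolding admissible_def by blast
  have L: "AE x in lebesgue_on \<Omega>. F x \<in> L2_on B \<and> G x \<in> L2_on B" using F G by (simp add: admissible_def)
  have "AE x in lebesgue_on \<Omega>. (\<integral>y. (p * F x y + q * G x y)\<^sup>2 \<partial>lebesgue_on B) \<le> 2 * p\<^sup>2 * K x + 2 * q\<^sup>2 * K' x"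
    using L K(2) K'(2)
  proof eventually_elim
    case (elim x)
    have "(\<integral>y. (p * F x y - (- q) * G x y)\<^sup>2 \<partial>lebesgue_on B) \<le> 2 * (\<integral>y. (p * F x y - 0)\<^sup>2 \<partial>lebesgue_on B) + 2 * (\<integral>y. (0 - (- q) * G x y)\<^sup>2 \<partial>lebesgue_on B)"
      by (rule L2_dist_triangle[OF L2_on_cmult L2_on_zero L2_on_cmult]) (use elim in blast)+
    then have "(\<integral>y. (p * F x y + q * G x y)\<^sup>2 \<partial>lebesgue_on B) \<le> 2 * (p\<^sup>2 * (\<integral>y. (F x y)\<^sup>2 \<partial>lebesgue_on B)) + 2 * (q\<^sup>2 * (\<integral>y. (G x y)\<^sup>2 \<partial>lebesgue_on B))"
      by (simp add: power_mult_distrib)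
    also have "\<dots> \<le> 2 * (p\<^sup>2 * K x) + 2 * (q\<^sup>2 * K' x)"
      using elim by (intro add_mono mult_left_mono) auto
    finally show ?case by simp
  qed
  then show "\<exists>K. integrable (lebesgue_on \<Omega>) K \<and> (AE x in lebesgue_on \<Omega>. (\<integral>y. (p * F x y + q * G x y)\<^sup>2 \<partial>lebesgue_on B) \<le> K x)"
    using K(1) K'(1) by (intro exI[of _ "\<lambda>x. 2 * p\<^sup>2 * K x + 2 * q\<^sup>2 * K' x"]) auto
qed

text \<open>For a simple function the pairing is a finite sum over its values, each multiplied by
  the indicator of a measurable set. The approximating simple functions converge in the quotient
  norm, hence their derivatives converge in square mean and the pairings converge for almost every
  \<open>x\<close>.\<close>

lemma admissible_wderiv:
  assumes S: "open S" and \<Omega>: "\<Omega> \<in> sets lebesgue" and v: "v \<in> L2_H1_per \<Omega> S"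
  shows "admissible \<Omega> (material S) (\<lambda>x. wderiv S k (v x))"
  unfolding admissible_def
proof (intro conjI ballI)
  let ?B = "material S"
  obtain s where s: "\<And>n. simple_function (lebesgue_on \<Omega>) (s n)" "\<And>n x. x \<in> \<Omega> \<Longrightarrow> s n x \<in> H1_per S"
    and lim: "AE x in lebesgue_on \<Omega>. (\<lambda>n. H1_per_quot_norm S (\<lambda>y. v x y - s n x y)) \<longlonglongrightarrow> 0"
    and vH: "AE x in lebesgue_on \<Omega>. v x \<in> H1_per S" and K: "integrable (lebesgue_on \<Omega>) (\<lambda>x. (H1_per_quot_norm S (v x))\<^sup>2)"
    using v unfolding L2_H1_per_def by blast
  show "AE x in lebesgue_on \<Omega>. wderiv S k (v x) \<in> L2_on ?B"
    using vH by eventually_elim (rule H1_per_wderiv(2)[OF S])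
  show "\<exists>K. integrable (lebesgue_on \<Omega>) K \<and> (AE x in lebesgue_on \<Omega>. (\<integral>y. (wderiv S k (v x) y)\<^sup>2 \<partial>lebesgue_on ?B) \<le> K x)"
    by (rule exI, rule conjI[OF K], use vH in eventually_elim) (rule wderiv_le_quot_norm[OF S])
  fix a :: "R3 \<Rightarrow> (R3 \<Rightarrow>\<^sub>C real)" and g assume a: "a \<in> borel_measurable (lebesgue_on \<Omega>)" and g: "g \<in> L2_on ?B"
  define I where "I n x = (\<integral>y. apply_bcontfun (a x) y * wderiv S k (s n x) y * g y \<partial>lebesgue_on ?B)" for n x
  show "(\<lambda>x. \<integral>y. apply_bcontfun (a x) y * wderiv S k (v x) y * g y \<partial>lebesgue_on ?B) \<in> borel_measurable (lebesgue_on \<Omega>)"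
  proof (rule borel_measurable_lebesgue_on_AE_LIMSEQ[OF \<Omega>])
    show "I n \<in> borel_measurable (lebesgue_on \<Omega>)" for n
    proof -
      define J where "J z x = (\<integral>y. apply_bcontfun (a x) y * (wderiv S k z y * g y) \<partial>lebesgue_on ?B)" for z x
      have fin: "finite (s n ` \<Omega>)" using s(1)[of n] by (simp add: simple_function_def)
      have J: "J z \<in> borel_measurable (lebesgue_on \<Omega>)" if "z \<in> s n ` \<Omega>" for z
      proof -
        have "z \<in> H1_per S" using that s(2) by blast
        from measurable_compose[OF a borel_measurable_bcontfun_integral[OF L2_on_integrable_mult[OF H1_per_wderiv(2)[OF S this, of k] g]]]
        show ?thesis unfolding J_def .
      qed
      have "(\<lambda>x. \<Sum>z\<in>s n ` \<Omega>. indicator (s n -` {z} \<inter> \<Omega>) x * J z x) \<in> borel_measurable (lebesgue_on \<Omega>)"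
      proof (intro borel_measurable_sum borel_measurable_times borel_measurable_indicator J)
        show "s n -` {z} \<inter> \<Omega> \<in> sets (lebesgue_on \<Omega>)" if "z \<in> s n ` \<Omega>" for z
          using s(1)[of n] that by (auto simp: simple_function_def)
      qed
      then show ?thesis
      proof (rule measurable_cong[THEN iffD1, rotated])
        fix x assume "x \<in> space (lebesgue_on \<Omega>)"
        then have x: "x \<in> \<Omega>" by simp
        have "(\<Sum>z\<in>s n ` \<Omega>. indicator (s n -` {z} \<inter> \<Omega>) x * J z x) = (\<Sum>z\<in>s n ` \<Omega>. if z = s n x then J z x else 0)"
          using x by (intro sum.cong) auto
        also have "\<dots> = J (s n x) x" using fin x by (simp add: sum.delta)
        finally show "(\<Sum>z\<in>s n ` \<Omega>. indicator (s n -` {z} \<inter> \<Omega>) x * J z x) = I n x"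
          by (simp add: I_def J_def mult.assoc)
      qed
    qed
    show "AE x in lebesgue_on \<Omega>. (\<lambda>n. I n x) \<longlonglongrightarrow> (\<integral>y. apply_bcontfun (a x) y * wderiv S k (v x) y * g y \<partial>lebesgue_on ?B)"
      using vH lim AE_space
    proof eventually_elim
      case (elim x)
      then have x: "x \<in> \<Omega>" by simp
      define D where "D n y = wderiv S k (v x) y - wderiv S k (s n x) y" for n y
      have vL: "wderiv S k (v x) \<in> L2_on ?B" by (rule H1_per_wderiv(2)[OF S elim(1)])
      have sL: "wderiv S k (s n x) \<in> L2_on ?B" for n by (rule H1_per_wderiv(2)[OF S s(2)[OF x]])
      have DL: "D n \<in> L2_on ?B" for n unfolding D_def[abs_def] by (rule L2_on_diff[OF vL sL])
      have agL: "(\<lambda>y. apply_bcontfun (a x) y * g y) \<in> L2_on ?B" by (rule bcontfun_L2[OF g])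
      have le: "(\<integral>y. (D n y)\<^sup>2 \<partial>lebesgue_on ?B) \<le> (H1_per_quot_norm S (\<lambda>y. v x y - s n x y))\<^sup>2" for n
      proof -
        have 1: "(\<lambda>y. 1 * v x y + (- 1) * s n x y) \<in> H1_per S" by (rule H1_per_lincomb(1)[OF S elim(1) s(2)[OF x]])
        have "AE y in lebesgue_on ?B. wderiv S k (\<lambda>y. 1 * v x y + (- 1) * s n x y) y = 1 * wderiv S k (v x) y + (- 1) * wderiv S k (s n x) y"
          by (rule H1_per_lincomb(2)[OF S elim(1) s(2)[OF x]])
        then have "AE y in lebesgue_on ?B. (D n y)\<^sup>2 = (wderiv S k (\<lambda>y. 1 * v x y + (- 1) * s n x y) y)\<^sup>2"
          by eventually_elim (simp add: D_def)
        then have "(\<integral>y. (D n y)\<^sup>2 \<partial>lebesgue_on ?B) = (\<integral>y. (wderiv S k (\<lambda>y. 1 * v x y + (- 1) * s n x y) y)\<^sup>2 \<partial>lebesgue_on ?B)"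
          using DL[of n] H1_per_wderiv(2)[OF S 1, of k]
          by (intro integral_cong_AE) (auto simp: L2_on_def)
        then show ?thesis using wderiv_le_quot_norm[OF S 1, of k] by simp
      qed
      have "(\<lambda>n. (H1_per_quot_norm S (\<lambda>y. v x y - s n x y))\<^sup>2) \<longlonglongrightarrow> 0\<^sup>2" by (intro tendsto_intros elim(2))
      then have l: "(\<lambda>n. (H1_per_quot_norm S (\<lambda>y. v x y - s n x y))\<^sup>2) \<longlonglongrightarrow> 0" by simp
      have "(\<lambda>n. \<integral>y. (D n y)\<^sup>2 \<partial>lebesgue_on ?B) \<longlonglongrightarrow> 0"
        by (rule tendsto_sandwich[OF _ _ tendsto_const l]) (use le in auto)
      from L2_tendsto_0_mult[OF DL agL this]
      have "(\<lambda>n. (\<integral>y. apply_bcontfun (a x) y * wderiv S k (v x) y * g y \<partial>lebesgue_on ?B) - (\<integral>y. D n y * (apply_bcontfun (a x) y * g y) \<partial>lebesgue_on ?B))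
         \<longlonglongrightarrow> (\<integral>y. apply_bcontfun (a x) y * wderiv S k (v x) y * g y \<partial>lebesgue_on ?B) - 0"
        by (intro tendsto_intros)
      moreover have "(\<integral>y. D n y * (apply_bcontfun (a x) y * g y) \<partial>lebesgue_on ?B)
         = (\<integral>y. apply_bcontfun (a x) y * wderiv S k (v x) y * g y \<partial>lebesgue_on ?B) - I n x" for n
      proof -
        have "(\<lambda>y. D n y * (apply_bcontfun (a x) y * g y)) = (\<lambda>y. apply_bcontfun (a x) y * wderiv S k (v x) y * g y - apply_bcontfun (a x) y * wderiv S k (s n x) y * g y)"
          by (simp add: D_def fun_eq_iff algebra_simps)
        moreover have "integrable (lebesgue_on ?B) (\<lambda>y. apply_bcontfun (a x) y * wderiv S k (v x) y * g y)" "integrable (lebesgue_on ?B) (\<lambda>y. apply_bcontfun (a x) y * wderiv S k (s n x) y * g y)"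
          by (intro L2_on_integrable_mult bcontfun_L2 g vL sL)+
        ultimately show ?thesis by (simp add: I_def)
      qed
      ultimately show ?case by simp
    qed
  qed
qed

text \<open>What localization requires of a flux: square integrable sections, and integrable
  pairings with every fixed function of \<open>y\<close>.\<close>

definition square_integrable_flux :: "R3 set \<Rightarrow> R3 set \<Rightarrow> (R3 \<Rightarrow> R3 \<Rightarrow> real) \<Rightarrow> bool" where
  "square_integrable_flux \<Omega> B F \<longleftrightarrow> (AE x in lebesgue_on \<Omega>. F x \<in> L2_on B) \<and>
     (\<forall>g\<in>L2_on B. integrable (lebesgue_on \<Omega>) (\<lambda>x. \<integral>y. F x y * g y \<partial>lebesgue_on B))"

text \<open>By Cauchy-Schwarz the pairing is at most the sum of the squared norms of
  \<open>F x\<close> and of \<open>apply_bcontfun (a x) * g\<close>. The first has the integrable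
  majorant \<open>K\<close>, the second a constant one, which is integrable because
  \<open>\<Omega>\<close> has finite measure.\<close>

lemma square_integrable_flux_coef:
  assumes F: "admissible \<Omega> B F" and a: "a \<in> Linf_C_per \<Omega>" and \<Omega>: "\<Omega> \<in> lmeasurable"
  shows "square_integrable_flux \<Omega> B (\<lambda>x y. apply_bcontfun (a x) y * F x y)"
  unfolding square_integrable_flux_def
proof (intro conjI ballI)
  have L: "AE x in lebesgue_on \<Omega>. F x \<in> L2_on B" using F by (simp add: admissible_def)
  then show "AE x in lebesgue_on \<Omega>. (\<lambda>y. apply_bcontfun (a x) y * F x y) \<in> L2_on B"
    by eventually_elim (rule bcontfun_L2)
  fix g assume g: "g \<in> L2_on B"
  obtain K where K: "integrable (lebesgue_on \<Omega>) K" "AE x in lebesgue_on \<Omega>. (\<integral>y. (F x y)\<^sup>2 \<partial>lebesgue_on B) \<le> K x"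
    using F unfolding admissible_def by blast
  obtain M where M: "AE x in lebesgue_on \<Omega>. norm (a x) \<le> M" using a by (auto simp: Linf_C_per_def)
  let ?G = "\<integral>y. (g y)\<^sup>2 \<partial>lebesgue_on B"
  show "integrable (lebesgue_on \<Omega>) (\<lambda>x. \<integral>y. apply_bcontfun (a x) y * F x y * g y \<partial>lebesgue_on B)"
  proof (rule Bochner_Integration.integrable_bound)
    show "integrable (lebesgue_on \<Omega>) (\<lambda>x. K x + M\<^sup>2 * ?G)"
      by (rule Bochner_Integration.integrable_add[OF K(1) finite_measure.integrable_const[OF finite_measure_lebesgue_on[OF \<Omega>]]])
    show "(\<lambda>x. \<integral>y. apply_bcontfun (a x) y * F x y * g y \<partial>lebesgue_on B) \<in> borel_measurable (lebesgue_on \<Omega>)"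
      using F g a unfolding admissible_def Linf_C_per_def by blast
    show "AE x in lebesgue_on \<Omega>. norm (\<integral>y. apply_bcontfun (a x) y * F x y * g y \<partial>lebesgue_on B) \<le> norm (K x + M\<^sup>2 * ?G)"
      using L K(2) M
    proof eventually_elim
      case (elim x)
      let ?A = "\<integral>y. (apply_bcontfun (a x) y * g y)\<^sup>2 \<partial>lebesgue_on B" and ?F = "\<integral>y. (F x y)\<^sup>2 \<partial>lebesgue_on B"
      let ?P = "\<integral>y. apply_bcontfun (a x) y * F x y * g y \<partial>lebesgue_on B"
      have "?A \<le> (\<integral>y. M\<^sup>2 * (g y)\<^sup>2 \<partial>lebesgue_on B)"
      proof (rule integral_mono)
        show "integrable (lebesgue_on B) (\<lambda>y. (apply_bcontfun (a x) y * g y)\<^sup>2)" using bcontfun_L2[OF g] by (simp add: L2_on_def)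
        show "integrable (lebesgue_on B) (\<lambda>y. M\<^sup>2 * (g y)\<^sup>2)" using g by (simp add: L2_on_def)
        fix y
        have "\<bar>apply_bcontfun (a x) y\<bar> \<le> M" using norm_bounded[of "a x" y] elim(3) by simp
        then have "(apply_bcontfun (a x) y)\<^sup>2 \<le> M\<^sup>2" using abs_le_square_iff[of "apply_bcontfun (a x) y" M] by simp
        then show "(apply_bcontfun (a x) y * g y)\<^sup>2 \<le> M\<^sup>2 * (g y)\<^sup>2" by (simp add: power_mult_distrib mult_right_mono)
      qed
      then have A: "?A \<le> M\<^sup>2 * ?G" by simp
      have "?P = (\<integral>y. F x y * (apply_bcontfun (a x) y * g y) \<partial>lebesgue_on B)" by (simp add: algebra_simps)
      then have P: "?P\<^sup>2 \<le> ?F * ?A" using L2_cauchy_schwarz[OF elim(1) bcontfun_L2[OF g, of "a x"]] by simp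
      have 0: "?F \<ge> 0" "?A \<ge> 0" by simp_all
      have "\<bar>?P\<bar> \<le> ?F + ?A"
      proof (rule power2_le_imp_le)
        have "0 \<le> ?F * ?A" using 0 by (rule mult_nonneg_nonneg)
        moreover have "(?F + ?A)\<^sup>2 = ?F\<^sup>2 + ?A\<^sup>2 + 2 * (?F * ?A)" by (simp add: power2_sum)
        moreover have "0 \<le> ?F\<^sup>2" "0 \<le> ?A\<^sup>2" by simp_all
        ultimately show "\<bar>?P\<bar>\<^sup>2 \<le> (?F + ?A)\<^sup>2" using P unfolding power2_abs by linarith
      qed (use 0 in linarith)
      then show ?case using A elim(2) by simp
    qed
  qed
qed

lemma square_integrable_flux_add:
  assumes F: "square_integrable_flux \<Omega> B F" and G: "square_integrable_flux \<Omega> B G" and \<Omega>: "\<Omega> \<in> sets lebesgue"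
  shows "square_integrable_flux \<Omega> B (\<lambda>x y. p * F x y + q * G x y)"
  unfolding square_integrable_flux_def
proof (intro conjI ballI)
  have L: "AE x in lebesgue_on \<Omega>. F x \<in> L2_on B \<and> G x \<in> L2_on B" using F G by (simp add: square_integrable_flux_def)
  then show "AE x in lebesgue_on \<Omega>. (\<lambda>y. p * F x y + q * G x y) \<in> L2_on B"
    by eventually_elim (intro L2_on_add L2_on_cmult; simp)
  fix g assume g: "g \<in> L2_on B"
  have int: "integrable (lebesgue_on \<Omega>) (\<lambda>x. p * (\<integral>y. F x y * g y \<partial>lebesgue_on B) + q * (\<integral>y. G x y * g y \<partial>lebesgue_on B))"
    using F G g by (auto simp: square_integrable_flux_def)
  have eq: "AE x in lebesgue_on \<Omega>. p * (\<integral>y. F x y * g y \<partial>lebesgue_on B) + q * (\<integral>y. G x y * g y \<partial>lebesgue_on B)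
     = (\<integral>y. (p * F x y + q * G x y) * g y \<partial>lebesgue_on B)"
    using L
  proof eventually_elim
    case (elim x)
    then have "integrable (lebesgue_on B) (\<lambda>y. F x y * g y)" "integrable (lebesgue_on B) (\<lambda>y. G x y * g y)"
      by (auto intro: L2_on_integrable_mult g)
    then show ?case by (simp add: distrib_right mult.assoc)
  qed
  show "integrable (lebesgue_on \<Omega>) (\<lambda>x. \<integral>y. (p * F x y + q * G x y) * g y \<partial>lebesgue_on B)"
    by (rule integrable_cong_AE_imp[OF int _ eq])
       (rule borel_measurable_lebesgue_on_AE[OF \<Omega> borel_measurable_integrable[OF int] eq])
qed

lemma square_integrable_flux_sum:
  assumes "\<And>i. i \<in> I \<Longrightarrow> square_integrable_flux \<Omega> B (F i)" and \<Omega>: "\<Omega> \<in> sets lebesgue"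
  shows "square_integrable_flux \<Omega> B (\<lambda>x y. \<Sum>i\<in>I. F i x y)"
  using assms(1)
proof (induction I rule: infinite_finite_induct)
  case (insert i I)
  then show ?case using square_integrable_flux_add[of \<Omega> B "F i" "\<lambda>x y. \<Sum>i\<in>I. F i x y" 1 1] \<Omega> by simp
qed (auto simp: square_integrable_flux_def L2_on_zero)

lemma indicator_L2_H1_per:
  assumes S: "open S" and \<Omega>: "\<Omega> \<in> lmeasurable" and A: "A \<in> sets (lebesgue_on \<Omega>)" and g: "g \<in> H1_per S"
  shows "(\<lambda>x. if x \<in> A then g else (\<lambda>y. 0)) \<in> L2_H1_per \<Omega> S"
proof -
  let ?v = "\<lambda>x. if x \<in> A then g else (\<lambda>y. 0)"
  have H: "?v x \<in> H1_per S" for x using g H1_per_zero by simp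
  have "simple_function (lebesgue_on \<Omega>) ?v"
    using A sets.sets_into_space[OF A] by (intro simple_function_If) (auto simp: Int_absorb1 Collect_conj_eq)
  moreover have "(\<lambda>n :: nat. H1_per_quot_norm S (\<lambda>y. ?v x y - ?v x y)) \<longlonglongrightarrow> 0" for x
    by (simp add: quot_norm_zero[OF S])
  moreover have "integrable (lebesgue_on \<Omega>) (\<lambda>x. (H1_per_quot_norm S (?v x))\<^sup>2)"
  proof -
    have "integrable (lebesgue_on \<Omega>) (\<lambda>x. indicator A x * (H1_per_quot_norm S g)\<^sup>2)"
      using A finite_measure.emeasure_finite[OF finite_measure_lebesgue_on[OF \<Omega>]]
      by (intro integrable_mult_left integrable_real_indicator) (auto simp: less_top)
    moreover have "(\<lambda>x. indicator A x * (H1_per_quot_norm S g)\<^sup>2) = (\<lambda>x. (H1_per_quot_norm S (?v x))\<^sup>2)"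
      by (auto simp: fun_eq_iff quot_norm_zero[OF S])
    ultimately show ?thesis by simp
  qed
  ultimately show ?thesis
    unfolding L2_H1_per_def using H by (intro CollectI conjI exI[of _ "\<lambda>n. ?v"]) auto
qed

text \<open>Testing with products of the indicator of a set \<open>A\<close> in \<open>x\<close> and
  a fixed \<open>g\<close> in \<open>y\<close>, for all measurable \<open>A\<close>, makes the cell
  pairing with \<open>g\<close> vanish almost everywhere. A countable family of such
  \<open>g\<close> with dense gradients gives a common null set, and at a fixed \<open>x\<close>
  every test function is reached by continuity of the pairing.\<close>

lemma two_scale_localize:
  assumes S: "open S" and \<Omega>: "\<Omega> \<in> lmeasurable" and F: "\<And>j. square_integrable_flux \<Omega> (material S) (F j)"
    and weak: "weak_neg_div_two_scale \<Omega> S F"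
  shows "AE x in lebesgue_on \<Omega>. weak_neg_div_cell S (\<lambda>j. F j x)"
proof -
  let ?B = "material S"
  define h where "h g x = (\<integral>y. (\<Sum>j\<in>UNIV. F j x y * wderiv S j g y) \<partial>lebesgue_on ?B)" for g x
  have FL: "AE x in lebesgue_on \<Omega>. \<forall>j. F j x \<in> L2_on ?B"
    using F by (simp add: square_integrable_flux_def eventually_all_finite)
  have hsum: "AE x in lebesgue_on \<Omega>. (\<Sum>j\<in>UNIV. \<integral>y. F j x y * wderiv S j g y \<partial>lebesgue_on ?B) = h g x"
    if g: "g \<in> H1_per S" for g
    using FL
  proof eventually_elim
    case (elim x)
    then have "integrable (lebesgue_on ?B) (\<lambda>y. F j x y * wderiv S j g y)" for j
      by (intro L2_on_integrable_mult H1_per_wderiv(2)[OF S g]) simp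
    then show ?case by (simp add: h_def Bochner_Integration.integral_sum)
  qed
  have hint: "integrable (lebesgue_on \<Omega>) (h g)" if g: "g \<in> H1_per S" for g
  proof -
    have int: "integrable (lebesgue_on \<Omega>) (\<lambda>x. \<Sum>j\<in>UNIV. \<integral>y. F j x y * wderiv S j g y \<partial>lebesgue_on ?B)"
      using F H1_per_wderiv(2)[OF S g] by (intro Bochner_Integration.integrable_sum) (simp add: square_integrable_flux_def)
    show ?thesis
      by (rule integrable_cong_AE_imp[OF int _ hsum[OF g]])
         (rule borel_measurable_lebesgue_on_AE[OF fmeasurableD[OF \<Omega>] borel_measurable_integrable[OF int] hsum[OF g]])
  qed
  have h0: "AE x in lebesgue_on \<Omega>. h g x = 0" if g: "g \<in> H1_per S" for g
  proof -
    have "(LINT x:A|lebesgue_on \<Omega>. h g x) = 0" if A: "A \<in> sets (lebesgue_on \<Omega>)" for A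
    proof -
      let ?v = "\<lambda>x. if x \<in> A then g else (\<lambda>y. 0)"
      have "(\<integral>y. (\<Sum>i\<in>UNIV. F i x y * wderiv S i (?v x) y) \<partial>lebesgue_on ?B) = indicator A x *\<^sub>R h g x" for x
      proof (cases "x \<in> A")
        case False
        \<comment> \<open>Outside \<open>A\<close> the test function is 0, but its chosen weak
          derivative is known to be 0 only almost everywhere.\<close>
        have "AE y in lebesgue_on ?B. \<forall>k. wderiv S k (\<lambda>y. 0) y = 0"
          using wderiv_zero_material[OF S] by (simp add: eventually_all_finite)
        then have "AE y in lebesgue_on ?B. (\<Sum>i\<in>UNIV. F i x y * wderiv S i (?v x) y) = 0"
          by eventually_elim (simp add: False)
        then show ?thesis using False by (simp add: integral_eq_zero_AE)
      qed (simp add: h_def)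
      then show ?thesis
        using weak[unfolded weak_neg_div_two_scale_def, rule_format, OF indicator_L2_H1_per[OF S \<Omega> A g]]
        unfolding set_lebesgue_integral_def by simp
    qed
    then show ?thesis
      using density_unique_real[OF hint[OF g], of "\<lambda>x. 0"] by (simp add: set_lebesgue_integral_def)
  qed
  have sub: "?B \<subseteq> unit_cell" by (auto simp: material_def)
  obtain \<G> where G: "countable \<G>" "\<G> \<subseteq> H1_per S"
    "\<And>v \<epsilon>. v \<in> H1_per S \<Longrightarrow> \<epsilon> > 0 \<Longrightarrow> \<exists>g\<in>\<G>. \<forall>k. (\<integral>x. (wderiv S k v x - wderiv S k g x)\<^sup>2 \<partial>lebesgue_on ?B) < \<epsilon>"
    by (rule countable_L2_dense[OF material_lmeasurable[OF S] sub, of "H1_per S" "\<lambda>v k. wderiv S k v"])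
       (rule H1_per_wderiv(2)[OF S], assumption, rule that)
  have "AE x in lebesgue_on \<Omega>. \<forall>g\<in>\<G>. h g x = 0"
    unfolding AE_ball_countable[OF G(1)] using h0 G(2) by blast
  then show ?thesis
    using FL
  proof eventually_elim
    case (elim x)
    show ?case
      unfolding weak_neg_div_cell_def
    proof
      fix v assume v: "v \<in> H1_per S"
      define P where "P n g \<longleftrightarrow> g \<in> \<G> \<and> (\<forall>k. (\<integral>y. (wderiv S k v y - wderiv S k g y)\<^sup>2 \<partial>lebesgue_on ?B) < 1 / real (Suc n))"
        for n :: nat and g
      define g where "g n = (SOME g. P n g)" for n
      have "P n (g n)" for n
      proof -
        have "0 < 1 / real (Suc n)" by simp
        from G(3)[OF v this] have "\<exists>g. P n g" unfolding P_def by blast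
        then show ?thesis unfolding g_def by (rule someI_ex)
      qed
      then have g: "\<And>n. g n \<in> \<G>"
        and gl: "\<And>n k. (\<integral>y. (wderiv S k v y - wderiv S k (g n) y)\<^sup>2 \<partial>lebesgue_on ?B) < 1 / real (Suc n)"
        unfolding P_def by blast+
      have gH: "g n \<in> H1_per S" for n using g G(2) by blast
      define D where "D k n y = wderiv S k v y - wderiv S k (g n) y" for k n y
      have DL: "D k n \<in> L2_on ?B" for k n
        unfolding D_def[abs_def] by (intro L2_on_diff H1_per_wderiv(2)[OF S] v gH)
      have "(\<lambda>n. \<integral>y. (D k n y)\<^sup>2 \<partial>lebesgue_on ?B) \<longlonglongrightarrow> 0" for k
        by (rule Lim_null_comparison[OF _ LIMSEQ_Suc[OF lim_1_over_n]])
           (use gl in \<open>auto simp: D_def intro!: always_eventually less_imp_le\<close>)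
      then have "(\<lambda>n. \<integral>y. D k n y * F k x y \<partial>lebesgue_on ?B) \<longlonglongrightarrow> 0" for k
        using elim(2) by (intro L2_tendsto_0_mult DL) simp
      then have "(\<lambda>n. \<Sum>k\<in>UNIV. \<integral>y. D k n y * F k x y \<partial>lebesgue_on ?B) \<longlonglongrightarrow> (\<Sum>k\<in>(UNIV :: 3 set). 0)"
        by (intro tendsto_sum)
      moreover have "(\<Sum>k\<in>UNIV. \<integral>y. D k n y * F k x y \<partial>lebesgue_on ?B) = h v x" for n
      proof -
        have i: "integrable (lebesgue_on ?B) (\<lambda>y. F k x y * wderiv S k w y)" if "w \<in> H1_per S" for k w
          using elim(2) by (intro L2_on_integrable_mult H1_per_wderiv(2)[OF S that]) simp
        have "(\<integral>y. D k n y * F k x y \<partial>lebesgue_on ?B)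
           = (\<integral>y. F k x y * wderiv S k v y \<partial>lebesgue_on ?B) - (\<integral>y. F k x y * wderiv S k (g n) y \<partial>lebesgue_on ?B)" for k
          using i[OF v, of k] i[OF gH[of n], of k] by (simp add: D_def left_diff_distrib right_diff_distrib mult.commute[of _ "F k x _"])
        then have "(\<Sum>k\<in>UNIV. \<integral>y. D k n y * F k x y \<partial>lebesgue_on ?B) = h v x - h (g n) x"
          using i[OF v] i[OF gH[of n]] by (simp add: h_def Bochner_Integration.integral_sum sum_subtractf)
        then show ?thesis using elim(1) g by simp
      qed
      ultimately show "(\<integral>y. (\<Sum>i\<in>UNIV. F i x y * wderiv S i v y) \<partial>lebesgue_on ?B) = 0"
        by (simp add: h_def LIMSEQ_const_iff)
    qed
  qed
qed

section \<open>The cell problems at a fixed macroscopic point\<close>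

lemma sum4_swap:
  "(\<Sum>i\<in>A. \<Sum>j\<in>B. \<Sum>k\<in>C. \<Sum>l\<in>D. f i j k l) = (\<Sum>k\<in>C. \<Sum>l\<in>D. \<Sum>i\<in>A. \<Sum>j\<in>B. f i j k l)"
proof -
  have "(\<Sum>i\<in>A. \<Sum>j\<in>B. \<Sum>k\<in>C. \<Sum>l\<in>D. f i j k l) = (\<Sum>i\<in>A. \<Sum>k\<in>C. \<Sum>j\<in>B. \<Sum>l\<in>D. f i j k l)"
    by (intro sum.cong refl sum.swap)
  also have "\<dots> = (\<Sum>k\<in>C. \<Sum>i\<in>A. \<Sum>j\<in>B. \<Sum>l\<in>D. f i j k l)" by (rule sum.swap)
  also have "\<dots> = (\<Sum>k\<in>C. \<Sum>i\<in>A. \<Sum>l\<in>D. \<Sum>j\<in>B. f i j k l)"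
    by (intro sum.cong refl sum.swap)
  also have "\<dots> = (\<Sum>k\<in>C. \<Sum>l\<in>D. \<Sum>i\<in>A. \<Sum>j\<in>B. f i j k l)"
    by (intro sum.cong refl sum.swap)
  finally show ?thesis .
qed

lemma stress_lincomb:
  "stress c e x y (\<lambda>k l. a * \<xi> k l + b * \<xi>' k l) (\<lambda>k. a * E k + b * E' k) i j
    = a * stress c e x y \<xi> E i j + b * stress c e x y \<xi>' E' i j"
  by (simp add: stress_def sum.distrib sum_distrib_left algebra_simps)

lemma elec_disp_lincomb:
  "elec_disp e d x y (\<lambda>k l. a * \<xi> k l + b * \<xi>' k l) (\<lambda>k. a * E k + b * E' k) i
    = a * elec_disp e d x y \<xi> E i + b * elec_disp e d x y \<xi>' E' i"
  by (simp add: elec_disp_def sum.distrib sum_distrib_left algebra_simps)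

lemma stress_zero: "stress c e x y (\<lambda>k l. 0) (\<lambda>k. 0) i j = 0"
  by (simp add: stress_def)

lemma elec_disp_zero: "elec_disp e d x y (\<lambda>k l. 0) (\<lambda>k. 0) i = 0"
  by (simp add: elec_disp_def)

lemma stress_sum:
  "stress c e x y (\<lambda>k l. \<Sum>t\<in>T. r t * \<xi> t k l) (\<lambda>k. \<Sum>t\<in>T. r t * E t k) i j
    = (\<Sum>t\<in>T. r t * stress c e x y (\<xi> t) (E t) i j)"
proof (induction T rule: infinite_finite_induct)
  case (insert t T)
  then show ?case
    using stress_lincomb[of c e x y "r t" "\<xi> t" 1 "\<lambda>k l. \<Sum>t\<in>T. r t * \<xi> t k l" "E t" "\<lambda>k. \<Sum>t\<in>T. r t * E t k" i j] by simp
qed (simp_all add: stress_zero)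

lemma elec_disp_sum:
  "elec_disp e d x y (\<lambda>k l. \<Sum>t\<in>T. r t * \<xi> t k l) (\<lambda>k. \<Sum>t\<in>T. r t * E t k) i
    = (\<Sum>t\<in>T. r t * elec_disp e d x y (\<xi> t) (E t) i)"
proof (induction T rule: infinite_finite_induct)
  case (insert t T)
  then show ?case
    using elec_disp_lincomb[of e d x y "r t" "\<xi> t" 1 "\<lambda>k l. \<Sum>t\<in>T. r t * \<xi> t k l" "E t" "\<lambda>k. \<Sum>t\<in>T. r t * E t k" i] by simp
qed (simp_all add: elec_disp_zero)

text \<open>The coupling sum is brought to the order used in \<open>elec_disp_contract\<close>, so
  that the two coupling terms cancel literally when stress work and electric work are added.\<close>

lemma stress_contract:
  "(\<Sum>i\<in>UNIV. \<Sum>j\<in>UNIV. stress c e x y \<xi> E i j * \<xi>' i j)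
    = (\<Sum>i\<in>UNIV. \<Sum>j\<in>UNIV. \<Sum>k\<in>UNIV. \<Sum>l\<in>UNIV. apply_bcontfun (c i j k l x) y * \<xi>' i j * \<xi> k l)
      + (\<Sum>k\<in>UNIV. \<Sum>i\<in>UNIV. \<Sum>j\<in>UNIV. apply_bcontfun (e k i j x) y * \<xi>' i j * E k)"
proof -
  have "(\<Sum>i\<in>UNIV. \<Sum>j\<in>UNIV. \<Sum>k\<in>UNIV. apply_bcontfun (e k i j x) y * \<xi>' i j * E k)
     = (\<Sum>k\<in>UNIV. \<Sum>i\<in>UNIV. \<Sum>j\<in>UNIV. apply_bcontfun (e k i j x) y * \<xi>' i j * E k)"
    by (subst sum.swap[of _ _ "UNIV :: 3 set"], subst sum.swap[of _ _ "UNIV :: 3 set"]) (simp add: sum_3)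
  then show ?thesis
    by (simp add: stress_def distrib_right sum.distrib sum_distrib_right mult.assoc mult.commute[of "\<xi>' _ _"])
qed

lemma elec_disp_contract:
  "(\<Sum>i\<in>UNIV. elec_disp e d x y \<xi> E i * E' i)
    = - (\<Sum>k\<in>UNIV. \<Sum>i\<in>UNIV. \<Sum>j\<in>UNIV. apply_bcontfun (e k i j x) y * \<xi> i j * E' k)
      + (\<Sum>i\<in>UNIV. \<Sum>j\<in>UNIV. apply_bcontfun (d i j x) y * E' i * E j)"
  by (simp add: elec_disp_def distrib_right left_diff_distrib sum.distrib sum_subtractf sum_negf sum_distrib_right mult.assoc mult.commute[of "E' _"])

text \<open>The two kinds of cell problems are treated simultaneously: \<open>Inl (m, h)\<close> is the unit strain
  \<open>\<tau>\<^sub>m\<^sub>h\<close>, and \<open>Inr n\<close> is the unit potential gradient \<open>\<delta>\<^sub>n\<close>.\<close>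

type_synonym mode = "(3 \<times> 3) + 3"

definition mode_strain :: "mode \<Rightarrow> 3 \<Rightarrow> 3 \<Rightarrow> real" where
  "mode_strain t k l = (case t of Inl (m, h) \<Rightarrow> tau m h k l | Inr n \<Rightarrow> 0)"

definition mode_field :: "mode \<Rightarrow> 3 \<Rightarrow> real" where
  "mode_field t k = (case t of Inl _ \<Rightarrow> 0 | Inr n \<Rightarrow> kdelta k n)"

definition mode_coeff :: "(3 \<Rightarrow> 3 \<Rightarrow> real) \<Rightarrow> (3 \<Rightarrow> real) \<Rightarrow> mode \<Rightarrow> real" where
  "mode_coeff \<xi> E t = (case t of Inl (m, h) \<Rightarrow> \<xi> m h | Inr n \<Rightarrow> E n)"

lemma sum_mode:
  fixes f :: "mode \<Rightarrow> 'b :: comm_monoid_add"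
  shows "(\<Sum>t\<in>UNIV. f t) = (\<Sum>m\<in>UNIV. \<Sum>h\<in>UNIV. f (Inl (m, h))) + (\<Sum>n\<in>UNIV. f (Inr n))"
proof -
  have "(\<Sum>t\<in>UNIV. f t) = (\<Sum>t\<in>UNIV <+> UNIV. f t)" by simp
  also have "\<dots> = (\<Sum>p\<in>UNIV. f (Inl p)) + (\<Sum>n\<in>UNIV. f (Inr n))"
    by (subst sum.Plus) auto
  also have "(\<Sum>p\<in>UNIV. f (Inl p)) = (\<Sum>m\<in>UNIV. \<Sum>h\<in>UNIV. f (Inl (m, h)))"
    by (simp add: sum.cartesian_product)
  finally show ?thesis .
qed

text \<open>The unit strains are symmetrized, so the expansion recovers only the symmetric part of
  \<open>\<xi>\<close>. This is why the macroscopic strain is required to be symmetric in the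
  superposition below.\<close>

lemma sum_tau: "(\<Sum>m\<in>UNIV. \<Sum>h\<in>UNIV. \<xi> m h * tau m h k l) = (\<xi> k l + \<xi> l k) / 2"
  using exhaust_3[of k] exhaust_3[of l] by (auto simp: tau_def kdelta_def sum_3)

lemma sum_tau': "(\<Sum>k\<in>UNIV. \<Sum>l\<in>UNIV. \<xi> k l * tau m h k l) = (\<xi> m h + \<xi> h m) / 2"
  using exhaust_3[of m] exhaust_3[of h] by (auto simp: tau_def kdelta_def sum_3)

lemma sum_mode_strain:
  assumes "\<And>k l. \<xi> k l = \<xi> l k"
  shows "(\<Sum>t\<in>UNIV. mode_coeff \<xi> E t * mode_strain t k l) = \<xi> k l"
  using assms[of l k] by (simp add: sum_mode mode_coeff_def mode_strain_def sum_tau)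

lemma sum_mode_field: "(\<Sum>t\<in>UNIV. mode_coeff \<xi> E t * mode_field t k) = E k"
  by (simp add: sum_mode mode_coeff_def mode_field_def kdelta_def if_distrib[of "\<lambda>t. _ * t"] sum.delta cong: if_cong)

section \<open>Periodic gradients as test fields\<close>

definition symgrad :: "(3 \<Rightarrow> 3 \<Rightarrow> R3 \<Rightarrow> real) \<Rightarrow> 3 \<Rightarrow> 3 \<Rightarrow> R3 \<Rightarrow> real" where
  "symgrad H k l y = (H l k y + H k l y) / 2"

text \<open>In \<open>H l k\<close> the first index is the component of the displacement and the
  second the direction of differentiation, hence the exchanged arguments.\<close>

lemma strain_symgrad: "strain A v k l y = symgrad (\<lambda>l k. wderiv A k (\<lambda>z. v z $ l)) k l y"
  by (simp add: strain_def symgrad_def)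

text \<open>Asking for equality only almost everywhere makes the class closed under linear
  combinations, although \<open>wderiv\<close> itself is linear only almost everywhere.\<close>

definition per_grad :: "R3 set \<Rightarrow> (3 \<Rightarrow> R3 \<Rightarrow> real) \<Rightarrow> bool" where
  "per_grad S h \<longleftrightarrow> (\<exists>v\<in>H1_per S. \<forall>k. AE y in lebesgue_on (material S). wderiv S k v y = h k y)"

lemma per_grad_wderiv: "v \<in> H1_per S \<Longrightarrow> per_grad S (\<lambda>k. wderiv S k v)"
  unfolding per_grad_def by (intro bexI[of _ v]) auto

lemma per_grad_L2: "open S \<Longrightarrow> per_grad S h \<Longrightarrow> h k \<in> L2_on (material S)"
  unfolding per_grad_def using H1_per_wderiv(2) L2_on_AE[OF material_sets] by blast

lemma per_grad_lincomb:
  assumes S: "open S" and g: "per_grad S g" and h: "per_grad S h"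
  shows "per_grad S (\<lambda>k y. a * g k y + b * h k y)"
proof -
  obtain v w where v: "v \<in> H1_per S" "\<And>k. AE y in lebesgue_on (material S). wderiv S k v y = g k y"
    and w: "w \<in> H1_per S" "\<And>k. AE y in lebesgue_on (material S). wderiv S k w y = h k y"
    using g h unfolding per_grad_def by blast
  have "AE y in lebesgue_on (material S). wderiv S k (\<lambda>y. a * v y + b * w y) y = a * g k y + b * h k y" for k
    using H1_per_lincomb(2)[OF S v(1) w(1), of k a b] v(2)[of k] w(2)[of k] by eventually_elim simp
  then show ?thesis
    unfolding per_grad_def by (intro bexI[OF _ H1_per_lincomb(1)[OF S v(1) w(1)]]) blast
qed

lemma per_grad_zero: "open S \<Longrightarrow> per_grad S (\<lambda>k y. 0)"
  unfolding per_grad_def by (intro bexI[OF _ H1_per_zero] allI wderiv_zero_material)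

lemma per_grad_sum:
  assumes S: "open S" and h: "\<And>t. per_grad S (h t)"
  shows "per_grad S (\<lambda>k y. \<Sum>t\<in>T. r t * h t k y)"
proof (induction T rule: infinite_finite_induct)
  case (insert t T)
  then show ?case using per_grad_lincomb[OF S h[of t] insert.IH, of "r t" 1] by simp
qed (simp_all add: per_grad_zero[OF S])

lemma equilibrium_test:
  assumes S: "open S" and F: "\<And>j. F j \<in> L2_on (material S)" and eq: "weak_neg_div_cell S F" and h: "per_grad S h"
  shows "(\<integral>y. (\<Sum>j\<in>UNIV. F j y * h j y) \<partial>lebesgue_on (material S)) = 0"
proof -
  obtain v where v: "v \<in> H1_per S" "\<And>k. AE y in lebesgue_on (material S). wderiv S k v y = h k y"
    using h unfolding per_grad_def by blast
  have "AE y in lebesgue_on (material S). \<forall>k. wderiv S k v y = h k y" using v(2) by (simp add: eventually_all_finite)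
  then have "AE y in lebesgue_on (material S). (\<Sum>j\<in>UNIV. F j y * h j y) = (\<Sum>j\<in>UNIV. F j y * wderiv S j v y)"
    by eventually_elim simp
  then have "(\<integral>y. (\<Sum>j\<in>UNIV. F j y * h j y) \<partial>lebesgue_on (material S)) = (\<integral>y. (\<Sum>j\<in>UNIV. F j y * wderiv S j v y) \<partial>lebesgue_on (material S))"
    by (rule integral_cong_AE[rotated 2])
       (intro borel_measurable_sum borel_measurable_times L2_on_measurable F per_grad_L2[OF S h] H1_per_wderiv(2)[OF S v(1)])+
  then show ?thesis using eq v(1) by (simp add: weak_neg_div_cell_def)
qed

text \<open>The gradient is constant on one cell; periodicity of the weak derivative spreads this to
  all of the connected set \<open>S\<close>, where the rigidity result applies.\<close>

lemma per_grad_const_imp_0: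
  assumes S: "periodic_material_set S" and h: "per_grad S h"
    and C: "\<And>k. AE y in lebesgue_on (material S). h k y = C k"
  shows "C k = 0"
proof -
  have S': "open S" "connected S" "S \<noteq> {}" "\<And>y k. y + axis k 1 \<in> S \<longleftrightarrow> y \<in> S"
    using S by (auto simp: periodic_material_set_def smooth_open_set_def)
  obtain v where v: "v \<in> H1_per S" "\<And>k. AE y in lebesgue_on (material S). wderiv S k v y = h k y"
    using h unfolding per_grad_def by blast
  have vp: "v (y + axis k 1) = v y" if "y \<in> S" for y k using v(1) that by (simp add: H1_per_def)
  have vd: "is_weak_deriv S k v (wderiv S k v)" for k by (rule H1_per_wderiv(1)[OF S'(1) v(1)])
  have "AE y in lebesgue_on S. wderiv S k v y = C k" for k
  proof (rule AE_material_imp_AE[OF S'(1,4)])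
    show "AE y in lebesgue_on S. \<forall>a\<in>integer_vectors. wderiv S k v (y + a) = wderiv S k v y"
      by (rule weak_deriv_periodic[OF S'(1,4) vp vd])
    show "AE y in lebesgue_on (material S). wderiv S k v y = C k"
      using v(2)[of k] C[of k] by eventually_elim simp
  qed
  from periodic_constant_gradient[OF S' vp vd this] show ?thesis .
qed

lemma symgrad_const_imp_0:
  assumes S: "periodic_material_set S" and H: "\<And>i. per_grad S (H i)"
    and C: "\<And>i j. AE y in lebesgue_on (material S). symgrad H i j y = C i j"
  shows "C i j = 0"
proof -
  have S': "open S" "connected S" "S \<noteq> {}" "\<And>y k. y + axis k 1 \<in> S \<longleftrightarrow> y \<in> S"
    using S by (auto simp: periodic_material_set_def smooth_open_set_def)
  have "\<forall>i. \<exists>v. v \<in> H1_per S \<and> (\<forall>k. AE y in lebesgue_on (material S). wderiv S k v y = H i k y)"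
    using H unfolding per_grad_def by blast
  from choice[OF this] obtain v where v: "\<And>i. v i \<in> H1_per S"
    "\<And>i k. AE y in lebesgue_on (material S). wderiv S k (v i) y = H i k y" by blast
  have vp: "v i (y + axis k 1) = v i y" if "y \<in> S" for i y k using v(1)[of i] that by (simp add: H1_per_def)
  have vd: "is_weak_deriv S k (v i) (wderiv S k (v i))" for i k by (rule H1_per_wderiv(1)[OF S'(1) v(1)])
  have vper: "AE y in lebesgue_on S. \<forall>a\<in>integer_vectors. wderiv S k (v i) (y + a) = wderiv S k (v i) y" for i k
    by (rule weak_deriv_periodic[OF S'(1,4) vp vd])
  \<comment> \<open>The rigidity result is stated for the sum of a derivative and its transpose,
    which is twice the symmetrized gradient.\<close>
  have ae: "AE y in lebesgue_on S. wderiv S j (v i) y + wderiv S i (v j) y = 2 * C i j" for i j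
  proof (rule AE_material_imp_AE[OF S'(1,4)])
    show "AE y in lebesgue_on S. \<forall>a\<in>integer_vectors. wderiv S j (v i) (y + a) + wderiv S i (v j) (y + a) = wderiv S j (v i) y + wderiv S i (v j) y"
      using vper[of i j] vper[of j i] by eventually_elim simp
    show "AE y in lebesgue_on (material S). wderiv S j (v i) y + wderiv S i (v j) y = 2 * C i j"
      using v(2)[of j i] v(2)[of i j] C[of i j] by eventually_elim (simp add: symgrad_def)
  qed
  have "2 * C i j = 0"
    by (rule periodic_constant_strain[OF S' vp vd ae])
  then show ?thesis by simp
qed

section \<open>Energy, reciprocity and uniqueness on the cell\<close>

locale piezo_cell =
  fixes S :: "R3 set" and c :: "3 \<Rightarrow> 3 \<Rightarrow> 3 \<Rightarrow> 3 \<Rightarrow> coef" and e :: "3 \<Rightarrow> 3 \<Rightarrow> 3 \<Rightarrow> coef" and d :: "3 \<Rightarrow> 3 \<Rightarrow> coef"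
    and \<alpha>\<^sub>c \<alpha>\<^sub>d :: real and x :: R3
  assumes S: "periodic_material_set S"
    and coef: "\<And>y. piezo_at (\<lambda>i j k l. apply_bcontfun (c i j k l x)) (\<lambda>i j k. apply_bcontfun (e i j k x))
      (\<lambda>i j. apply_bcontfun (d i j x)) \<alpha>\<^sub>c \<alpha>\<^sub>d y"
    and pos: "\<alpha>\<^sub>c > 0" "\<alpha>\<^sub>d > 0"
begin

lemma openS: "open S"
  using S by (simp add: periodic_material_set_def smooth_open_set_def)

definition sig :: "(3 \<Rightarrow> 3 \<Rightarrow> R3 \<Rightarrow> real) \<Rightarrow> (3 \<Rightarrow> R3 \<Rightarrow> real) \<Rightarrow> 3 \<Rightarrow> 3 \<Rightarrow> R3 \<Rightarrow> real" where
  "sig \<xi> E i j y = stress c e x y (\<lambda>k l. \<xi> k l y) (\<lambda>k. E k y) i j"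

definition dis :: "(3 \<Rightarrow> 3 \<Rightarrow> R3 \<Rightarrow> real) \<Rightarrow> (3 \<Rightarrow> R3 \<Rightarrow> real) \<Rightarrow> 3 \<Rightarrow> R3 \<Rightarrow> real" where
  "dis \<xi> E i y = elec_disp e d x y (\<lambda>k l. \<xi> k l y) (\<lambda>k. E k y) i"

definition L2_state :: "(3 \<Rightarrow> 3 \<Rightarrow> R3 \<Rightarrow> real) \<Rightarrow> (3 \<Rightarrow> R3 \<Rightarrow> real) \<Rightarrow> bool" where
  "L2_state \<xi> E \<longleftrightarrow> (\<forall>k l. \<xi> k l \<in> L2_on (material S)) \<and> (\<forall>k. E k \<in> L2_on (material S))"

definition equilibrium :: "(3 \<Rightarrow> 3 \<Rightarrow> R3 \<Rightarrow> real) \<Rightarrow> (3 \<Rightarrow> R3 \<Rightarrow> real) \<Rightarrow> bool" where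
  "equilibrium \<xi> E \<longleftrightarrow> (\<forall>i. weak_neg_div_cell S (sig \<xi> E i)) \<and> weak_neg_div_cell S (dis \<xi> E)"

lemma sig_L2: "L2_state \<xi> E \<Longrightarrow> sig \<xi> E i j \<in> L2_on (material S)"
  unfolding sig_def[abs_def] stress_def L2_state_def by (intro L2_on_add L2_on_sum bcontfun_L2) auto

lemma dis_L2:
  assumes L: "L2_state \<xi> E" shows "dis \<xi> E i \<in> L2_on (material S)"
proof -
  have "(\<lambda>y. \<Sum>k\<in>UNIV. \<Sum>l\<in>UNIV. apply_bcontfun (e i k l x) y * \<xi> k l y) \<in> L2_on (material S)"
    "(\<lambda>y. \<Sum>j\<in>UNIV. apply_bcontfun (d i j x) y * E j y) \<in> L2_on (material S)"
    using L unfolding L2_state_def by (auto intro!: L2_on_sum bcontfun_L2)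
  from L2_on_diff[OF this(2,1)] show ?thesis by (simp add: dis_def[abs_def] elec_disp_def)
qed

lemma sig_sym: "sig \<xi> E i j y = sig \<xi> E j i y"
proof -
  have "apply_bcontfun (c i j k l x) y = apply_bcontfun (c j i k l x) y" "apply_bcontfun (e k i j x) y = apply_bcontfun (e k j i x) y" for k l
    using coef[of y] unfolding piezo_at_def by blast+
  then show ?thesis by (simp add: sig_def stress_def)
qed

text \<open>In the sum of mechanical and electric work the coupling terms cancel, so the ellipticity
  of \<open>c\<close> on symmetric matrices and that of \<open>d\<close> can be used
  separately.\<close>

lemma energy_coercive:
  assumes "\<And>k l. \<xi> k l y = \<xi> l k y"
  shows "\<alpha>\<^sub>c * (\<Sum>i\<in>UNIV. \<Sum>j\<in>UNIV. (\<xi> i j y)\<^sup>2) + \<alpha>\<^sub>d * (\<Sum>i\<in>UNIV. (E i y)\<^sup>2)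
    \<le> (\<Sum>i\<in>UNIV. \<Sum>j\<in>UNIV. sig \<xi> E i j y * \<xi> i j y) + (\<Sum>i\<in>UNIV. dis \<xi> E i y * E i y)"
proof -
  define X :: "real^3^3" where "X = (\<chi> i j. \<xi> i j y)"
  have "transpose X = X" using assms by (simp add: X_def transpose_def vec_eq_iff)
  then have "(\<Sum>i\<in>UNIV. \<Sum>j\<in>UNIV. \<Sum>k\<in>UNIV. \<Sum>l\<in>UNIV. apply_bcontfun (c i j k l x) y * X $ i $ j * X $ k $ l)
        \<ge> \<alpha>\<^sub>c * (\<Sum>i\<in>UNIV. \<Sum>j\<in>UNIV. X $ i $ j * X $ i $ j)"
    using coef[of y] unfolding piezo_at_def by blast
  moreover define Z :: R3 where "Z = (\<chi> i. E i y)"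
  have "(\<Sum>i\<in>UNIV. \<Sum>j\<in>UNIV. apply_bcontfun (d i j x) y * Z $ i * Z $ j) \<ge> \<alpha>\<^sub>d * (\<Sum>i\<in>UNIV. Z $ i * Z $ i)"
    using coef[of y] unfolding piezo_at_def by blast
  ultimately show ?thesis
    by (simp add: sig_def dis_def stress_contract elec_disp_contract X_def Z_def power2_eq_square)
qed

text \<open>On each side the coupling terms cancel because stress and electric displacement come
  from different states: the left side reduces to \<open>c\<close> paired with both strains plus
  \<open>d\<close> paired with both fields. The symmetries of \<open>c\<close> and \<open>d\<close>
  make this invariant under exchanging the states.\<close>

lemma reciprocity:
  "(\<Sum>i\<in>UNIV. \<Sum>j\<in>UNIV. sig \<xi> E i j y * \<xi>' i j y) + (\<Sum>i\<in>UNIV. dis \<xi>' E' i y * E i y)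
   = (\<Sum>i\<in>UNIV. \<Sum>j\<in>UNIV. sig \<xi>' E' i j y * \<xi> i j y) + (\<Sum>i\<in>UNIV. dis \<xi> E i y * E' i y)"
proof -
  have c: "apply_bcontfun (c i j k l x) y = apply_bcontfun (c k l i j x) y" for i j k l
    using coef[of y] unfolding piezo_at_def by blast
  have d: "apply_bcontfun (d i j x) y = apply_bcontfun (d j i x) y" for i j
    using coef[of y] unfolding piezo_at_def by blast
  have "(\<Sum>i\<in>UNIV. \<Sum>j\<in>UNIV. \<Sum>k\<in>UNIV. \<Sum>l\<in>UNIV. apply_bcontfun (c i j k l x) y * \<xi>' i j y * \<xi> k l y)
    = (\<Sum>k\<in>UNIV. \<Sum>l\<in>UNIV. \<Sum>i\<in>UNIV. \<Sum>j\<in>UNIV. apply_bcontfun (c k l i j x) y * \<xi> k l y * \<xi>' i j y)"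
    by (subst sum4_swap) (intro sum.cong refl, subst c, simp)
  moreover have "(\<Sum>i\<in>UNIV. \<Sum>j\<in>UNIV. apply_bcontfun (d i j x) y * E i y * E' j y)
    = (\<Sum>j\<in>UNIV. \<Sum>i\<in>UNIV. apply_bcontfun (d j i x) y * E' j y * E i y)"
    by (subst sum.swap) (intro sum.cong refl, subst d, simp)
  ultimately show ?thesis by (simp add: sig_def dis_def stress_contract elec_disp_contract)
qed

text \<open>A symmetric stress does the same work on a gradient as on its symmetric part, so the
  equations for the single components can be summed into one with a strain.\<close>

lemma sig_test:
  assumes L: "L2_state \<xi> E" and eq: "equilibrium \<xi> E" and H: "\<And>i. per_grad S (H i)"
  shows "(\<integral>y. (\<Sum>i\<in>UNIV. \<Sum>j\<in>UNIV. sig \<xi> E i j y * symgrad H i j y) \<partial>lebesgue_on (material S)) = 0"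
proof -
  have e: "(\<Sum>i\<in>UNIV. \<Sum>j\<in>UNIV. sig \<xi> E i j y * symgrad H i j y) = (\<Sum>i\<in>UNIV. \<Sum>j\<in>UNIV. sig \<xi> E i j y * H i j y)" for y
  proof -
    have "(\<Sum>i\<in>UNIV. \<Sum>j\<in>UNIV. sig \<xi> E i j y * H j i y) = (\<Sum>j\<in>UNIV. \<Sum>i\<in>UNIV. sig \<xi> E i j y * H j i y)" by (rule sum.swap)
    also have "\<dots> = (\<Sum>i\<in>UNIV. \<Sum>j\<in>UNIV. sig \<xi> E i j y * H i j y)"
      by (intro sum.cong refl) (subst sig_sym, simp)
    finally show ?thesis by (simp add: symgrad_def distrib_left sum.distrib add_divide_distrib sum_divide_distrib[symmetric])
  qed
  have i: "integrable (lebesgue_on (material S)) (\<lambda>y. \<Sum>j\<in>UNIV. sig \<xi> E i j y * H i j y)" for i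
    by (intro Bochner_Integration.integrable_sum L2_on_integrable_mult sig_L2[OF L] per_grad_L2[OF openS H])
  have "(\<integral>y. (\<Sum>i\<in>UNIV. \<Sum>j\<in>UNIV. sig \<xi> E i j y * H i j y) \<partial>lebesgue_on (material S))
     = (\<Sum>i\<in>UNIV. \<integral>y. (\<Sum>j\<in>UNIV. sig \<xi> E i j y * H i j y) \<partial>lebesgue_on (material S))"
    using i by (rule Bochner_Integration.integral_sum)
  also have "\<dots> = 0"
    using equilibrium_test[OF openS sig_L2[OF L] _ H] eq by (simp add: equilibrium_def)
  finally show ?thesis by (simp add: e)
qed

lemma dis_test:
  assumes L: "L2_state \<xi> E" and eq: "equilibrium \<xi> E" and G: "per_grad S G"
  shows "(\<integral>y. (\<Sum>i\<in>UNIV. dis \<xi> E i y * G i y) \<partial>lebesgue_on (material S)) = 0"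
  using equilibrium_test[OF openS dis_L2[OF L] _ G] eq by (simp add: equilibrium_def)

lemma work_integrable:
  assumes "L2_state \<xi> E" "L2_state \<xi>' E'"
  shows "integrable (lebesgue_on (material S)) (\<lambda>y. \<Sum>i\<in>UNIV. \<Sum>j\<in>UNIV. sig \<xi> E i j y * \<xi>' i j y)"
    and "integrable (lebesgue_on (material S)) (\<lambda>y. \<Sum>i\<in>UNIV. dis \<xi> E i y * E' i y)"
  using sig_L2[OF assms(1)] dis_L2[OF assms(1)] assms(2)
  by (auto intro!: Bochner_Integration.integrable_sum L2_on_integrable_mult simp: L2_state_def)

lemma symgrad_L2: "(\<And>i. per_grad S (H i)) \<Longrightarrow> symgrad H k l \<in> L2_on (material S)"
  using L2_on_cmult[OF L2_on_add[OF per_grad_L2[OF openS, of "H l" k] per_grad_L2[OF openS, of "H k" l]], of "1 / 2"]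
  by (simp add: symgrad_def[abs_def])

lemma L2_state_grad: "(\<And>i. per_grad S (H i)) \<Longrightarrow> per_grad S G \<Longrightarrow> L2_state (symgrad H) G"
  by (simp add: L2_state_def symgrad_L2 per_grad_L2[OF openS])

lemma zero_energy:
  assumes L: "L2_state \<xi> E" and sym: "\<And>k l y. \<xi> k l y = \<xi> l k y"
    and 0: "(\<integral>y. (\<Sum>i\<in>UNIV. \<Sum>j\<in>UNIV. sig \<xi> E i j y * \<xi> i j y) + (\<Sum>i\<in>UNIV. dis \<xi> E i y * E i y) \<partial>lebesgue_on (material S)) = 0"
  shows "AE y in lebesgue_on (material S). (\<forall>k l. \<xi> k l y = 0) \<and> (\<forall>k. E k y = 0)"
proof -
  have nn: "0 \<le> \<alpha>\<^sub>c * (\<Sum>i\<in>UNIV. \<Sum>j\<in>UNIV. (\<xi> i j y)\<^sup>2)" "0 \<le> \<alpha>\<^sub>d * (\<Sum>i\<in>UNIV. (E i y)\<^sup>2)" for y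
    using pos by (auto intro!: mult_nonneg_nonneg sum_nonneg)
  note co = energy_coercive[of \<xi> _ E, OF sym]
  have "AE y in lebesgue_on (material S). (\<Sum>i\<in>UNIV. \<Sum>j\<in>UNIV. sig \<xi> E i j y * \<xi> i j y) + (\<Sum>i\<in>UNIV. dis \<xi> E i y * E i y) = 0"
  proof (rule integral_nonneg_eq_0_iff_AE[THEN iffD1, OF _ _ 0])
    show "integrable (lebesgue_on (material S)) (\<lambda>y. (\<Sum>i\<in>UNIV. \<Sum>j\<in>UNIV. sig \<xi> E i j y * \<xi> i j y) + (\<Sum>i\<in>UNIV. dis \<xi> E i y * E i y))"
      by (intro Bochner_Integration.integrable_add work_integrable(1)[OF L L] work_integrable(2)[OF L L])
    show "AE y in lebesgue_on (material S). 0 \<le> (\<Sum>i\<in>UNIV. \<Sum>j\<in>UNIV. sig \<xi> E i j y * \<xi> i j y) + (\<Sum>i\<in>UNIV. dis \<xi> E i y * E i y)"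
      using nn co by (intro AE_I2) (meson add_nonneg_nonneg order_trans)
  qed
  then show ?thesis
  proof eventually_elim
    case (elim y)
    then have "\<alpha>\<^sub>c * (\<Sum>i\<in>UNIV. \<Sum>j\<in>UNIV. (\<xi> i j y)\<^sup>2) = 0" "\<alpha>\<^sub>d * (\<Sum>i\<in>UNIV. (E i y)\<^sup>2) = 0"
      using nn[of y] co[of y] by linarith+
    then have 1: "(\<Sum>i\<in>UNIV. \<Sum>j\<in>UNIV. (\<xi> i j y)\<^sup>2) = 0" and 2: "(\<Sum>i\<in>UNIV. (E i y)\<^sup>2) = 0" using pos by auto
    from 1 have "\<forall>i\<in>UNIV. (\<Sum>j\<in>UNIV. (\<xi> i j y)\<^sup>2) = 0"
      by (subst (asm) sum_nonneg_eq_0_iff) (auto intro: sum_nonneg)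
    moreover from 2 have "\<forall>i\<in>UNIV. (E i y)\<^sup>2 = 0" by (subst (asm) sum_nonneg_eq_0_iff) auto
    ultimately show ?case by (auto simp: sum_nonneg_eq_0_iff)
  qed
qed

text \<open>The difference of the two states consists of periodic gradients, so it is an allowed
  test field for both equilibria. Its own energy is therefore 0, and coercivity applies.\<close>

lemma equilibrium_unique:
  assumes L: "L2_state \<xi> E" "L2_state \<xi>' E'" and eq: "equilibrium \<xi> E" "equilibrium \<xi>' E'"
    and H: "\<And>i. per_grad S (H i)" and G: "per_grad S G"
    and diff: "\<And>k l y. \<xi> k l y = \<xi>' k l y + symgrad H k l y" "\<And>k y. E k y = E' k y + G k y"
  shows "AE y in lebesgue_on (material S). (\<forall>k l. \<xi> k l y = \<xi>' k l y) \<and> (\<forall>k. E k y = E' k y)"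
proof -
  have sd: "sig (symgrad H) G i j y = sig \<xi> E i j y - sig \<xi>' E' i j y" for i j y
    using stress_lincomb[of c e x y 1 "\<lambda>k l. \<xi> k l y" "- 1" "\<lambda>k l. \<xi>' k l y" "\<lambda>k. E k y" "\<lambda>k. E' k y" i j]
    by (simp add: sig_def diff)
  have dd: "dis (symgrad H) G i y = dis \<xi> E i y - dis \<xi>' E' i y" for i y
    using elec_disp_lincomb[of e d x y 1 "\<lambda>k l. \<xi> k l y" "- 1" "\<lambda>k l. \<xi>' k l y" "\<lambda>k. E k y" "\<lambda>k. E' k y" i]
    by (simp add: dis_def diff)
  note LH = L2_state_grad[OF H G]
  have "AE y in lebesgue_on (material S). (\<forall>k l. symgrad H k l y = 0) \<and> (\<forall>k. G k y = 0)"
  proof (rule zero_energy[OF LH])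
    show "symgrad H k l y = symgrad H l k y" for k l y by (simp add: symgrad_def)
    have "(\<Sum>i\<in>UNIV. \<Sum>j\<in>UNIV. sig (symgrad H) G i j y * symgrad H i j y) + (\<Sum>i\<in>UNIV. dis (symgrad H) G i y * G i y)
      = ((\<Sum>i\<in>UNIV. \<Sum>j\<in>UNIV. sig \<xi> E i j y * symgrad H i j y) - (\<Sum>i\<in>UNIV. \<Sum>j\<in>UNIV. sig \<xi>' E' i j y * symgrad H i j y))
       + ((\<Sum>i\<in>UNIV. dis \<xi> E i y * G i y) - (\<Sum>i\<in>UNIV. dis \<xi>' E' i y * G i y))" for y
      by (simp add: sd dd left_diff_distrib sum_subtractf)
    then show "(\<integral>y. (\<Sum>i\<in>UNIV. \<Sum>j\<in>UNIV. sig (symgrad H) G i j y * symgrad H i j y) + (\<Sum>i\<in>UNIV. dis (symgrad H) G i y * G i y) \<partial>lebesgue_on (material S)) = 0"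
      using work_integrable[OF L(1) LH] work_integrable[OF L(2) LH] sig_test[OF L(1) eq(1) H] sig_test[OF L(2) eq(2) H]
        dis_test[OF L(1) eq(1) G] dis_test[OF L(2) eq(2) G] by simp
  qed
  then show ?thesis by eventually_elim (simp add: diff)
qed

end

section \<open>Superposition of the cell solutions and averaged fluxes\<close>

locale piezo_correctors = piezo_cell +
  fixes W :: "mode \<Rightarrow> R3 \<Rightarrow> R3" and P :: "mode \<Rightarrow> R3 \<Rightarrow> real"
  assumes W: "\<And>t i. (\<lambda>y. W t y $ i) \<in> H1_per S" and P: "\<And>t. P t \<in> H1_per S"
    and eq_mode: "\<And>t. equilibrium (\<lambda>k l y. mode_strain t k l + strain S (W t) k l y) (\<lambda>k y. mode_field t k + wderiv S k (P t) y)"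
begin

definition \<xi>_mode :: "mode \<Rightarrow> 3 \<Rightarrow> 3 \<Rightarrow> R3 \<Rightarrow> real" where
  "\<xi>_mode t k l y = mode_strain t k l + strain S (W t) k l y"

definition E_mode :: "mode \<Rightarrow> 3 \<Rightarrow> R3 \<Rightarrow> real" where
  "E_mode t k y = mode_field t k + wderiv S k (P t) y"

definition avg_sig :: "mode \<Rightarrow> 3 \<Rightarrow> 3 \<Rightarrow> real" where
  "avg_sig t i j = (\<integral>y. sig (\<xi>_mode t) (E_mode t) i j y \<partial>lebesgue_on (material S))"

definition avg_dis :: "mode \<Rightarrow> 3 \<Rightarrow> real" where
  "avg_dis t i = (\<integral>y. dis (\<xi>_mode t) (E_mode t) i y \<partial>lebesgue_on (material S))"

lemma equilibrium_mode: "equilibrium (\<xi>_mode t) (E_mode t)"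
  using eq_mode[of t] unfolding \<xi>_mode_def[abs_def] E_mode_def[abs_def] .

lemma per_grad_W: "per_grad S (\<lambda>k. wderiv S k (\<lambda>z. W t z $ i))"
  by (rule per_grad_wderiv[OF W])

lemma per_grad_P: "per_grad S (\<lambda>k. wderiv S k (P t))"
  by (rule per_grad_wderiv[OF P])

lemma const_L2: "(\<lambda>y. a) \<in> L2_on (material S)"
  by (rule L2_on_const[OF material_lmeasurable[OF openS]])

lemma L2_state_shift:
  assumes "\<And>i. per_grad S (H i)" "per_grad S G"
  shows "L2_state (\<lambda>k l y. \<xi>0 k l + symgrad H k l y) (\<lambda>k y. E0 k + G k y)"
  using L2_state_grad[OF assms] by (auto simp: L2_state_def intro!: L2_on_add const_L2)

lemma L2_state_mode: "L2_state (\<xi>_mode t) (E_mode t)"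
  unfolding \<xi>_mode_def[abs_def] E_mode_def[abs_def] strain_symgrad by (rule L2_state_shift[OF per_grad_W per_grad_P])

definition \<xi>_sum :: "(mode \<Rightarrow> real) \<Rightarrow> 3 \<Rightarrow> 3 \<Rightarrow> R3 \<Rightarrow> real" where
  "\<xi>_sum r k l y = (\<Sum>t\<in>UNIV. r t * \<xi>_mode t k l y)"

definition E_sum :: "(mode \<Rightarrow> real) \<Rightarrow> 3 \<Rightarrow> R3 \<Rightarrow> real" where
  "E_sum r k y = (\<Sum>t\<in>UNIV. r t * E_mode t k y)"

definition grad_W :: "(mode \<Rightarrow> real) \<Rightarrow> 3 \<Rightarrow> 3 \<Rightarrow> R3 \<Rightarrow> real" where
  "grad_W r i k y = (\<Sum>t\<in>UNIV. r t * wderiv S k (\<lambda>z. W t z $ i) y)"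

definition grad_P :: "(mode \<Rightarrow> real) \<Rightarrow> 3 \<Rightarrow> R3 \<Rightarrow> real" where
  "grad_P r k y = (\<Sum>t\<in>UNIV. r t * wderiv S k (P t) y)"

lemma per_grad_grad_W: "per_grad S (grad_W r i)"
  unfolding grad_W_def[abs_def] by (rule per_grad_sum[OF openS per_grad_W])

lemma per_grad_grad_P: "per_grad S (grad_P r)"
  unfolding grad_P_def[abs_def] by (rule per_grad_sum[OF openS per_grad_P])

lemma sig_sum: "sig (\<xi>_sum r) (E_sum r) i j y = (\<Sum>t\<in>UNIV. r t * sig (\<xi>_mode t) (E_mode t) i j y)"
  by (simp add: sig_def \<xi>_sum_def E_sum_def stress_sum)

lemma dis_sum: "dis (\<xi>_sum r) (E_sum r) i y = (\<Sum>t\<in>UNIV. r t * dis (\<xi>_mode t) (E_mode t) i y)"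
  by (simp add: dis_def \<xi>_sum_def E_sum_def elec_disp_sum)

text \<open>With the macroscopic strain and field as weights, the unit loads add up to these
  constants, and only a periodic gradient remains on top of them.\<close>

lemma \<xi>_sum_eq:
  assumes "\<And>k l. \<xi>0 k l = \<xi>0 l k"
  shows "\<xi>_sum (mode_coeff \<xi>0 E0) k l y = \<xi>0 k l + symgrad (grad_W (mode_coeff \<xi>0 E0)) k l y"
proof -
  have "(\<Sum>t\<in>UNIV. mode_coeff \<xi>0 E0 t * strain S (W t) k l y) = symgrad (grad_W (mode_coeff \<xi>0 E0)) k l y"
    by (simp add: strain_def symgrad_def grad_W_def sum.distrib[symmetric] sum_divide_distrib distrib_left)
  then show ?thesis
    using sum_mode_strain[of \<xi>0 E0 k l, OF assms] by (simp add: \<xi>_sum_def \<xi>_mode_def distrib_left sum.distrib)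
qed

lemma E_sum_eq: "E_sum (mode_coeff \<xi>0 E0) k y = E0 k + grad_P (mode_coeff \<xi>0 E0) k y"
  by (simp add: E_sum_def E_mode_def grad_P_def distrib_left sum.distrib sum_mode_field)

lemma L2_state_sum: "L2_state (\<xi>_sum r) (E_sum r)"
  using L2_state_mode unfolding L2_state_def \<xi>_sum_def[abs_def] E_sum_def[abs_def]
  by (auto intro!: L2_on_sum L2_on_cmult)

lemma equilibrium_sum: "equilibrium (\<xi>_sum r) (E_sum r)"
  unfolding equilibrium_def weak_neg_div_cell_def
proof (intro conjI allI ballI)
  fix v assume v: "v \<in> H1_per S"
  have L: "wderiv S i v \<in> L2_on (material S)" for i by (rule H1_per_wderiv(2)[OF openS v])
  have int: "integrable (lebesgue_on (material S)) (\<lambda>y. \<Sum>j\<in>UNIV. sig (\<xi>_mode t) (E_mode t) i j y * wderiv S j v y)" for t i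
    by (intro Bochner_Integration.integrable_sum L2_on_integrable_mult sig_L2 L2_state_mode L)
  fix i
  have "(\<Sum>j\<in>UNIV. sig (\<xi>_sum r) (E_sum r) i j y * wderiv S j v y)
     = (\<Sum>t\<in>UNIV. r t * (\<Sum>j\<in>UNIV. sig (\<xi>_mode t) (E_mode t) i j y * wderiv S j v y))" for y
    by (simp add: sig_sum sum_distrib_left sum_distrib_right mult.assoc) (rule sum.swap)
  then show "(\<integral>y. (\<Sum>j\<in>UNIV. sig (\<xi>_sum r) (E_sum r) i j y * wderiv S j v y) \<partial>lebesgue_on (material S)) = 0"
    using int equilibrium_mode v by (simp add: Bochner_Integration.integral_sum equilibrium_def weak_neg_div_cell_def)
next
  fix v assume v: "v \<in> H1_per S"
  have L: "wderiv S i v \<in> L2_on (material S)" for i by (rule H1_per_wderiv(2)[OF openS v])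
  have id: "integrable (lebesgue_on (material S)) (\<lambda>y. \<Sum>j\<in>UNIV. dis (\<xi>_mode t) (E_mode t) j y * wderiv S j v y)" for t
    by (intro Bochner_Integration.integrable_sum L2_on_integrable_mult dis_L2 L2_state_mode L)
  have "(\<Sum>j\<in>UNIV. dis (\<xi>_sum r) (E_sum r) j y * wderiv S j v y)
     = (\<Sum>t\<in>UNIV. r t * (\<Sum>j\<in>UNIV. dis (\<xi>_mode t) (E_mode t) j y * wderiv S j v y))" for y
    by (simp add: dis_sum sum_distrib_left sum_distrib_right mult.assoc) (rule sum.swap)
  then show "(\<integral>y. (\<Sum>j\<in>UNIV. dis (\<xi>_sum r) (E_sum r) j y * wderiv S j v y) \<partial>lebesgue_on (material S)) = 0"
    using id equilibrium_mode v by (simp add: Bochner_Integration.integral_sum equilibrium_def weak_neg_div_cell_def)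
qed

lemma L2_integrable: "f \<in> L2_on (material S) \<Longrightarrow> integrable (lebesgue_on (material S)) f"
  using L2_on_integrable_mult[OF _ const_L2[of 1]] by simp

lemma average_sum:
  "(\<integral>y. sig (\<xi>_sum r) (E_sum r) i j y \<partial>lebesgue_on (material S)) = (\<Sum>t\<in>UNIV. r t * avg_sig t i j)"
  "(\<integral>y. dis (\<xi>_sum r) (E_sum r) i y \<partial>lebesgue_on (material S)) = (\<Sum>t\<in>UNIV. r t * avg_dis t i)"
  using L2_integrable[OF sig_L2[OF L2_state_mode]] L2_integrable[OF dis_L2[OF L2_state_mode]]
  by (simp_all add: sig_sum dis_sum Bochner_Integration.integral_sum avg_sig_def avg_dis_def)

lemma average_flux:
  assumes sym: "\<And>k l. \<xi>0 k l = \<xi>0 l k" and H: "\<And>i. per_grad S (H i)" and G: "per_grad S G"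
    and eq: "equilibrium (\<lambda>k l y. \<xi>0 k l + symgrad H k l y) (\<lambda>k y. E0 k + G k y)"
  shows "(\<integral>y. sig (\<lambda>k l y. \<xi>0 k l + symgrad H k l y) (\<lambda>k y. E0 k + G k y) i j y \<partial>lebesgue_on (material S))
      = (\<Sum>t\<in>UNIV. mode_coeff \<xi>0 E0 t * avg_sig t i j)"
    and "(\<integral>y. dis (\<lambda>k l y. \<xi>0 k l + symgrad H k l y) (\<lambda>k y. E0 k + G k y) i y \<partial>lebesgue_on (material S))
      = (\<Sum>t\<in>UNIV. mode_coeff \<xi>0 E0 t * avg_dis t i)"
proof -
  let ?\<xi> = "\<lambda>k l y. \<xi>0 k l + symgrad H k l y" and ?E = "\<lambda>k y. E0 k + G k y"
  let ?r = "mode_coeff \<xi>0 E0"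
  \<comment> \<open>Both states have the same constant part, so their difference is the strain of
    this periodic gradient, as \<open>equilibrium_unique\<close> demands.\<close>
  have dH: "per_grad S (\<lambda>k y. 1 * H i k y + (- 1) * grad_W ?r i k y)" for i
    by (rule per_grad_lincomb[OF openS H per_grad_grad_W])
  have dG: "per_grad S (\<lambda>k y. 1 * G k y + (- 1) * grad_P ?r k y)"
    by (rule per_grad_lincomb[OF openS G per_grad_grad_P])
  have L: "L2_state ?\<xi> ?E" by (rule L2_state_shift[OF H G])
  have ae: "AE y in lebesgue_on (material S). (\<forall>k l. ?\<xi> k l y = \<xi>_sum ?r k l y) \<and> (\<forall>k. ?E k y = E_sum ?r k y)"
    by (rule equilibrium_unique[where H = "\<lambda>i k y. 1 * H i k y + (- 1) * grad_W ?r i k y", OF L L2_state_sum eq equilibrium_sum dH dG])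
       (simp_all add: \<xi>_sum_eq[of \<xi>0, OF sym] E_sum_eq symgrad_def field_simps)
  have "AE y in lebesgue_on (material S). sig ?\<xi> ?E i j y = sig (\<xi>_sum ?r) (E_sum ?r) i j y"
    using ae by eventually_elim (simp add: sig_def)
  then have "(\<integral>y. sig ?\<xi> ?E i j y \<partial>lebesgue_on (material S)) = (\<integral>y. sig (\<xi>_sum ?r) (E_sum ?r) i j y \<partial>lebesgue_on (material S))"
    by (rule integral_cong_AE[rotated 2]) (intro L2_on_measurable sig_L2 L L2_state_sum)+
  then show "(\<integral>y. sig ?\<xi> ?E i j y \<partial>lebesgue_on (material S)) = (\<Sum>t\<in>UNIV. ?r t * avg_sig t i j)"
    by (simp add: average_sum)
  have "AE y in lebesgue_on (material S). dis ?\<xi> ?E i y = dis (\<xi>_sum ?r) (E_sum ?r) i y"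
    using ae by eventually_elim (simp add: dis_def)
  then have "(\<integral>y. dis ?\<xi> ?E i y \<partial>lebesgue_on (material S)) = (\<integral>y. dis (\<xi>_sum ?r) (E_sum ?r) i y \<partial>lebesgue_on (material S))"
    by (rule integral_cong_AE[rotated 2]) (intro L2_on_measurable dis_L2 L L2_state_sum)+
  then show "(\<integral>y. dis ?\<xi> ?E i y \<partial>lebesgue_on (material S)) = (\<Sum>t\<in>UNIV. ?r t * avg_dis t i)"
    by (simp add: average_sum)
qed

text \<open>Fluxes in equilibrium do no work on periodic gradients, so only the constant unit load
  contributes and the work depends on averages alone (the Hill-Mandel relation).\<close>

lemma work_mode:
  assumes L: "L2_state \<xi> E" and eq: "equilibrium \<xi> E"
  shows "(\<integral>y. (\<Sum>i\<in>UNIV. \<Sum>j\<in>UNIV. sig \<xi> E i j y * \<xi>_mode t i j y) \<partial>lebesgue_on (material S))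
      = (\<Sum>i\<in>UNIV. \<Sum>j\<in>UNIV. (\<integral>y. sig \<xi> E i j y \<partial>lebesgue_on (material S)) * mode_strain t i j)"
    and "(\<integral>y. (\<Sum>i\<in>UNIV. dis \<xi> E i y * E_mode t i y) \<partial>lebesgue_on (material S))
      = (\<Sum>i\<in>UNIV. (\<integral>y. dis \<xi> E i y \<partial>lebesgue_on (material S)) * mode_field t i)"
proof -
  let ?H = "\<lambda>l k. wderiv S k (\<lambda>z. W t z $ l)"
  note s = L2_integrable[OF sig_L2[OF L]] and d = L2_integrable[OF dis_L2[OF L]]
  note w = work_integrable[OF L L2_state_grad[OF per_grad_W per_grad_P]]
  have "(\<Sum>i\<in>UNIV. \<Sum>j\<in>UNIV. sig \<xi> E i j y * \<xi>_mode t i j y)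
     = (\<Sum>i\<in>UNIV. \<Sum>j\<in>UNIV. sig \<xi> E i j y * mode_strain t i j) + (\<Sum>i\<in>UNIV. \<Sum>j\<in>UNIV. sig \<xi> E i j y * symgrad ?H i j y)" for y
    by (simp add: \<xi>_mode_def strain_symgrad distrib_left sum.distrib)
  then show "(\<integral>y. (\<Sum>i\<in>UNIV. \<Sum>j\<in>UNIV. sig \<xi> E i j y * \<xi>_mode t i j y) \<partial>lebesgue_on (material S))
      = (\<Sum>i\<in>UNIV. \<Sum>j\<in>UNIV. (\<integral>y. sig \<xi> E i j y \<partial>lebesgue_on (material S)) * mode_strain t i j)"
    using s w(1) sig_test[OF L eq per_grad_W] by (simp add: Bochner_Integration.integral_sum)
  have "(\<Sum>i\<in>UNIV. dis \<xi> E i y * E_mode t i y)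
     = (\<Sum>i\<in>UNIV. dis \<xi> E i y * mode_field t i) + (\<Sum>i\<in>UNIV. dis \<xi> E i y * wderiv S i (P t) y)" for y
    by (simp add: E_mode_def distrib_left sum.distrib)
  then show "(\<integral>y. (\<Sum>i\<in>UNIV. dis \<xi> E i y * E_mode t i y) \<partial>lebesgue_on (material S))
      = (\<Sum>i\<in>UNIV. (\<integral>y. dis \<xi> E i y \<partial>lebesgue_on (material S)) * mode_field t i)"
    using d w(2) dis_test[OF L eq per_grad_P] by (simp add: Bochner_Integration.integral_sum)
qed

text \<open>In the integrated reciprocity relation a strain mode has no constant field and a
  potential mode no constant strain, so one side vanishes. The other side is the averaged stress of
  the potential mode plus the averaged displacement of the strain mode. This is where the minus sign
  and the index order of \<open>e\<close> in the averaged displacement come from.\<close>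

lemma avg_reciprocity: "avg_dis (Inl (m, h)) n = - avg_sig (Inr n) m h"
proof -
  let ?s = "Inl (m, h) :: mode" and ?t = "Inr n :: mode"
  note L = L2_state_mode and q = equilibrium_mode
  note w = work_integrable[OF L L]
  have "(\<integral>y. (\<Sum>i\<in>UNIV. \<Sum>j\<in>UNIV. sig (\<xi>_mode ?s) (E_mode ?s) i j y * \<xi>_mode ?t i j y) + (\<Sum>i\<in>UNIV. dis (\<xi>_mode ?t) (E_mode ?t) i y * E_mode ?s i y) \<partial>lebesgue_on (material S))
    = (\<integral>y. (\<Sum>i\<in>UNIV. \<Sum>j\<in>UNIV. sig (\<xi>_mode ?t) (E_mode ?t) i j y * \<xi>_mode ?s i j y) + (\<Sum>i\<in>UNIV. dis (\<xi>_mode ?s) (E_mode ?s) i y * E_mode ?t i y) \<partial>lebesgue_on (material S))"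
    by (simp add: reciprocity[of "\<xi>_mode ?s"])
  then have "(\<Sum>i\<in>UNIV. \<Sum>j\<in>UNIV. avg_sig ?s i j * mode_strain ?t i j) + (\<Sum>i\<in>UNIV. avg_dis ?t i * mode_field ?s i)
    = (\<Sum>i\<in>UNIV. \<Sum>j\<in>UNIV. avg_sig ?t i j * mode_strain ?s i j) + (\<Sum>i\<in>UNIV. avg_dis ?s i * mode_field ?t i)"
    using w by (simp add: work_mode[OF L q] avg_sig_def avg_dis_def)
  moreover have "avg_sig ?t h m = avg_sig ?t m h" by (simp add: avg_sig_def sig_sym[of _ _ h m])
  ultimately show ?thesis
    by (simp add: mode_strain_def mode_field_def sum_tau' kdelta_def if_distrib[of "\<lambda>t. _ * t"] sum.delta cong: if_cong)
qed

lemma hom_energy: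
  fixes \<xi>0 :: "3 \<Rightarrow> 3 \<Rightarrow> real" and E0 :: "3 \<Rightarrow> real"
  assumes sym: "\<And>k l. \<xi>0 k l = \<xi>0 l k"
  defines "Q \<equiv> (\<Sum>i\<in>UNIV. \<Sum>j\<in>UNIV. (\<Sum>t\<in>UNIV. mode_coeff \<xi>0 E0 t * avg_sig t i j) * \<xi>0 i j)
     + (\<Sum>i\<in>UNIV. (\<Sum>t\<in>UNIV. mode_coeff \<xi>0 E0 t * avg_dis t i) * E0 i)"
  shows "0 \<le> Q" and "Q = 0 \<Longrightarrow> (\<forall>k l. \<xi>0 k l = 0) \<and> (\<forall>k. E0 k = 0)"
proof -
  let ?r = "mode_coeff \<xi>0 E0"
  let ?\<xi> = "\<xi>_sum ?r" and ?E = "E_sum ?r"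
  note L = L2_state_sum[of ?r] and q = equilibrium_sum[of ?r]
  note LG = L2_state_grad[OF per_grad_grad_W[of ?r] per_grad_grad_P[of ?r]]
  note s = L2_integrable[OF sig_L2[OF L]] and d = L2_integrable[OF dis_L2[OF L]] and w = work_integrable[OF L LG]
  \<comment> \<open>Splitting the second factor into constant and gradient isolates the terms with
    \<open>grad_W\<close> and \<open>grad_P\<close>, whose integrals vanish by equilibrium. What
    remains is the pairing of averages that defines \<open>Q\<close>.\<close>
  have "(\<Sum>i\<in>UNIV. \<Sum>j\<in>UNIV. sig ?\<xi> ?E i j y * ?\<xi> i j y) + (\<Sum>i\<in>UNIV. dis ?\<xi> ?E i y * ?E i y)
    = ((\<Sum>i\<in>UNIV. \<Sum>j\<in>UNIV. sig ?\<xi> ?E i j y * \<xi>0 i j) + (\<Sum>i\<in>UNIV. \<Sum>j\<in>UNIV. sig ?\<xi> ?E i j y * symgrad (grad_W ?r) i j y))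
     + ((\<Sum>i\<in>UNIV. dis ?\<xi> ?E i y * E0 i) + (\<Sum>i\<in>UNIV. dis ?\<xi> ?E i y * grad_P ?r i y))" for y
  proof -
    have "(\<Sum>i\<in>UNIV. \<Sum>j\<in>UNIV. sig ?\<xi> ?E i j y * ?\<xi> i j y) = (\<Sum>i\<in>UNIV. \<Sum>j\<in>UNIV. sig ?\<xi> ?E i j y * (\<xi>0 i j + symgrad (grad_W ?r) i j y))"
      by (intro sum.cong refl arg_cong2[where f = "(*)"] \<xi>_sum_eq sym)
    moreover have "(\<Sum>i\<in>UNIV. dis ?\<xi> ?E i y * ?E i y) = (\<Sum>i\<in>UNIV. dis ?\<xi> ?E i y * (E0 i + grad_P ?r i y))"
      by (intro sum.cong refl arg_cong2[where f = "(*)"] E_sum_eq)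
    ultimately show ?thesis by (simp add: distrib_left sum.distrib)
  qed
  then have Q: "Q = (\<integral>y. (\<Sum>i\<in>UNIV. \<Sum>j\<in>UNIV. sig ?\<xi> ?E i j y * ?\<xi> i j y) + (\<Sum>i\<in>UNIV. dis ?\<xi> ?E i y * ?E i y) \<partial>lebesgue_on (material S))"
    using s d w sig_test[OF L q per_grad_grad_W] dis_test[OF L q per_grad_grad_P]
    by (simp add: Bochner_Integration.integral_sum average_sum Q_def)
  have symS: "?\<xi> k l y = ?\<xi> l k y" for k l y
    using sym[of k l] by (simp add: \<xi>_sum_eq[of \<xi>0, OF sym] symgrad_def)
  show "0 \<le> Q"
    unfolding Q
  proof (rule Bochner_Integration.integral_nonneg)
    fix y
    have "0 \<le> \<alpha>\<^sub>c * (\<Sum>i\<in>UNIV. \<Sum>j\<in>UNIV. (?\<xi> i j y)\<^sup>2) + \<alpha>\<^sub>d * (\<Sum>i\<in>UNIV. (?E i y)\<^sup>2)"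
      using pos by (intro add_nonneg_nonneg mult_nonneg_nonneg sum_nonneg) auto
    then show "0 \<le> (\<Sum>i\<in>UNIV. \<Sum>j\<in>UNIV. sig ?\<xi> ?E i j y * ?\<xi> i j y) + (\<Sum>i\<in>UNIV. dis ?\<xi> ?E i y * ?E i y)"
      using energy_coercive[of ?\<xi> y ?E, OF symS] by linarith
  qed
  assume "Q = 0"
  then have ae: "AE y in lebesgue_on (material S). (\<forall>k l. ?\<xi> k l y = 0) \<and> (\<forall>k. ?E k y = 0)"
    unfolding Q by (rule zero_energy[OF L symS])
  have "AE y in lebesgue_on (material S). symgrad (grad_W ?r) k l y = - \<xi>0 k l" for k l
    using ae
  proof eventually_elim
    case (elim y)
    then have "?\<xi> k l y = 0" by blast
    then show ?case by (simp add: \<xi>_sum_eq[of \<xi>0, OF sym])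
  qed
  from symgrad_const_imp_0[OF S per_grad_grad_W this] have "\<xi>0 k l = 0" for k l by simp
  moreover have "AE y in lebesgue_on (material S). grad_P ?r k y = - E0 k" for k
    using ae
  proof eventually_elim
    case (elim y)
    then have "?E k y = 0" by blast
    then show ?case by (simp add: E_sum_eq)
  qed
  from per_grad_const_imp_0[OF S per_grad_grad_P this] have "E0 k = 0" for k by simp
  ultimately show "(\<forall>k l. \<xi>0 k l = 0) \<and> (\<forall>k. E0 k = 0)" by blast
qed

end

section \<open>The homogenized problem\<close>

lemma test_function_L2:
  assumes A: "open A" and f: "f \<in> test_functions A"
  shows "f \<in> L2_on A" "(\<integral>x. (f x)\<^sup>2 \<partial>lebesgue_on A) = (\<integral>x. (f x)\<^sup>2 \<partial>lebesgue)"
proof -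
  have "integrable lebesgue (\<lambda>x. (f x)\<^sup>2)"
    using test_functions_integrable[OF test_functions_mult[OF f test_functions_smooth[OF f]]] by (simp add: power2_eq_square)
  then have "integrable (lebesgue_on A) (\<lambda>x. (f x)\<^sup>2)"
    using A integrable_mult_indicator[of A lebesgue "\<lambda>x. (f x)\<^sup>2"] by (subst integrable_restrict_space) auto
  moreover have "f \<in> borel_measurable (lebesgue_on A)"
    using test_functions_integrable[OF f] by (intro measurable_restrict_space1) auto
  ultimately show "f \<in> L2_on A" by (simp add: L2_on_def)
  show "(\<integral>x. (f x)\<^sup>2 \<partial>lebesgue_on A) = (\<integral>x. (f x)\<^sup>2 \<partial>lebesgue)"
    using integral_lebesgue_on_test_function[OF A f, of f] by (simp add: power2_eq_square)
qed

lemma L2_sum_le: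
  assumes "f \<in> L2_on B" "g \<in> L2_on B"
  shows "(\<integral>x. (f x + g x)\<^sup>2 \<partial>lebesgue_on B) \<le> 2 * (\<integral>x. (f x)\<^sup>2 \<partial>lebesgue_on B) + 2 * (\<integral>x. (g x)\<^sup>2 \<partial>lebesgue_on B)"
  using L2_dist_triangle[OF assms(1) L2_on_zero L2_on_cmult[OF assms(2), of "- 1"]] by simp

lemma tendsto_0_squeeze:
  fixes a :: "nat \<Rightarrow> real"
  assumes "\<And>n. 0 \<le> a n" "\<And>n. a n \<le> 2 * b n + 2 * c n" "b \<longlonglongrightarrow> 0" "c \<longlonglongrightarrow> 0"
  shows "a \<longlonglongrightarrow> 0"
proof -
  have "(\<lambda>n. 2 * b n + 2 * c n) \<longlonglongrightarrow> 2 * 0 + 2 * 0" by (intro tendsto_intros assms)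
  then have l: "(\<lambda>n. 2 * b n + 2 * c n) \<longlonglongrightarrow> 0" by simp
  show ?thesis by (rule tendsto_sandwich[OF _ _ tendsto_const l]) (use assms(1,2) in auto)
qed

lemma H1_0_imp_H1: "v \<in> H1_0 A \<Longrightarrow> v \<in> H1 A"
  by (simp add: H1_0_def)

lemma H1_imp_L2: "v \<in> H1 A \<Longrightarrow> v \<in> L2_on A"
  by (simp add: H1_def)

text \<open>The approximating sequences are subtracted, and the limit of the gradients is kept as a
  difference of two chosen derivatives. In this way no representative of the derivative of
  \<open>v - w\<close> enters.\<close>

lemma H1_0_diff_approx:
  assumes A: "open A" and v: "v \<in> H1_0 A" and w: "w \<in> H1_0 A"
  obtains \<psi> where "\<And>n :: nat. \<psi> n \<in> test_functions A"
    "(\<lambda>n. \<integral>x. (\<psi> n x - (v x - w x))\<^sup>2 \<partial>lebesgue_on A) \<longlonglongrightarrow> 0"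
    "\<And>k. (\<lambda>n. \<integral>x. (pderiv_cl k (\<psi> n) x - (wderiv A k v x - wderiv A k w x))\<^sup>2 \<partial>lebesgue_on A) \<longlonglongrightarrow> 0"
proof -
  obtain a b where a: "\<And>n :: nat. a n \<in> test_functions A"
      "(\<lambda>n. \<integral>x. (a n x - v x)\<^sup>2 \<partial>lebesgue_on A) \<longlonglongrightarrow> 0"
      "\<And>k. (\<lambda>n. \<integral>x. (pderiv_cl k (a n) x - wderiv A k v x)\<^sup>2 \<partial>lebesgue_on A) \<longlonglongrightarrow> 0"
    and b: "\<And>n :: nat. b n \<in> test_functions A"
      "(\<lambda>n. \<integral>x. (b n x - w x)\<^sup>2 \<partial>lebesgue_on A) \<longlonglongrightarrow> 0"
      "\<And>k. (\<lambda>n. \<integral>x. (pderiv_cl k (b n) x - wderiv A k w x)\<^sup>2 \<partial>lebesgue_on A) \<longlonglongrightarrow> 0"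
    using v w unfolding H1_0_def by blast
  have le: "(\<integral>x. (f x - g x - (p x - q x))\<^sup>2 \<partial>lebesgue_on A) \<le> 2 * (\<integral>x. (f x - p x)\<^sup>2 \<partial>lebesgue_on A) + 2 * (\<integral>x. (g x - q x)\<^sup>2 \<partial>lebesgue_on A)"
    if "f \<in> L2_on A" "g \<in> L2_on A" "p \<in> L2_on A" "q \<in> L2_on A" for f g p q
  proof -
    have "(\<integral>x. ((f x - p x) + - 1 * (g x - q x))\<^sup>2 \<partial>lebesgue_on A)
      \<le> 2 * (\<integral>x. (f x - p x)\<^sup>2 \<partial>lebesgue_on A) + 2 * (\<integral>x. (- 1 * (g x - q x))\<^sup>2 \<partial>lebesgue_on A)"
      using that by (intro L2_sum_le L2_on_diff L2_on_cmult)
    then show ?thesis by (simp add: power2_eq_square algebra_simps)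
  qed
  note L = H1_imp_L2[OF H1_0_imp_H1[OF v]] H1_imp_L2[OF H1_0_imp_H1[OF w]]
  note D = H1_wderiv(2)[OF A H1_0_imp_H1[OF v]] H1_wderiv(2)[OF A H1_0_imp_H1[OF w]]
  show ?thesis
  proof (rule that[of "\<lambda>n x. a n x - b n x"])
    show "(\<lambda>x. a n x - b n x) \<in> test_functions A" for n by (rule test_functions_diff[OF a(1) b(1)])
    show "(\<lambda>n. \<integral>x. (a n x - b n x - (v x - w x))\<^sup>2 \<partial>lebesgue_on A) \<longlonglongrightarrow> 0"
      by (rule tendsto_0_squeeze[OF _ _ a(2) b(2)])
         (simp, rule le[OF test_function_L2(1)[OF A a(1)] test_function_L2(1)[OF A b(1)] L])
    show "(\<lambda>n. \<integral>x. (pderiv_cl k (\<lambda>x. a n x - b n x) x - (wderiv A k v x - wderiv A k w x))\<^sup>2 \<partial>lebesgue_on A) \<longlonglongrightarrow> 0" for k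
      unfolding pderiv_cl_diff[OF test_functions_smooth[OF a(1)] test_functions_smooth[OF b(1)]]
      by (rule tendsto_0_squeeze[OF _ _ a(3)[of k] b(3)[of k]])
         (simp, rule le[OF test_function_L2(1)[OF A test_functions_pderiv_cl[OF a(1)]] test_function_L2(1)[OF A test_functions_pderiv_cl[OF b(1)]] D])
  qed
qed

text \<open>The Poincare inequality is applied to the approximants: their derivatives in direction
  \<open>k\<close> tend to 0, so they tend to 0 themselves, while they also converge to
  \<open>r\<close>.\<close>

lemma poincare_limit:
  assumes A: "open A" "bounded A" and r: "r \<in> L2_on A" and \<psi>: "\<And>n :: nat. \<psi> n \<in> test_functions A"
    and lim: "(\<lambda>n. \<integral>x. (\<psi> n x - r x)\<^sup>2 \<partial>lebesgue_on A) \<longlonglongrightarrow> 0"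
    and lim': "(\<lambda>n. \<integral>x. (pderiv_cl k (\<psi> n) x)\<^sup>2 \<partial>lebesgue_on A) \<longlonglongrightarrow> 0"
  shows "AE x in lebesgue_on A. r x = 0"
proof -
  obtain R where R: "\<And>x. x \<in> A \<Longrightarrow> norm x \<le> R" using A(2) unfolding bounded_iff by blast
  have R': "\<bar>x $ k\<bar> \<le> R" if "x \<in> A" for x using R[OF that] component_le_norm_cart[of x k] by linarith
  have "(\<lambda>n. 4 * R\<^sup>2 * (\<integral>x. (pderiv_cl k (\<psi> n) x)\<^sup>2 \<partial>lebesgue_on A)) \<longlonglongrightarrow> 4 * R\<^sup>2 * 0"
    by (intro tendsto_intros lim')
  then have l: "(\<lambda>n. 4 * R\<^sup>2 * (\<integral>x. (pderiv_cl k (\<psi> n) x)\<^sup>2 \<partial>lebesgue_on A)) \<longlonglongrightarrow> 0" by simp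
  have p: "(\<integral>x. (\<psi> n x)\<^sup>2 \<partial>lebesgue_on A) \<le> 4 * R\<^sup>2 * (\<integral>x. (pderiv_cl k (\<psi> n) x)\<^sup>2 \<partial>lebesgue_on A)" for n
    using poincare[OF \<psi>[of n] R'] test_function_L2(2)[OF A(1) \<psi>] test_function_L2(2)[OF A(1) test_functions_pderiv_cl[OF \<psi>]] by simp
  have l2: "(\<lambda>n. \<integral>x. (\<psi> n x)\<^sup>2 \<partial>lebesgue_on A) \<longlonglongrightarrow> 0"
    by (rule tendsto_sandwich[OF _ _ tendsto_const l]) (use p in auto)
  have "(\<lambda>n :: nat. \<integral>x. (r x)\<^sup>2 \<partial>lebesgue_on A) \<longlonglongrightarrow> 0"
  proof (rule tendsto_0_squeeze[OF _ _ lim l2])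
    fix n
    have "(\<integral>x. (r x - 0)\<^sup>2 \<partial>lebesgue_on A) \<le> 2 * (\<integral>x. (r x - \<psi> n x)\<^sup>2 \<partial>lebesgue_on A) + 2 * (\<integral>x. (\<psi> n x - 0)\<^sup>2 \<partial>lebesgue_on A)"
      by (rule L2_dist_triangle[OF r test_function_L2(1)[OF A(1) \<psi>] L2_on_zero])
    then show "(\<integral>x. (r x)\<^sup>2 \<partial>lebesgue_on A) \<le> 2 * (\<integral>x. (\<psi> n x - r x)\<^sup>2 \<partial>lebesgue_on A) + 2 * (\<integral>x. (\<psi> n x)\<^sup>2 \<partial>lebesgue_on A)"
      by (simp add: power2_commute)
  qed simp
  then have "(\<integral>x. (r x)\<^sup>2 \<partial>lebesgue_on A) = 0" by (simp add: LIMSEQ_const_iff)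
  then have "AE x in lebesgue_on A. (r x)\<^sup>2 = 0"
    using integral_nonneg_eq_0_iff_AE[of "lebesgue_on A" "\<lambda>x. (r x)\<^sup>2"] r by (simp add: L2_on_def)
  then show ?thesis by eventually_elim simp
qed

lemma H1_0_gradient_unique:
  assumes A: "open A" "bounded A" and v: "v \<in> H1_0 A" and w: "w \<in> H1_0 A"
    and eq: "\<And>k. AE x in lebesgue_on A. wderiv A k v x = wderiv A k w x"
  shows "AE x in lebesgue_on A. v x = w x"
proof -
  obtain \<psi> where \<psi>: "\<And>n :: nat. \<psi> n \<in> test_functions A"
    "(\<lambda>n. \<integral>x. (\<psi> n x - (v x - w x))\<^sup>2 \<partial>lebesgue_on A) \<longlonglongrightarrow> 0"
    "\<And>k. (\<lambda>n. \<integral>x. (pderiv_cl k (\<psi> n) x - (wderiv A k v x - wderiv A k w x))\<^sup>2 \<partial>lebesgue_on A) \<longlonglongrightarrow> 0"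
    using H1_0_diff_approx[OF A(1) v w] by blast
  have r: "(\<lambda>x. v x - w x) \<in> L2_on A"
    using v w by (intro L2_on_diff H1_imp_L2 H1_0_imp_H1)
  have D: "(\<lambda>x. wderiv A 1 v x - wderiv A 1 w x) \<in> L2_on A"
    using v w by (intro L2_on_diff H1_wderiv(2)[OF A(1)] H1_0_imp_H1)
  have "(\<integral>x. (pderiv_cl 1 (\<psi> n) x - (wderiv A 1 v x - wderiv A 1 w x))\<^sup>2 \<partial>lebesgue_on A) = (\<integral>x. (pderiv_cl 1 (\<psi> n) x)\<^sup>2 \<partial>lebesgue_on A)" for n
  proof (rule integral_cong_AE)
    have T: "pderiv_cl 1 (\<psi> n) \<in> L2_on A" by (rule test_function_L2(1)[OF A(1) test_functions_pderiv_cl[OF \<psi>(1)]])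
    show "(\<lambda>x. (pderiv_cl 1 (\<psi> n) x - (wderiv A 1 v x - wderiv A 1 w x))\<^sup>2) \<in> borel_measurable (lebesgue_on A)"
      using L2_on_measurable[OF L2_on_diff[OF T D]] by (rule borel_measurable_power)
    show "(\<lambda>x. (pderiv_cl 1 (\<psi> n) x)\<^sup>2) \<in> borel_measurable (lebesgue_on A)"
      using L2_on_measurable[OF T] by (rule borel_measurable_power)
    show "AE x in lebesgue_on A. (pderiv_cl 1 (\<psi> n) x - (wderiv A 1 v x - wderiv A 1 w x))\<^sup>2 = (pderiv_cl 1 (\<psi> n) x)\<^sup>2"
      using eq[of 1] by eventually_elim simp
  qed
  with \<psi>(3)[of 1] have "(\<lambda>n. \<integral>x. (pderiv_cl 1 (\<psi> n) x)\<^sup>2 \<partial>lebesgue_on A) \<longlonglongrightarrow> 0" by simp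
  from poincare_limit[OF A r \<psi>(1,2) this] show ?thesis by eventually_elim simp
qed

text \<open>The approximants of the difference have strains that merely tend to 0. Korn's inequality
  for test functions turns this into convergence of their full gradients to 0, and the Poincare
  inequality concludes for each component.\<close>

lemma H1_0_strain_unique:
  fixes u v :: "R3 \<Rightarrow> R3"
  assumes A: "open A" "bounded A" and u: "\<And>i. (\<lambda>x. u x $ i) \<in> H1_0 A" and v: "\<And>i. (\<lambda>x. v x $ i) \<in> H1_0 A"
    and eq: "\<And>k l. AE x in lebesgue_on A. strain A u k l x = strain A v k l x"
  shows "AE x in lebesgue_on A. u x = v x"
proof -
  define g where "g k j x = wderiv A k (\<lambda>x. u x $ j) x - wderiv A k (\<lambda>x. v x $ j) x" for k j x
  define P where "P j \<psi> \<longleftrightarrow> (\<forall>n :: nat. \<psi> n \<in> test_functions A) \<and>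
    (\<lambda>n. \<integral>x. (\<psi> n x - (u x $ j - v x $ j))\<^sup>2 \<partial>lebesgue_on A) \<longlonglongrightarrow> 0 \<and>
    (\<forall>k. (\<lambda>n. \<integral>x. (pderiv_cl k (\<psi> n) x - g k j x)\<^sup>2 \<partial>lebesgue_on A) \<longlonglongrightarrow> 0)" for j \<psi>
  define \<psi> where "\<psi> j = (SOME \<psi>. P j \<psi>)" for j
  have "P j (\<psi> j)" for j
  proof -
    obtain \<zeta> where \<zeta>: "\<And>n :: nat. \<zeta> n \<in> test_functions A"
      "(\<lambda>n. \<integral>x. (\<zeta> n x - (u x $ j - v x $ j))\<^sup>2 \<partial>lebesgue_on A) \<longlonglongrightarrow> 0"
      "\<And>k. (\<lambda>n. \<integral>x. (pderiv_cl k (\<zeta> n) x - (wderiv A k (\<lambda>x. u x $ j) x - wderiv A k (\<lambda>x. v x $ j) x))\<^sup>2 \<partial>lebesgue_on A) \<longlonglongrightarrow> 0"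
      using H1_0_diff_approx[OF A(1) u[of j] v[of j]] by blast
    have "P j \<zeta>" unfolding P_def g_def using \<zeta> by simp
    then show ?thesis unfolding \<psi>_def by (rule someI[of "P j"])
  qed
  then have \<psi>: "\<psi> j n \<in> test_functions A"
    "(\<lambda>n. \<integral>x. (\<psi> j n x - (u x $ j - v x $ j))\<^sup>2 \<partial>lebesgue_on A) \<longlonglongrightarrow> 0"
    "(\<lambda>n. \<integral>x. (pderiv_cl k (\<psi> j n) x - g k j x)\<^sup>2 \<partial>lebesgue_on A) \<longlonglongrightarrow> 0" for j n k
    unfolding P_def by blast+
  have gL: "g k j \<in> L2_on A" for k j
    unfolding g_def[abs_def] using u v by (intro L2_on_diff H1_wderiv(2)[OF A(1)] H1_0_imp_H1)
  have dT: "pderiv_cl k (\<psi> j n) \<in> test_functions A" for k j n by (rule test_functions_pderiv_cl[OF \<psi>(1)])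
  note dL = test_function_L2(1)[OF A(1) dT]
  have sym0: "(\<lambda>n. \<integral>x. (pderiv_cl k (\<psi> j n) x + pderiv_cl j (\<psi> k n) x)\<^sup>2 \<partial>lebesgue_on A) \<longlonglongrightarrow> 0" for k j
  proof (rule tendsto_0_squeeze[OF _ _ \<psi>(3)[where j = j and k = k] \<psi>(3)[where j = k and k = j]])
    fix n
    \<comment> \<open>Equality of the strains says that the symmetric part of the limit gradient
      vanishes, so it may be inserted into the square without changing the integral.\<close>
    have "AE x in lebesgue_on A. g k j x + g j k x = 0"
      using eq[of k j] by eventually_elim (simp add: strain_def g_def)
    then have "AE x in lebesgue_on A. (pderiv_cl k (\<psi> j n) x + pderiv_cl j (\<psi> k n) x)\<^sup>2
       = ((pderiv_cl k (\<psi> j n) x - g k j x) + (pderiv_cl j (\<psi> k n) x - g j k x))\<^sup>2"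
    proof eventually_elim
      case (elim x)
      then have "pderiv_cl k (\<psi> j n) x + pderiv_cl j (\<psi> k n) x = (pderiv_cl k (\<psi> j n) x - g k j x) + (pderiv_cl j (\<psi> k n) x - g j k x)"
        by linarith
      then show ?case by (rule arg_cong)
    qed
    then have "(\<integral>x. (pderiv_cl k (\<psi> j n) x + pderiv_cl j (\<psi> k n) x)\<^sup>2 \<partial>lebesgue_on A)
       = (\<integral>x. ((pderiv_cl k (\<psi> j n) x - g k j x) + (pderiv_cl j (\<psi> k n) x - g j k x))\<^sup>2 \<partial>lebesgue_on A)"
      by (rule integral_cong_AE[rotated 2])
         (intro borel_measurable_power L2_on_measurable L2_on_add L2_on_diff dL gL)+
    also have "\<dots> \<le> 2 * (\<integral>x. (pderiv_cl k (\<psi> j n) x - g k j x)\<^sup>2 \<partial>lebesgue_on A) + 2 * (\<integral>x. (pderiv_cl j (\<psi> k n) x - g j k x)\<^sup>2 \<partial>lebesgue_on A)"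
      by (intro L2_sum_le L2_on_diff dL gL)
    finally show "(\<integral>x. (pderiv_cl k (\<psi> j n) x + pderiv_cl j (\<psi> k n) x)\<^sup>2 \<partial>lebesgue_on A)
      \<le> 2 * (\<integral>x. (pderiv_cl k (\<psi> j n) x - g k j x)\<^sup>2 \<partial>lebesgue_on A) + 2 * (\<integral>x. (pderiv_cl j (\<psi> k n) x - g j k x)\<^sup>2 \<partial>lebesgue_on A)" .
  qed simp
  \<comment> \<open>The direction 1 is an arbitrary choice; \<open>poincare_limit\<close> asks for
    smallness of the derivative in one direction.\<close>
  have le: "(\<integral>x. (pderiv_cl 1 (\<psi> j n) x)\<^sup>2 \<partial>lebesgue_on A)
     \<le> (\<Sum>k\<in>UNIV. \<Sum>l\<in>UNIV. \<integral>x. (pderiv_cl k (\<psi> l n) x + pderiv_cl l (\<psi> k n) x)\<^sup>2 \<partial>lebesgue_on A) / 2" for j n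
  proof -
    have i1: "integrable lebesgue (\<lambda>x. (pderiv_cl k (\<psi> l n) x)\<^sup>2)" for k l
      using test_functions_integrable[OF test_functions_mult[OF dT test_functions_smooth[OF dT]]] by (simp add: power2_eq_square)
    have T2: "(\<lambda>x. pderiv_cl k (\<psi> l n) x + pderiv_cl l (\<psi> k n) x) \<in> test_functions A" for k l
      using test_functions_diff[OF dT test_functions_mult[OF dT smooth_const[of "- 1"]], of k l n l k n] by simp
    have i2: "integrable lebesgue (\<lambda>x. (pderiv_cl k (\<psi> l n) x + pderiv_cl l (\<psi> k n) x)\<^sup>2)" for k l
      using test_functions_integrable[OF test_functions_mult[OF T2 test_functions_smooth[OF T2]]] by (simp add: power2_eq_square)
    have "(\<integral>x. (pderiv_cl 1 (\<psi> j n) x)\<^sup>2 \<partial>lebesgue) \<le> (\<integral>x. (\<Sum>k\<in>UNIV. \<Sum>l\<in>UNIV. (pderiv_cl k (\<psi> l n) x)\<^sup>2) \<partial>lebesgue)"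
    proof (rule integral_mono[OF i1])
      show "integrable lebesgue (\<lambda>x. \<Sum>k\<in>UNIV. \<Sum>l\<in>UNIV. (pderiv_cl k (\<psi> l n) x)\<^sup>2)"
        by (intro Bochner_Integration.integrable_sum i1)
      fix x
      have "(pderiv_cl 1 (\<psi> j n) x)\<^sup>2 \<le> (\<Sum>l\<in>UNIV. (pderiv_cl 1 (\<psi> l n) x)\<^sup>2)" by (rule member_le_sum) auto
      also have "\<dots> \<le> (\<Sum>k\<in>UNIV. \<Sum>l\<in>UNIV. (pderiv_cl k (\<psi> l n) x)\<^sup>2)"
        by (rule member_le_sum[of 1 UNIV "\<lambda>k. \<Sum>l\<in>UNIV. (pderiv_cl k (\<psi> l n) x)\<^sup>2"]) (auto intro: sum_nonneg)
      finally show "(pderiv_cl 1 (\<psi> j n) x)\<^sup>2 \<le> (\<Sum>k\<in>UNIV. \<Sum>l\<in>UNIV. (pderiv_cl k (\<psi> l n) x)\<^sup>2)" .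
    qed
    also have "\<dots> \<le> (\<integral>x. (\<Sum>k\<in>UNIV. \<Sum>l\<in>UNIV. (pderiv_cl k (\<psi> l n) x + pderiv_cl l (\<psi> k n) x)\<^sup>2) \<partial>lebesgue) / 2"
      by (rule korn_first[of "\<lambda>l. \<psi> l n", OF \<psi>(1)])
    also have "(\<integral>x. (\<Sum>k\<in>UNIV. \<Sum>l\<in>UNIV. (pderiv_cl k (\<psi> l n) x + pderiv_cl l (\<psi> k n) x)\<^sup>2) \<partial>lebesgue)
       = (\<Sum>k\<in>UNIV. \<Sum>l\<in>UNIV. \<integral>x. (pderiv_cl k (\<psi> l n) x + pderiv_cl l (\<psi> k n) x)\<^sup>2 \<partial>lebesgue)"
      using i2 by (simp add: Bochner_Integration.integral_sum)
    finally show ?thesis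
      by (simp only: test_function_L2(2)[OF A(1) dT] test_function_L2(2)[OF A(1) T2])
  qed
  have "AE x in lebesgue_on A. u x $ j - v x $ j = 0" for j
  proof (rule poincare_limit[OF A _ \<psi>(1,2)])
    show "(\<lambda>x. u x $ j - v x $ j) \<in> L2_on A" by (intro L2_on_diff H1_imp_L2 H1_0_imp_H1 u v)
    have "(\<lambda>n. (\<Sum>k\<in>UNIV. \<Sum>l\<in>UNIV. \<integral>x. (pderiv_cl k (\<psi> l n) x + pderiv_cl l (\<psi> k n) x)\<^sup>2 \<partial>lebesgue_on A) / 2)
       \<longlonglongrightarrow> (\<Sum>k\<in>(UNIV :: 3 set). \<Sum>l\<in>(UNIV :: 3 set). 0) / 2"
      by (intro tendsto_divide tendsto_sum sym0 tendsto_const) simp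
    then have l: "(\<lambda>n. (\<Sum>k\<in>UNIV. \<Sum>l\<in>UNIV. \<integral>x. (pderiv_cl k (\<psi> l n) x + pderiv_cl l (\<psi> k n) x)\<^sup>2 \<partial>lebesgue_on A) / 2) \<longlonglongrightarrow> 0" by simp
    show "(\<lambda>n. \<integral>x. (pderiv_cl 1 (\<psi> j n) x)\<^sup>2 \<partial>lebesgue_on A) \<longlonglongrightarrow> 0"
      by (rule tendsto_sandwich[OF _ _ tendsto_const l]) (use le in auto)
  qed
  then have "AE x in lebesgue_on A. \<forall>j. u x $ j - v x $ j = 0" by (simp add: eventually_all_finite)
  then show ?thesis by eventually_elim (simp add: vec_eq_iff)
qed

section \<open>Identification of the averaged two-scale fluxes\<close>

lemma strain_L2:
  assumes A: "open A" and u: "\<And>i. (\<lambda>x. u x $ i) \<in> H1 A"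
  shows "strain A u k l \<in> L2_on A"
  using L2_on_cmult[OF L2_on_add[OF H1_wderiv(2)[OF A u, of k l] H1_wderiv(2)[OF A u, of l k]], of "1 / 2"]
  by (simp add: strain_def[abs_def])

lemma two_scale_flux:
  assumes \<Omega>: "open \<Omega>" "\<Omega> \<in> lmeasurable" and S: "open S" and co: "piezo_coefficients \<Omega> c e d \<alpha>\<^sub>c \<alpha>\<^sub>d"
    and u: "\<And>i. (\<lambda>x. u x $ i) \<in> H1 \<Omega>" and p: "\<phi> \<in> H1 \<Omega>"
    and u1: "\<And>i. (\<lambda>x y. u1 x y $ i) \<in> L2_H1_per \<Omega> S" and p1: "\<phi>1 \<in> L2_H1_per \<Omega> S"
  shows "square_integrable_flux \<Omega> (material S) (\<lambda>x y. stress c e x y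
      (\<lambda>k l. strain \<Omega> u k l x + strain S (u1 x) k l y) (\<lambda>k. wderiv \<Omega> k \<phi> x + wderiv S k (\<phi>1 x) y) i j)" (is ?A)
    and "square_integrable_flux \<Omega> (material S) (\<lambda>x y. elec_disp e d x y
      (\<lambda>k l. strain \<Omega> u k l x + strain S (u1 x) k l y) (\<lambda>k. wderiv \<Omega> k \<phi> x + wderiv S k (\<phi>1 x) y) i)" (is ?B)
proof -
  note M = material_lmeasurable[OF S] and \<Omega>s = fmeasurableD[OF \<Omega>(2)]
  have c: "c i j k l \<in> Linf_C_per \<Omega>" and e: "e i j k \<in> Linf_C_per \<Omega>" and d: "d i j \<in> Linf_C_per \<Omega>" for i j k l
    using co by (auto simp: piezo_coefficients_def)
  \<comment> \<open>The factors 1 and 1 / 2 only bring the strain into the shape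
    \<open>p * F + q * G\<close> of the combination rule.\<close>
  have "admissible \<Omega> (material S) (\<lambda>x y. 1 * strain \<Omega> u k l x + 1 *
      (1 / 2 * wderiv S k (\<lambda>z. u1 x z $ l) y + 1 / 2 * wderiv S l (\<lambda>z. u1 x z $ k) y))" for k l
    by (intro admissible_lincomb admissible_const[OF M] strain_L2[OF \<Omega>(1)] u \<Omega>s admissible_wderiv[OF S \<Omega>s u1])
  then have \<xi>: "admissible \<Omega> (material S) (\<lambda>x y. strain \<Omega> u k l x + strain S (u1 x) k l y)" for k l
    by (simp add: strain_def[of S] add_divide_distrib)
  have "admissible \<Omega> (material S) (\<lambda>x y. 1 * wderiv \<Omega> k \<phi> x + 1 * wderiv S k (\<phi>1 x) y)" for k
    by (intro admissible_lincomb admissible_const[OF M] H1_wderiv(2)[OF \<Omega>(1)] p \<Omega>s admissible_wderiv[OF S \<Omega>s p1])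
  then have E: "admissible \<Omega> (material S) (\<lambda>x y. wderiv \<Omega> k \<phi> x + wderiv S k (\<phi>1 x) y)" for k by simp
  note f = square_integrable_flux_coef[OF \<xi> _ \<Omega>(2)] square_integrable_flux_coef[OF E _ \<Omega>(2)]
  let ?\<xi> = "\<lambda>x y k l. strain \<Omega> u k l x + strain S (u1 x) k l y" and ?E = "\<lambda>x y k. wderiv \<Omega> k \<phi> x + wderiv S k (\<phi>1 x) y"
  have "square_integrable_flux \<Omega> (material S) (\<lambda>x y. 1 * (\<Sum>k\<in>UNIV. \<Sum>l\<in>UNIV. apply_bcontfun (c i j k l x) y * ?\<xi> x y k l)
     + 1 * (\<Sum>k\<in>UNIV. apply_bcontfun (e k i j x) y * ?E x y k))"
    by (intro square_integrable_flux_add square_integrable_flux_sum f c e \<Omega>s)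
  then show ?A by (simp add: stress_def)
  have "square_integrable_flux \<Omega> (material S) (\<lambda>x y. (- 1) * (\<Sum>k\<in>UNIV. \<Sum>l\<in>UNIV. apply_bcontfun (e i k l x) y * ?\<xi> x y k l)
     + 1 * (\<Sum>j\<in>UNIV. apply_bcontfun (d i j x) y * ?E x y j))"
    by (intro square_integrable_flux_add square_integrable_flux_sum f d e \<Omega>s)
  then show ?B by (simp add: elec_disp_def)
qed

lemma weak_neg_div_AE:
  assumes \<Omega>: "open \<Omega>" and w: "weak_neg_div \<Omega> F g" and eq: "\<And>i. AE x in lebesgue_on \<Omega>. F i x = F' i x"
  shows "weak_neg_div \<Omega> F' g"
proof -
  have \<Omega>s: "\<Omega> \<in> sets lebesgue" using \<Omega> by auto
  have F: "F i \<in> L2_on \<Omega>" for i using w by (simp add: weak_neg_div_def)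
  have F': "F' i \<in> L2_on \<Omega>" for i by (rule L2_on_AE[OF \<Omega>s F eq])
  have all: "AE x in lebesgue_on \<Omega>. \<forall>i. F i x = F' i x" using eq by (simp add: eventually_all_finite)
  have "(\<integral>x. (\<Sum>i\<in>UNIV. F' i x * wderiv \<Omega> i v x) \<partial>lebesgue_on \<Omega>) = (\<integral>x. g x * v x \<partial>lebesgue_on \<Omega>)" if v: "v \<in> H1_0 \<Omega>" for v
  proof -
    note D = H1_wderiv(2)[OF \<Omega> H1_0_imp_H1[OF v]]
    have "AE x in lebesgue_on \<Omega>. (\<Sum>i\<in>UNIV. F' i x * wderiv \<Omega> i v x) = (\<Sum>i\<in>UNIV. F i x * wderiv \<Omega> i v x)"
      using all by eventually_elim simp
    then have "(\<integral>x. (\<Sum>i\<in>UNIV. F' i x * wderiv \<Omega> i v x) \<partial>lebesgue_on \<Omega>) = (\<integral>x. (\<Sum>i\<in>UNIV. F i x * wderiv \<Omega> i v x) \<partial>lebesgue_on \<Omega>)"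
      by (rule integral_cong_AE[rotated 2])
         (intro borel_measurable_sum borel_measurable_times L2_on_measurable F F' D)+
    then show ?thesis using w v by (simp add: weak_neg_div_def)
  qed
  then show ?thesis using F' by (simp add: weak_neg_div_def)
qed

definition corrector :: "(3 \<Rightarrow> 3 \<Rightarrow> R3 \<Rightarrow> 'a) \<Rightarrow> (3 \<Rightarrow> R3 \<Rightarrow> 'a) \<Rightarrow> R3 \<Rightarrow> mode \<Rightarrow> 'a" where
  "corrector w q x t = (case t of Inl (m, h) \<Rightarrow> w m h x | Inr n \<Rightarrow> q n x)"

lemma piezo_correctorsI:
  assumes cell: "piezo_cell S c e d \<alpha>\<^sub>c \<alpha>\<^sub>d x"
    and w: "\<And>m h. strain_cell_solution S c e d x m h (w m h x) (p m h x)"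
    and q: "\<And>n. potential_cell_solution S c e d x n (q n x) (\<psi> n x)"
  shows "piezo_correctors S c e d \<alpha>\<^sub>c \<alpha>\<^sub>d x (corrector w q x) (corrector p \<psi> x)"
proof -
  interpret piezo_cell S c e d \<alpha>\<^sub>c \<alpha>\<^sub>d x by (rule cell)
  show ?thesis
  proof unfold_locales
    fix t :: mode and i :: 3
    show "(\<lambda>y. corrector w q x t y $ i) \<in> H1_per S"
      using w q by (auto simp: corrector_def strain_cell_solution_def potential_cell_solution_def split: sum.split prod.split)
    show "corrector p \<psi> x t \<in> H1_per S"
      using w q by (auto simp: corrector_def strain_cell_solution_def potential_cell_solution_def split: sum.split prod.split)
    show "equilibrium (\<lambda>k l y. mode_strain t k l + strain S (corrector w q x t) k l y) (\<lambda>k y. mode_field t k + wderiv S k (corrector p \<psi> x t) y)"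
    proof (cases t)
      case (Inl a)
      obtain m h where a: "a = (m, h)" by (cases a) auto
      have "equilibrium (\<lambda>k l y. tau m h k l + strain S (w m h x) k l y) (\<lambda>k. wderiv S k (p m h x))"
        using w[of m h] by (simp add: equilibrium_def strain_cell_solution_def sig_def[abs_def] dis_def[abs_def])
      then show ?thesis by (simp add: Inl a corrector_def mode_strain_def mode_field_def)
    next
      case (Inr n)
      have "equilibrium (\<lambda>k l. strain S (q n x) k l) (\<lambda>k y. kdelta k n + wderiv S k (\<psi> n x) y)"
        using q[of n] by (simp add: equilibrium_def potential_cell_solution_def sig_def[abs_def] dis_def[abs_def])
      then show ?thesis by (simp add: Inr corrector_def mode_strain_def mode_field_def)
    qed
  qed
qed

text \<open>The averaged fluxes of the modes are the homogenized coefficients by definition, with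
  one exception: the averaged displacement of a strain mode is computed from a different cell
  problem than \<open>hom_e\<close>. Reciprocity identifies it with \<open>- hom_e\<close>.\<close>

lemma homogenized_laws:
  assumes "piezo_correctors S c e d \<alpha>\<^sub>c \<alpha>\<^sub>d x (corrector w q x) (corrector p \<psi> x)"
  shows "hom_stress \<Omega> (hom_c S c e w p) (hom_e S c e q \<psi>) u \<phi> i j x
      = (\<Sum>t\<in>UNIV. mode_coeff (\<lambda>k l. strain \<Omega> u k l x) (\<lambda>k. wderiv \<Omega> k \<phi> x) t
          * piezo_correctors.avg_sig S c e x (corrector w q x) (corrector p \<psi> x) t i j)"
    and "hom_elec_disp \<Omega> (hom_e S c e q \<psi>) (hom_d S e d q \<psi>) u \<phi> i x
      = (\<Sum>t\<in>UNIV. mode_coeff (\<lambda>k l. strain \<Omega> u k l x) (\<lambda>k. wderiv \<Omega> k \<phi> x) t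
          * piezo_correctors.avg_dis S e d x (corrector w q x) (corrector p \<psi> x) t i)"
proof -
  interpret piezo_correctors S c e d \<alpha>\<^sub>c \<alpha>\<^sub>d x "corrector w q x" "corrector p \<psi> x" by (rule assms)
  have 1: "avg_sig (Inl (m, h)) i j = hom_c S c e w p i j m h x" for m h i j
    by (simp add: avg_sig_def sig_def hom_c_def \<xi>_mode_def E_mode_def mode_strain_def mode_field_def corrector_def)
  have 2: "avg_sig (Inr n) i j = hom_e S c e q \<psi> n i j x" for n i j
    by (simp add: avg_sig_def sig_def hom_e_def \<xi>_mode_def E_mode_def mode_strain_def mode_field_def corrector_def)
  have 3: "avg_dis (Inr n) i = hom_d S e d q \<psi> i n x" for n i
    by (simp add: avg_dis_def dis_def hom_d_def \<xi>_mode_def E_mode_def mode_strain_def mode_field_def corrector_def)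
  show "hom_stress \<Omega> (hom_c S c e w p) (hom_e S c e q \<psi>) u \<phi> i j x
      = (\<Sum>t\<in>UNIV. mode_coeff (\<lambda>k l. strain \<Omega> u k l x) (\<lambda>k. wderiv \<Omega> k \<phi> x) t * avg_sig t i j)"
    by (simp add: hom_stress_def sum_mode mode_coeff_def 1 2 mult.commute)
  show "hom_elec_disp \<Omega> (hom_e S c e q \<psi>) (hom_d S e d q \<psi>) u \<phi> i x
      = (\<Sum>t\<in>UNIV. mode_coeff (\<lambda>k l. strain \<Omega> u k l x) (\<lambda>k. wderiv \<Omega> k \<phi> x) t * avg_dis t i)"
    by (simp add: hom_elec_disp_def sum_mode mode_coeff_def avg_reciprocity 2 3 mult.commute sum_negf)
qed

lemma strain_commute: "strain A u k l x = strain A u l k x"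
  by (simp add: strain_def add.commute)

text \<open>The indices \<open>j i\<close> and \<open>i j\<close> differ on purpose: the two-scale
  equations differentiate along the second stress index, the homogenized problem along the first.
  Symmetry of the stress reconciles the two conventions.\<close>

lemma average_flux_eq_homogenized:
  assumes cor: "piezo_correctors S c e d \<alpha>\<^sub>c \<alpha>\<^sub>d x (corrector w q x) (corrector p \<psi> x)"
    and u1: "\<And>i. (\<lambda>y. v y $ i) \<in> H1_per S" and p1: "\<pi> \<in> H1_per S"
    and s: "\<And>i. weak_neg_div_cell S (\<lambda>j y. stress c e x y (\<lambda>k l. strain \<Omega> u k l x + strain S v k l y) (\<lambda>k. wderiv \<Omega> k \<phi> x + wderiv S k \<pi> y) i j)"
    and d: "weak_neg_div_cell S (\<lambda>i y. elec_disp e d x y (\<lambda>k l. strain \<Omega> u k l x + strain S v k l y) (\<lambda>k. wderiv \<Omega> k \<phi> x + wderiv S k \<pi> y) i)"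
  shows "(\<integral>y. stress c e x y (\<lambda>k l. strain \<Omega> u k l x + strain S v k l y) (\<lambda>k. wderiv \<Omega> k \<phi> x + wderiv S k \<pi> y) j i \<partial>lebesgue_on (material S))
      = hom_stress \<Omega> (hom_c S c e w p) (hom_e S c e q \<psi>) u \<phi> i j x"
    and "(\<integral>y. elec_disp e d x y (\<lambda>k l. strain \<Omega> u k l x + strain S v k l y) (\<lambda>k. wderiv \<Omega> k \<phi> x + wderiv S k \<pi> y) i \<partial>lebesgue_on (material S))
      = hom_elec_disp \<Omega> (hom_e S c e q \<psi>) (hom_d S e d q \<psi>) u \<phi> i x"
proof -
  interpret piezo_correctors S c e d \<alpha>\<^sub>c \<alpha>\<^sub>d x "corrector w q x" "corrector p \<psi> x" by (rule cor)
  let ?H = "\<lambda>l k. wderiv S k (\<lambda>z. v z $ l)"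
  have H: "per_grad S (?H l)" for l by (rule per_grad_wderiv[OF u1])
  have G: "per_grad S (\<lambda>k. wderiv S k \<pi>)" by (rule per_grad_wderiv[OF p1])
  have eq: "equilibrium (\<lambda>k l y. strain \<Omega> u k l x + symgrad ?H k l y) (\<lambda>k y. wderiv \<Omega> k \<phi> x + wderiv S k \<pi> y)"
    using s d by (simp add: equilibrium_def sig_def[abs_def] dis_def[abs_def] strain_symgrad[of S])
  note av = average_flux[of "\<lambda>k l. strain \<Omega> u k l x", OF strain_commute H G eq]
  have "(\<integral>y. stress c e x y (\<lambda>k l. strain \<Omega> u k l x + strain S v k l y) (\<lambda>k. wderiv \<Omega> k \<phi> x + wderiv S k \<pi> y) j i \<partial>lebesgue_on (material S))
     = (\<integral>y. sig (\<lambda>k l y. strain \<Omega> u k l x + symgrad ?H k l y) (\<lambda>k y. wderiv \<Omega> k \<phi> x + wderiv S k \<pi> y) i j y \<partial>lebesgue_on (material S))"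
    by (subst sig_sym) (simp add: sig_def[abs_def] strain_symgrad[of S])
  then show "(\<integral>y. stress c e x y (\<lambda>k l. strain \<Omega> u k l x + strain S v k l y) (\<lambda>k. wderiv \<Omega> k \<phi> x + wderiv S k \<pi> y) j i \<partial>lebesgue_on (material S))
      = hom_stress \<Omega> (hom_c S c e w p) (hom_e S c e q \<psi>) u \<phi> i j x"
    by (simp add: av(1) homogenized_laws[OF cor])
  show "(\<integral>y. elec_disp e d x y (\<lambda>k l. strain \<Omega> u k l x + strain S v k l y) (\<lambda>k. wderiv \<Omega> k \<phi> x + wderiv S k \<pi> y) i \<partial>lebesgue_on (material S))
      = hom_elec_disp \<Omega> (hom_e S c e q \<psi>) (hom_d S e d q \<psi>) u \<phi> i x"
    using av(2)[of i] by (simp add: homogenized_laws[OF cor] dis_def strain_symgrad[of S])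
qed

text \<open>The homogenized laws are linear in strain and field, so the flux difference belongs to
  the difference of the states and \<open>Q\<close> is the homogenized energy of that
  difference.\<close>

lemma homogenized_difference_energy:
  fixes \<Omega> :: "R3 set" and u u' :: "R3 \<Rightarrow> R3" and \<phi> \<phi>' :: "R3 \<Rightarrow> real"
  assumes cor: "piezo_correctors S c e d \<alpha>\<^sub>c \<alpha>\<^sub>d x (corrector w q x) (corrector p \<psi> x)"
  defines "\<sigma> \<equiv> hom_stress \<Omega> (hom_c S c e w p) (hom_e S c e q \<psi>)" and "D \<equiv> hom_elec_disp \<Omega> (hom_e S c e q \<psi>) (hom_d S e d q \<psi>)"
  defines "Q \<equiv> (\<Sum>i\<in>UNIV. \<Sum>j\<in>UNIV. (\<sigma> u' \<phi>' i j x - \<sigma> u \<phi> i j x) * (strain \<Omega> u' i j x - strain \<Omega> u i j x))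
    + (\<Sum>i\<in>UNIV. (D u' \<phi>' i x - D u \<phi> i x) * (wderiv \<Omega> i \<phi>' x - wderiv \<Omega> i \<phi> x))"
  shows "0 \<le> Q" and "Q = 0 \<Longrightarrow> (\<forall>k l. strain \<Omega> u' k l x = strain \<Omega> u k l x) \<and> (\<forall>k. wderiv \<Omega> k \<phi>' x = wderiv \<Omega> k \<phi> x)"
    and "\<sigma> u \<phi> i j x = \<sigma> u \<phi> j i x"
proof -
  interpret piezo_correctors S c e d \<alpha>\<^sub>c \<alpha>\<^sub>d x "corrector w q x" "corrector p \<psi> x" by (rule cor)
  let ?\<xi> = "\<lambda>k l. strain \<Omega> u' k l x - strain \<Omega> u k l x" and ?E = "\<lambda>k. wderiv \<Omega> k \<phi>' x - wderiv \<Omega> k \<phi> x"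
  have mc: "mode_coeff ?\<xi> ?E t = mode_coeff (\<lambda>k l. strain \<Omega> u' k l x) (\<lambda>k. wderiv \<Omega> k \<phi>' x) t - mode_coeff (\<lambda>k l. strain \<Omega> u k l x) (\<lambda>k. wderiv \<Omega> k \<phi> x) t" for t
    by (simp add: mode_coeff_def split: sum.split prod.split)
  have Q: "Q = (\<Sum>i\<in>UNIV. \<Sum>j\<in>UNIV. (\<Sum>t\<in>UNIV. mode_coeff ?\<xi> ?E t * avg_sig t i j) * ?\<xi> i j)
     + (\<Sum>i\<in>UNIV. (\<Sum>t\<in>UNIV. mode_coeff ?\<xi> ?E t * avg_dis t i) * ?E i)"
    by (simp add: Q_def \<sigma>_def D_def homogenized_laws[OF cor] mc left_diff_distrib[of "mode_coeff _ _ _"] sum_subtractf)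
  have sym: "?\<xi> k l = ?\<xi> l k" for k l by (simp add: strain_commute[of _ _ k l])
  show "0 \<le> Q" unfolding Q by (rule hom_energy(1)[OF sym])
  show "(\<forall>k l. strain \<Omega> u' k l x = strain \<Omega> u k l x) \<and> (\<forall>k. wderiv \<Omega> k \<phi>' x = wderiv \<Omega> k \<phi> x)" if "Q = 0"
    using hom_energy(2)[of ?\<xi> ?E, OF sym] that unfolding Q by simp
  have "avg_sig t i j = avg_sig t j i" for t by (simp add: avg_sig_def sig_sym[of _ _ i j])
  then show "\<sigma> u \<phi> i j x = \<sigma> u \<phi> j i x" by (simp add: \<sigma>_def homogenized_laws[OF cor])
qed

theorem mainTheorem2:
  fixes \<Omega> S :: "R3 set"
    and c :: "3 \<Rightarrow> 3 \<Rightarrow> 3 \<Rightarrow> 3 \<Rightarrow> coef" and e :: "3 \<Rightarrow> 3 \<Rightarrow> 3 \<Rightarrow> coef" and d :: "3 \<Rightarrow> 3 \<Rightarrow> coef"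
    and \<alpha>\<^sub>c \<alpha>\<^sub>d :: real
    and f u :: "R3 \<Rightarrow> R3" and u\<^sub>1 :: "R3 \<Rightarrow> R3 \<Rightarrow> R3"
    and \<phi> :: "R3 \<Rightarrow> real" and \<phi>\<^sub>1 :: "R3 \<Rightarrow> R3 \<Rightarrow> real"
    and w :: "3 \<Rightarrow> 3 \<Rightarrow> R3 \<Rightarrow> R3 \<Rightarrow> R3" and p :: "3 \<Rightarrow> 3 \<Rightarrow> R3 \<Rightarrow> R3 \<Rightarrow> real"
    and q :: "3 \<Rightarrow> R3 \<Rightarrow> R3 \<Rightarrow> R3" and \<psi> :: "3 \<Rightarrow> R3 \<Rightarrow> R3 \<Rightarrow> real"
  defines "\<theta> \<equiv> measure lebesgue (material S)"
    and "cH \<equiv> hom_c S c e w p"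
    and "eH \<equiv> hom_e S c e q \<psi>"
    and "dH \<equiv> hom_d S e d q \<psi>"
  assumes domain: "open \<Omega>" "connected \<Omega>" "bounded \<Omega>" "\<Omega> \<noteq> {}"
    and material: "periodic_material_set S"
    and coefficients: "piezo_coefficients \<Omega> c e d \<alpha>\<^sub>c \<alpha>\<^sub>d"
    and force: "\<forall>i. (\<lambda>x. f x $ i) \<in> L2_on \<Omega>"
    and cell_w: "\<forall>m h. AE x in lebesgue_on \<Omega>.
                   strain_cell_solution S c e d x m h (w m h x) (p m h x)"
    and cell_q: "\<forall>n. AE x in lebesgue_on \<Omega>.
                   potential_cell_solution S c e d x n (q n x) (\<psi> n x)"
    and two_scale: "two_scale_solution \<Omega> S c e d f u u\<^sub>1 \<phi> \<phi>\<^sub>1"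
  shows "homogenized_solution \<Omega> \<theta> f cH eH dH u \<phi> \<and>
         (\<forall>u' \<phi>'. homogenized_solution \<Omega> \<theta> f cH eH dH u' \<phi>' \<longrightarrow>
            (AE x in lebesgue_on \<Omega>. u' x = u x \<and> \<phi>' x = \<phi> x))"
proof -
  let ?M = "lebesgue_on (material S)"
  have \<Omega>: "open \<Omega>" "bounded \<Omega>" by fact+
  have \<Omega>m: "\<Omega> \<in> lmeasurable" using \<Omega> by (simp add: lmeasurable_open)
  have S: "open S" using material by (simp add: periodic_material_set_def smooth_open_set_def)
  have pos: "\<alpha>\<^sub>c > 0" "\<alpha>\<^sub>d > 0" using coefficients by (auto simp: piezo_coefficients_def)
  let ?\<sigma> = "\<lambda>i j x y. stress c e x y (\<lambda>k l. strain \<Omega> u k l x + strain S (u\<^sub>1 x) k l y) (\<lambda>k. wderiv \<Omega> k \<phi> x + wderiv S k (\<phi>\<^sub>1 x) y) i j"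
  let ?D = "\<lambda>i x y. elec_disp e d x y (\<lambda>k l. strain \<Omega> u k l x + strain S (u\<^sub>1 x) k l y) (\<lambda>k. wderiv \<Omega> k \<phi> x + wderiv S k (\<phi>\<^sub>1 x) y) i"
  have u: "\<And>i. (\<lambda>x. u x $ i) \<in> H1_0 \<Omega>" and u1: "\<And>i. (\<lambda>x y. u\<^sub>1 x y $ i) \<in> L2_H1_per \<Omega> S"
    and \<phi>: "\<phi> \<in> H1_0 \<Omega>" and \<phi>1: "\<phi>\<^sub>1 \<in> L2_H1_per \<Omega> S"
    and macro: "\<And>i. weak_neg_div \<Omega> (\<lambda>j x. \<integral>y. ?\<sigma> i j x y \<partial>?M) (\<lambda>x. \<theta> * f x $ i)"
      "weak_neg_div \<Omega> (\<lambda>i x. \<integral>y. ?D i x y \<partial>?M) (\<lambda>x. 0)"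
    and micro: "\<And>i. weak_neg_div_two_scale \<Omega> S (\<lambda>j. ?\<sigma> i j)" "weak_neg_div_two_scale \<Omega> S ?D"
    using two_scale unfolding two_scale_solution_def Let_def \<theta>_def by blast+
  note flux = two_scale_flux[OF \<Omega>(1) \<Omega>m S coefficients H1_0_imp_H1[OF u] H1_0_imp_H1[OF \<phi>] u1 \<phi>1]
  have "AE x in lebesgue_on \<Omega>. weak_neg_div_cell S (\<lambda>j. ?\<sigma> i j x)" for i
    by (rule two_scale_localize[OF S \<Omega>m flux(1) micro(1)])
  then have cell_\<sigma>: "AE x in lebesgue_on \<Omega>. \<forall>i. weak_neg_div_cell S (\<lambda>j. ?\<sigma> i j x)" by (simp add: eventually_all_finite)
  have cell_D: "AE x in lebesgue_on \<Omega>. weak_neg_div_cell S (\<lambda>i. ?D i x)"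
    by (rule two_scale_localize[OF S \<Omega>m flux(2) micro(2)])
  have u1_AE: "AE x in lebesgue_on \<Omega>. \<forall>i. (\<lambda>y. u\<^sub>1 x y $ i) \<in> H1_per S"
    using u1 by (simp add: eventually_all_finite L2_H1_per_def)
  have \<phi>1_AE: "AE x in lebesgue_on \<Omega>. \<phi>\<^sub>1 x \<in> H1_per S" using \<phi>1 by (simp add: L2_H1_per_def)
  have w_AE: "AE x in lebesgue_on \<Omega>. \<forall>m h. strain_cell_solution S c e d x m h (w m h x) (p m h x)"
    using cell_w by (simp add: eventually_all_finite)
  have q_AE: "AE x in lebesgue_on \<Omega>. \<forall>n. potential_cell_solution S c e d x n (q n x) (\<psi> n x)"
    using cell_q by (simp add: eventually_all_finite)
  \<comment> \<open>From here on almost every \<open>x\<close> carries coefficients that are good at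
    all \<open>y\<close>, together with all twelve cell solutions.\<close>
  have cor: "AE x in lebesgue_on \<Omega>. piezo_correctors S c e d \<alpha>\<^sub>c \<alpha>\<^sub>d x (corrector w q x) (corrector p \<psi> x)"
    using piezo_coefficients_AE[OF coefficients fmeasurableD[OF \<Omega>m]] w_AE q_AE
  proof eventually_elim
    case (elim x)
    have "piezo_cell S c e d \<alpha>\<^sub>c \<alpha>\<^sub>d x" by unfold_locales (use material elim(1) pos in blast)+
    then show ?case by (rule piezo_correctorsI) (use elim(2,3) in blast)+
  qed
  have laws: "AE x in lebesgue_on \<Omega>. (\<forall>i j. (\<integral>y. ?\<sigma> j i x y \<partial>?M) = hom_stress \<Omega> cH eH u \<phi> i j x) \<and>
      (\<forall>i. (\<integral>y. ?D i x y \<partial>?M) = hom_elec_disp \<Omega> eH dH u \<phi> i x)"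
    using cor cell_\<sigma> cell_D u1_AE \<phi>1_AE
  proof eventually_elim
    case (elim x)
    show ?case
      unfolding cH_def eH_def dH_def
      using average_flux_eq_homogenized[OF elim(1), of "u\<^sub>1 x" "\<phi>\<^sub>1 x" \<Omega> u \<phi>] elim(2-5) by blast
  qed
  have "AE x in lebesgue_on \<Omega>. (\<integral>y. ?\<sigma> j i x y \<partial>?M) = hom_stress \<Omega> cH eH u \<phi> i j x" for i j
    using laws by eventually_elim blast
  from weak_neg_div_AE[OF \<Omega>(1) macro(1) this]
  have hom1: "weak_neg_div \<Omega> (\<lambda>i. hom_stress \<Omega> cH eH u \<phi> i j) (\<lambda>x. \<theta> * f x $ j)" for j .
  have "AE x in lebesgue_on \<Omega>. (\<integral>y. ?D i x y \<partial>?M) = hom_elec_disp \<Omega> eH dH u \<phi> i x" for i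
    using laws by eventually_elim blast
  from weak_neg_div_AE[OF \<Omega>(1) macro(2) this]
  have hom2: "weak_neg_div \<Omega> (hom_elec_disp \<Omega> eH dH u \<phi>) (\<lambda>x. 0)" .
  have solution: "homogenized_solution \<Omega> \<theta> f cH eH dH u \<phi>"
    unfolding homogenized_solution_def using u \<phi> hom1 hom2 by blast
  have "AE x in lebesgue_on \<Omega>. u' x = u x \<and> \<phi>' x = \<phi> x"
    if sol': "homogenized_solution \<Omega> \<theta> f cH eH dH u' \<phi>'" for u' \<phi>'
  proof -
    let ?s = "\<lambda>i j x. hom_stress \<Omega> cH eH u' \<phi>' i j x - hom_stress \<Omega> cH eH u \<phi> i j x"
    let ?t = "\<lambda>i x. hom_elec_disp \<Omega> eH dH u' \<phi>' i x - hom_elec_disp \<Omega> eH dH u \<phi> i x"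
    have u': "\<And>i. (\<lambda>x. u' x $ i) \<in> H1_0 \<Omega>" and \<phi>': "\<phi>' \<in> H1_0 \<Omega>"
      and hom': "\<And>j. weak_neg_div \<Omega> (\<lambda>i. hom_stress \<Omega> cH eH u' \<phi>' i j) (\<lambda>x. \<theta> * f x $ j)"
        "weak_neg_div \<Omega> (hom_elec_disp \<Omega> eH dH u' \<phi>') (\<lambda>x. 0)"
      using sol' unfolding homogenized_solution_def by blast+
    \<comment> \<open>The two equations have the same right-hand side, so the flux difference
      annihilates every admissible gradient. Testing with \<open>v\<close> and \<open>v'\<close>
      separately keeps to their own chosen derivatives, since \<open>wderiv\<close> is additive only
      almost everywhere.\<close>
    have diff: "(\<integral>x. (\<Sum>i\<in>UNIV. (F i x - G i x) * (wderiv \<Omega> i v x - wderiv \<Omega> i v' x)) \<partial>lebesgue_on \<Omega>) = 0"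
      "integrable (lebesgue_on \<Omega>) (\<lambda>x. \<Sum>i\<in>UNIV. (F i x - G i x) * (wderiv \<Omega> i v x - wderiv \<Omega> i v' x))"
      if F: "weak_neg_div \<Omega> F g" and G: "weak_neg_div \<Omega> G g" and v: "v \<in> H1_0 \<Omega>" "v' \<in> H1_0 \<Omega>" for F G g v v'
    proof -
      have i: "integrable (lebesgue_on \<Omega>) (\<lambda>x. \<Sum>i\<in>UNIV. F i x * wderiv \<Omega> i v x)"
        if "weak_neg_div \<Omega> F g" "v \<in> H1_0 \<Omega>" for F v
        using that H1_wderiv(2)[OF \<Omega>(1) H1_0_imp_H1]
        by (intro Bochner_Integration.integrable_sum L2_on_integrable_mult) (auto simp: weak_neg_div_def)
      have e: "(\<lambda>x. \<Sum>i\<in>UNIV. (F i x - G i x) * (wderiv \<Omega> i v x - wderiv \<Omega> i v' x))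
        = (\<lambda>x. ((\<Sum>i\<in>UNIV. F i x * wderiv \<Omega> i v x) - (\<Sum>i\<in>UNIV. G i x * wderiv \<Omega> i v x))
           - ((\<Sum>i\<in>UNIV. F i x * wderiv \<Omega> i v' x) - (\<Sum>i\<in>UNIV. G i x * wderiv \<Omega> i v' x)))"
        by (simp add: fun_eq_iff left_diff_distrib right_diff_distrib sum_subtractf)
      show "(\<integral>x. (\<Sum>i\<in>UNIV. (F i x - G i x) * (wderiv \<Omega> i v x - wderiv \<Omega> i v' x)) \<partial>lebesgue_on \<Omega>) = 0"
        unfolding e using i[OF F v(1)] i[OF G v(1)] i[OF F v(2)] i[OF G v(2)] F G v by (simp add: weak_neg_div_def)
      show "integrable (lebesgue_on \<Omega>) (\<lambda>x. \<Sum>i\<in>UNIV. (F i x - G i x) * (wderiv \<Omega> i v x - wderiv \<Omega> i v' x))"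
        unfolding e by (intro Bochner_Integration.integrable_diff i F G v)
    qed
    note ds = diff[OF hom'(1) hom1 u' u] and dt = diff[OF hom'(2) hom2 \<phi>' \<phi>]
    \<comment> \<open>Testing the equation of component \<open>j\<close> with \<open>u' - u\<close>
      produces full gradients. The symmetry of the homogenized stress then allows replacing them by
      strains, which gives the form whose sign is known.\<close>
    define Q where "Q x = (\<Sum>j\<in>UNIV. \<Sum>i\<in>UNIV. ?s i j x * (wderiv \<Omega> i (\<lambda>z. u' z $ j) x - wderiv \<Omega> i (\<lambda>z. u z $ j) x))
      + (\<Sum>i\<in>UNIV. ?t i x * (wderiv \<Omega> i \<phi>' x - wderiv \<Omega> i \<phi> x))" for x
    have Qi: "integrable (lebesgue_on \<Omega>) Q"
      unfolding Q_def by (intro Bochner_Integration.integrable_add Bochner_Integration.integrable_sum ds(2) dt(2))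
    have Q0: "(\<integral>x. Q x \<partial>lebesgue_on \<Omega>) = 0"
      unfolding Q_def using ds dt by (simp add: Bochner_Integration.integral_sum)
    have Q_eq: "AE x in lebesgue_on \<Omega>. Q x = (\<Sum>i\<in>UNIV. \<Sum>j\<in>UNIV. ?s i j x * (strain \<Omega> u' i j x - strain \<Omega> u i j x))
      + (\<Sum>i\<in>UNIV. ?t i x * (wderiv \<Omega> i \<phi>' x - wderiv \<Omega> i \<phi> x))"
      using cor
    proof eventually_elim
      case (elim x)
      let ?a = "\<lambda>i j. wderiv \<Omega> i (\<lambda>z. u' z $ j) x - wderiv \<Omega> i (\<lambda>z. u z $ j) x"
      have sym: "?s i j x = ?s j i x" for i j
        using homogenized_difference_energy(3)[OF elim, of \<Omega> u \<phi> i j] homogenized_difference_energy(3)[OF elim, of \<Omega> u' \<phi>' i j]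
        by (simp add: cH_def eH_def)
      have "(\<Sum>i\<in>UNIV. \<Sum>j\<in>UNIV. ?s i j x * ?a j i) = (\<Sum>j\<in>UNIV. \<Sum>i\<in>UNIV. ?s i j x * ?a j i)" by (rule sum.swap)
      also have "\<dots> = (\<Sum>i\<in>UNIV. \<Sum>j\<in>UNIV. ?s i j x * ?a i j)"
        by (intro sum.cong refl arg_cong2[where f = "(*)"] sym)
      finally have t: "(\<Sum>i\<in>UNIV. \<Sum>j\<in>UNIV. ?s i j x * ?a j i) = (\<Sum>i\<in>UNIV. \<Sum>j\<in>UNIV. ?s i j x * ?a i j)" .
      have "strain \<Omega> u' i j x - strain \<Omega> u i j x = (?a i j + ?a j i) / 2" for i j
        by (simp add: strain_def diff_divide_distrib add_divide_distrib)
      then have "(\<Sum>i\<in>UNIV. \<Sum>j\<in>UNIV. ?s i j x * (strain \<Omega> u' i j x - strain \<Omega> u i j x))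
         = (\<Sum>i\<in>UNIV. \<Sum>j\<in>UNIV. ?s i j x * ((?a i j + ?a j i) / 2))" by (simp only:)
      also have "\<dots> = ((\<Sum>i\<in>UNIV. \<Sum>j\<in>UNIV. ?s i j x * ?a i j) + (\<Sum>i\<in>UNIV. \<Sum>j\<in>UNIV. ?s i j x * ?a j i)) / 2"
        by (simp only: distrib_left times_divide_eq_right sum_divide_distrib[symmetric] sum.distrib)
      also have "\<dots> = (\<Sum>i\<in>UNIV. \<Sum>j\<in>UNIV. ?s i j x * ?a i j)" unfolding t by simp
      also have "\<dots> = (\<Sum>j\<in>UNIV. \<Sum>i\<in>UNIV. ?s i j x * ?a i j)" by (rule sum.swap)
      finally show ?case by (simp add: Q_def)
    qed
    have "AE x in lebesgue_on \<Omega>. 0 \<le> Q x"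
      using cor Q_eq
    proof eventually_elim
      case (elim x)
      show ?case unfolding elim(2) cH_def eH_def dH_def by (rule homogenized_difference_energy(1)[OF elim(1)])
    qed
    \<comment> \<open>A nonnegative integrand with integral 0 vanishes almost everywhere;
      definiteness of the homogenized energy can then be used pointwise.\<close>
    then have "AE x in lebesgue_on \<Omega>. Q x = 0" using integral_nonneg_eq_0_iff_AE[OF Qi] Q0 by blast
    with cor Q_eq have eq: "AE x in lebesgue_on \<Omega>. (\<forall>k l. strain \<Omega> u' k l x = strain \<Omega> u k l x) \<and> (\<forall>k. wderiv \<Omega> k \<phi>' x = wderiv \<Omega> k \<phi> x)"
    proof eventually_elim
      case (elim x)
      show ?case
        by (rule homogenized_difference_energy(2)[OF elim(1)])
           (use elim(2,3) in \<open>simp add: cH_def eH_def dH_def\<close>)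
    qed
    have "AE x in lebesgue_on \<Omega>. strain \<Omega> u' k l x = strain \<Omega> u k l x" for k l
      using eq by eventually_elim blast
    from H1_0_strain_unique[OF \<Omega> u' u this] have "AE x in lebesgue_on \<Omega>. u' x = u x" .
    moreover have "AE x in lebesgue_on \<Omega>. wderiv \<Omega> k \<phi>' x = wderiv \<Omega> k \<phi> x" for k
      using eq by eventually_elim blast
    from H1_0_gradient_unique[OF \<Omega> \<phi>' \<phi> this] have "AE x in lebesgue_on \<Omega>. \<phi>' x = \<phi> x" .
    ultimately show ?thesis by eventually_elim blast
  qed
  with solution show ?thesis by blast
qed

end
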